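(* Let $n\ge 1$ and let $X$ be any almost complex manifold of complex dimension $n$. Then the differential relation $\mathcal{R}_I\subset J^1(X,Z)$ admits a formal solution, i.e. there exists a section of $J^1(X,Z)\to X$ whose image lies in $\mathcal{R}_I$.
   Context: Dimensions are complex unless stated otherwise; Grassmannians $Gr(k,V)$ consist of complex $k$-planes in a complex vector space $V$, and $Gr(k,m)=Gr(k,\mathbb{C}^m)$. Universal space (Demailly–Gaussier). $Z$ is the set of tuples $(z,S',S'',\Sigma',\Sigma'')\in \mathbb{C}^{8n}\times Gr(3n,8n)^2\times Gr(4n,8n)^2$ with $S'\subset\Sigma'$, $S''\subset\Sigma''$, $\Sigma'\oplus\Sigma''=\mathbb{C}^{8n}$. It is a smooth complex variety of dimension $N=38n^2+8n$ with complex structure $J_Z$. The distribution $D\subset TZ$ is, at $P=(z,S',S'',\Sigma',\Sigma'')$, the set of tangent vectors $(v,u',u'',w',w'')\in T_PZ$ whose $\mathbb{C}^{8n}$-component $v$ lies in $S'\oplus\Sigma''$. It is a holomorphic subbundle of corank $n$, with $T_PZ/D_P\cong\Sigma'/S'$. Write $J_{TZ/D}$ for the complex structure induced on $TZ/D$. Torsion and isotropy locus. The torsion tensor of $D$ is $\theta:D\times D\to TZ/D$, $\theta(\xi,\eta)=[\xi,\eta]\bmod D$. $Gr(n,D)\to Z$ is the bundle of complex $n$-planes in the fibers of $D$, and $I\subset Gr(n,D)$ is the set of $n$-planes $S$ with $\theta|_{S\times S}=0$. Relation. $J^1(X,Z)$ is the space of 1-jets of maps $X\to Z$; its elements are triples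 $(x,z,L)$ with $x\in X$, $z\in Z$, $L\in \mathrm{Hom}_{\mathbb{R}}(T_xX,T_zZ)$. $\mathcal{R}_{ac}\subset J^1(X,Z)$ is the set of $(x,z,L)$ such that $L$ is injective, totally real ($L(T_xX)\cap J_Z(L(T_xX))=0$) and transverse to $D$ (the composite $T_xX\to T_zZ\to T_zZ/D_z$ is surjective, hence an $\mathbb{R}$-linear isomorphism $\bar L$). For such $L$ put $J_L=\bar L^{-1}\circ J_{TZ/D}\circ\bar L$ and $\overline{\partial}L=\tfrac12(L+J_Z\circ L\circ J_L)$; then $\overline{\partial}L$ is injective with image a complex $n$-plane in $D_z$. $\mathcal{R}_I\subset\mathcal{R}_{ac}$ is the set of $(x,z,L)$ with $\overline{\partial}L(T_xX)\in I$. *)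

theory Defs
  imports "HOL-Analysis.Analysis"
begin

section \<open>Smooth manifolds, tangent spaces and 1-jets\<close>

text \<open>Smoothness on an open subset of a Euclidean space, through iterated Frechet derivatives.\<close>

primrec Ck_on :: "nat \<Rightarrow> 'e::euclidean_space set \<Rightarrow> ('e \<Rightarrow> 'f::real_normed_vector) \<Rightarrow> bool" where
  "Ck_on 0 S f \<longleftrightarrow> continuous_on S f"
| "Ck_on (Suc k) S f \<longleftrightarrow> (\<forall>y\<in>S. f differentiable (at y)) \<and>
     (\<forall>e. Ck_on k S (\<lambda>y. frechet_derivative f (at y) e))"

definition smooth_on :: "'e::euclidean_space set \<Rightarrow> ('e \<Rightarrow> 'f::real_normed_vector) \<Rightarrow> bool" where
  "smooth_on S f \<longleftrightarrow> (\<forall>k. Ck_on k S f)"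

text \<open>A chart is a pair (domain, coordinate map); an atlas is a set of charts. The values of a
  coordinate map outside the domain of the chart play no role.\<close>

type_synonym ('a, 'e) chart = "'a set \<times> ('a \<Rightarrow> 'e)"

definition chart_inv :: "('a, 'e) chart \<Rightarrow> 'e \<Rightarrow> 'a" where
  "chart_inv c = inv_into (fst c) (snd c)"

definition transition :: "('a, 'e) chart \<Rightarrow> ('a, 'e) chart \<Rightarrow> 'e \<Rightarrow> 'e" where
  "transition c d = snd d \<circ> chart_inv c"

definition carrier_of :: "('a, 'e) chart set \<Rightarrow> 'a set" where
  "carrier_of A = (\<Union>c\<in>A. fst c)"

text \<open>The topology for which the charts of an atlas are homeomorphisms onto open sets.\<close>

definition chart_topology :: "('a, 'e::topological_space) chart set \<Rightarrow> 'a topology" where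
  "chart_topology A = topology_generated_by {fst c \<inter> snd c -` O' | c O'. c \<in> A \<and> open O'}"

definition smooth_manifold :: "'a topology \<Rightarrow> ('a, 'e::euclidean_space) chart set \<Rightarrow> bool" where
  "smooth_manifold X A \<longleftrightarrow>
     Hausdorff_space X \<and> second_countable X \<and> topspace X = carrier_of A \<and>
     (\<forall>c\<in>A. openin X (fst c) \<and> open (snd c ` fst c) \<and>
        homeomorphic_map (subtopology X (fst c)) (top_of_set (snd c ` fst c)) (snd c)) \<and>
     (\<forall>c\<in>A. \<forall>d\<in>A. smooth_on (snd c ` (fst c \<inter> fst d)) (transition c d))"

text \<open>A tangent vector at \<open>x\<close> is the family of its coordinate representations in all the charts
  around \<open>x\<close>; these are related by the differentials of the transition maps. In charts not around
  \<open>x\<close> the entry is 0. Vector space operations are pointwise.\<close>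

type_synonym ('a, 'e) tvec = "('a, 'e) chart \<Rightarrow> 'e"

definition tangent_space ::
  "('a, 'e::euclidean_space) chart set \<Rightarrow> 'a \<Rightarrow> ('a, 'e) tvec set" where
  "tangent_space A x = {v.
     (\<forall>c. \<not> (c \<in> A \<and> x \<in> fst c) \<longrightarrow> v c = 0) \<and>
     (\<forall>c\<in>A. \<forall>d\<in>A. x \<in> fst c \<longrightarrow> x \<in> fst d \<longrightarrow>
        v d = frechet_derivative (transition c d) (at (snd c x)) (v c))}"

text \<open>The tangent vector at \<open>x\<close> with coordinates \<open>e\<close> in the chart \<open>c\<close>.\<close>

definition tvec_of ::
  "('a, 'e::euclidean_space) chart set \<Rightarrow> 'a \<Rightarrow> ('a, 'e) chart \<Rightarrow> 'e \<Rightarrow> ('a, 'e) tvec" where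
  "tvec_of A x c e = (\<lambda>d. if d \<in> A \<and> x \<in> fst d
     then frechet_derivative (transition c d) (at (snd c x)) e else 0)"

definition tangent_hom ::
  "('a, 'e::euclidean_space) chart set \<Rightarrow> 'a \<Rightarrow> ('b, 'f::euclidean_space) chart set \<Rightarrow> 'b \<Rightarrow>
     (('a, 'e) tvec \<Rightarrow> ('b, 'f) tvec) set" where
  "tangent_hom A x B z = {L \<in> tangent_space A x \<rightarrow>\<^sub>E tangent_space B z.
     (\<forall>v\<in>tangent_space A x. \<forall>w\<in>tangent_space A x.
        L (\<lambda>c. v c + w c) = (\<lambda>d. L v d + L w d)) \<and>
     (\<forall>r::real. \<forall>v\<in>tangent_space A x. L (\<lambda>c. r *\<^sub>R v c) = (\<lambda>d. r *\<^sub>R L v d))}"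

type_synonym ('a, 'e, 'b, 'f) jet = "'a \<times> 'b \<times> (('a, 'e) tvec \<Rightarrow> ('b, 'f) tvec)"

definition jet1 :: "('a, 'e::euclidean_space) chart set \<Rightarrow> ('b, 'f::euclidean_space) chart set \<Rightarrow>
    ('a, 'e, 'b, 'f) jet set" where
  "jet1 A B = {(x, z, L). x \<in> carrier_of A \<and> z \<in> carrier_of B \<and> L \<in> tangent_hom A x B z}"

definition jet_chart :: "('a, 'e::euclidean_space) chart set \<Rightarrow>
    ('b, 'f::euclidean_space) chart set \<Rightarrow> ('a, 'e) chart \<Rightarrow> ('b, 'f) chart \<Rightarrow>
    (('a, 'e, 'b, 'f) jet, 'e \<times> 'f \<times> ('e \<Rightarrow>\<^sub>L 'f)) chart" where
  "jet_chart A B c d =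
     ({(x, z, L) \<in> jet1 A B. x \<in> fst c \<and> z \<in> fst d},
      \<lambda>(x, z, L). (snd c x, snd d z, Blinfun (\<lambda>e. L (tvec_of A x c e) d)))"

definition jet_topology :: "('a, 'e::euclidean_space) chart set \<Rightarrow>
    ('b, 'f::euclidean_space) chart set \<Rightarrow> ('a, 'e, 'b, 'f) jet topology" where
  "jet_topology A B = chart_topology {jet_chart A B c d | c d. c \<in> A \<and> d \<in> B}"

text \<open>A formal solution of a differential relation \<open>R\<close> is a continuous section of the 1-jet bundle
  with image in \<open>R\<close>.\<close>

definition formal_solution :: "'a topology \<Rightarrow> ('a, 'e::euclidean_space) chart set \<Rightarrow>
    ('b, 'f::euclidean_space) chart set \<Rightarrow> ('a, 'e, 'b, 'f) jet set \<Rightarrow>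
    ('a \<Rightarrow> ('a, 'e, 'b, 'f) jet) \<Rightarrow> bool" where
  "formal_solution X A B R \<sigma> \<longleftrightarrow>
     continuous_map X (jet_topology A B) \<sigma> \<and>
     (\<forall>x\<in>topspace X. fst (\<sigma> x) = x) \<and>
     (\<forall>x\<in>topspace X. \<sigma> x \<in> R)"

definition almost_complex_structure :: "('a, 'e::euclidean_space) chart set \<Rightarrow>
    ('a \<Rightarrow> ('a, 'e) tvec \<Rightarrow> ('a, 'e) tvec) \<Rightarrow> bool" where
  "almost_complex_structure A J \<longleftrightarrow>
     (\<forall>x\<in>carrier_of A. J x \<in> tangent_hom A x A x \<and>
        (\<forall>v\<in>tangent_space A x. J x (J x v) = (\<lambda>c. - v c))) \<and>
     (\<forall>c\<in>A. \<forall>e. smooth_on (snd c ` fst c)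
        (\<lambda>y. J (chart_inv c y) (tvec_of A (chart_inv c y) c e) c))"

definition almost_complex_manifold :: "'a topology \<Rightarrow> ('a, 'e::euclidean_space) chart set \<Rightarrow>
    ('a \<Rightarrow> ('a, 'e) tvec \<Rightarrow> ('a, 'e) tvec) \<Rightarrow> bool" where
  "almost_complex_manifold X A J \<longleftrightarrow> smooth_manifold X A \<and> almost_complex_structure A J"


section \<open>Distributions, Lie bracket and torsion\<close>

type_synonym ('a, 'e) vfield = "'a \<Rightarrow> ('a, 'e) tvec"
type_synonym ('a, 'e) distrib = "'a \<Rightarrow> ('a, 'e) tvec set"

definition in_chart :: "('a, 'e) chart \<Rightarrow> ('a, 'e) vfield \<Rightarrow> 'e \<Rightarrow> 'e" where
  "in_chart c \<xi> y = \<xi> (chart_inv c y) c"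

definition local_section :: "('a, 'e::euclidean_space) chart set \<Rightarrow> ('a, 'e) distrib \<Rightarrow>
    'a set \<Rightarrow> ('a, 'e) vfield \<Rightarrow> bool" where
  "local_section B D W \<xi> \<longleftrightarrow> openin (chart_topology B) W \<and> (\<forall>q\<in>W. \<xi> q \<in> D q) \<and>
     (\<forall>c\<in>B. smooth_on (snd c ` (W \<inter> fst c)) (in_chart c \<xi>))"

definition lie_bracket :: "('a, 'e::euclidean_space) chart set \<Rightarrow> ('a, 'e) vfield \<Rightarrow>
    ('a, 'e) vfield \<Rightarrow> ('a, 'e) vfield" where
  "lie_bracket B \<xi> \<eta> P = (\<lambda>c. if c \<in> B \<and> P \<in> fst c
     then frechet_derivative (in_chart c \<eta>) (at (snd c P)) (\<xi> P c)
        - frechet_derivative (in_chart c \<xi>) (at (snd c P)) (\<eta> P c)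
     else 0)"

text \<open>The fibre at \<open>P\<close> of the quotient bundle \<open>T/D\<close>, its elements being cosets of \<open>D P\<close>.\<close>

definition quot_class :: "('a, 'e::euclidean_space) chart set \<Rightarrow> ('a, 'e) distrib \<Rightarrow> 'a \<Rightarrow>
    ('a, 'e) tvec \<Rightarrow> ('a, 'e) tvec set" where
  "quot_class B D P \<xi> = {\<zeta> \<in> tangent_space B P. (\<lambda>c. \<zeta> c - \<xi> c) \<in> D P}"

definition quot_space :: "('a, 'e::euclidean_space) chart set \<Rightarrow> ('a, 'e) distrib \<Rightarrow> 'a \<Rightarrow>
    ('a, 'e) tvec set set" where
  "quot_space B D P = quot_class B D P ` tangent_space B P"

text \<open>The torsion: for \<open>\<xi>, \<eta>\<close> in \<open>D P\<close>, the class modulo \<open>D P\<close> of the bracket at \<open>P\<close> of any local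
  sections of \<open>D\<close> extending \<open>\<xi>\<close> and \<open>\<eta>\<close>.\<close>

definition torsion :: "('a, 'e::euclidean_space) chart set \<Rightarrow> ('a, 'e) distrib \<Rightarrow> 'a \<Rightarrow>
    ('a, 'e) tvec \<Rightarrow> ('a, 'e) tvec \<Rightarrow> ('a, 'e) tvec set" where
  "torsion B D P \<xi> \<eta> = (THE q. \<exists>W \<xi>' \<eta>'. P \<in> W \<and>
     local_section B D W \<xi>' \<and> local_section B D W \<eta>' \<and> \<xi>' P = \<xi> \<and> \<eta>' P = \<eta> \<and>
     q = quot_class B D P (lie_bracket B \<xi>' \<eta>' P))"


section \<open>The universal space\<close>

text \<open>The complex dimension is \<open>n = CARD('n)\<close>; the spaces \<open>\<complex>\<^sup>k\<^sup>n\<close> are indexed by \<open>'n \<times> k\<close>.\<close>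

type_synonym 'n amb = "complex ^ ('n \<times> 8)"

type_synonym 'n zpoint = "'n amb \<times> 'n amb set \<times> 'n amb set \<times> 'n amb set \<times> 'n amb set"

definition grassmannian :: "nat \<Rightarrow> (complex ^ 'm::finite) set set" where
  "grassmannian k = {S. vec.subspace S \<and> vec.dim S = k}"

definition ssum :: "'v::plus set \<Rightarrow> 'v set \<Rightarrow> 'v set" where
  "ssum S T = {s + t | s t. s \<in> S \<and> t \<in> T}"

definition Z_space :: "'n::finite zpoint set" where
  "Z_space = {(z, S1, S2, T1, T2).
     S1 \<in> grassmannian (3 * CARD('n)) \<and> S2 \<in> grassmannian (3 * CARD('n)) \<and>
     T1 \<in> grassmannian (4 * CARD('n)) \<and> T2 \<in> grassmannian (4 * CARD('n)) \<and>
     S1 \<subseteq> T1 \<and> S2 \<subseteq> T2 \<and> T1 \<inter> T2 = {0} \<and> ssum T1 T2 = UNIV}"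

text \<open>Holomorphic charts of the manifold of flags \<open>S \<subseteq> T\<close> with \<open>dim S = 3n\<close> and \<open>dim T = 4n\<close>, by
  graphs. A frame \<open>(a, b, c)\<close> splits \<open>\<complex>\<^sup>8\<^sup>n\<close> as \<open>\<complex>\<^sup>3\<^sup>n \<oplus> \<complex>\<^sup>n \<oplus> \<complex>\<^sup>4\<^sup>n\<close>. In this splitting the flag with
  coordinates \<open>(K, M, E)\<close> has \<open>S\<close> the graph of \<open>(K, M) : \<complex>\<^sup>3\<^sup>n \<rightarrow> \<complex>\<^sup>n \<oplus> \<complex>\<^sup>4\<^sup>n\<close> and \<open>T\<close> the sum of \<open>S\<close>
  and the graph of \<open>E : \<complex>\<^sup>n \<rightarrow> \<complex>\<^sup>4\<^sup>n\<close>.\<close>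

type_synonym 'n frame =
  "(complex ^ ('n \<times> 3) ^ ('n \<times> 8)) \<times> (complex ^ 'n ^ ('n \<times> 8)) \<times> (complex ^ ('n \<times> 4) ^ ('n \<times> 8))"

type_synonym 'n fcoord =
  "(complex ^ ('n \<times> 3) ^ 'n) \<times> (complex ^ ('n \<times> 3) ^ ('n \<times> 4)) \<times> (complex ^ 'n ^ ('n \<times> 4))"

definition is_frame :: "'n::finite frame \<Rightarrow> bool" where
  "is_frame = (\<lambda>(a, b, c). bij (\<lambda>(s, q, t). a *v s + b *v q + c *v t))"

definition flag_sub :: "'n::finite frame \<Rightarrow> 'n fcoord \<Rightarrow> 'n amb set" where
  "flag_sub = (\<lambda>(a, b, c) (K, M, E). range ((*v) (a + b ** K + c ** M)))"

definition flag_sup :: "'n::finite frame \<Rightarrow> 'n fcoord \<Rightarrow> 'n amb set" where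
  "flag_sup = (\<lambda>(a, b, c) (K, M, E).
     ssum (flag_sub (a, b, c) (K, M, E)) (range ((*v) (b + c ** E))))"

text \<open>Coordinates on \<open>Z\<close>: the base point and the coordinates of the two flags. The model space has
  complex dimension \<open>8n + 2 (3n\<^sup>2 + 12n\<^sup>2 + 4n\<^sup>2) = 38n\<^sup>2 + 8n\<close>.\<close>

type_synonym 'n zmodel = "'n amb \<times> 'n fcoord \<times> 'n fcoord"

definition Z_param :: "'n::finite frame \<Rightarrow> 'n frame \<Rightarrow> 'n zmodel \<Rightarrow> 'n zpoint" where
  "Z_param f g = (\<lambda>(z, u, w). (z, flag_sub f u, flag_sub g w, flag_sup f u, flag_sup g w))"

definition Z_atlas :: "('n::finite zpoint, 'n zmodel) chart set" where
  "Z_atlas = {(Z_space \<inter> range (Z_param f g), inv (Z_param f g)) | f g. is_frame f \<and> is_frame g}"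

text \<open>The parametrizations are injective, and the charts cover \<open>Z\<close>.\<close>

lemma flag_sub_mem:
  "flag_sub (a, b, c) (K, M, E) = {a *v s + b *v (K *v s) + c *v (M *v s) | s. True}"
  by (auto simp: flag_sub_def matrix_vector_mult_add_rdistrib matrix_vector_mul_assoc[symmetric])

lemma flag_sup_mem:
  "flag_sup (a, b, c) (K, M, E) =
    {a *v s + b *v (K *v s + q) + c *v (M *v s + E *v q) | s q. True}"
proof -
  have "flag_sup (a, b, c) (K, M, E) =
    {(a *v s + b *v (K *v s) + c *v (M *v s)) + (b *v q + c *v (E *v q)) | s q. True}"
    unfolding flag_sup_def ssum_def prod.case flag_sub_mem
    by (auto simp: matrix_vector_mult_add_rdistrib matrix_vector_mul_assoc[symmetric])
  thus ?thesis by (simp add: matrix_vector_right_distrib algebra_simps)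
qed

lemma flag_coords_unique:
  assumes f: "is_frame f" and 1: "flag_sub f u = flag_sub f w" and 2: "flag_sup f u = flag_sup f w"
  shows "u = w"
proof -
  obtain a b c where [simp]: "f = (a,b,c)" by (cases f)
  obtain K M E where [simp]: "u = (K,M,E)" by (cases u)
  obtain K' M' E' where [simp]: "w = (K',M',E')" by (cases w)
  have uniq: "s = s' \<and> q = q' \<and> t = t'"
    if "a *v s + b *v q + c *v t = a *v s' + b *v q' + c *v t'" for s s' q q' t t'
  proof -
    have "inj (\<lambda>(s, q, t). a *v s + b *v q + c *v t)" using f by (auto simp: is_frame_def bij_def)
    from injD[OF this, of "(s,q,t)" "(s',q',t')"] that show ?thesis by simp
  qed
  have "K *v s = K' *v s \<and> M *v s = M' *v s" for s
  proof -
    have "a *v s + b *v (K *v s) + c *v (M *v s) \<in> flag_sub f w"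
      using 1[symmetric] by (auto simp: flag_sub_mem)
    then obtain s' where "a *v s + b *v (K *v s) + c *v (M *v s) =
      a *v s' + b *v (K' *v s') + c *v (M' *v s')"
      by (auto simp: flag_sub_mem)
    from uniq[OF this] show ?thesis by auto
  qed
  hence KM: "K = K'" "M = M'" by (auto simp: matrix_eq)
  have "E *v q = E' *v q" for q
  proof -
    have "a *v 0 + b *v (K *v 0 + q) + c *v (M *v 0 + E *v q) \<in> flag_sup f w"
      unfolding 2[symmetric] by (simp only: flag_sup_mem \<open>f = _\<close> \<open>u = _\<close>) blast
    then obtain s' q' where "a *v 0 + b *v (K *v 0 + q) + c *v (M *v 0 + E *v q) =
      a *v s' + b *v (K' *v s' + q') + c *v (M' *v s' + E' *v q')"
      by (auto simp: flag_sup_mem)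
    from uniq[OF this] show ?thesis by auto
  qed
  thus ?thesis using KM by (auto simp: matrix_eq)
qed

lemma inj_Z_param:
  assumes "is_frame f" "is_frame g"
  shows "inj (Z_param f g)"
proof (rule injI)
  fix p p' assume eq: "Z_param f g p = Z_param f g p'"
  obtain z u w z' u' w' where p: "p = (z, u, w)" "p' = (z', u', w')" by (cases p; cases p')
  show "p = p'"
    using eq flag_coords_unique[OF assms(1), of u u'] flag_coords_unique[OF assms(2), of w w']
    by (simp add: Z_param_def p)
qed

lemma DIM_zmodel: "DIM('n::finite zmodel) = 2 * (38 * CARD('n)^2 + 8 * CARD('n))"
  by (simp add: power2_eq_square algebra_simps)

lemma columns_matrix:
  fixes h :: "'k::finite \<Rightarrow> complex ^ 'm::finite"
  shows "(\<chi> i j. h j $ i) *v x = (\<Sum>j\<in>UNIV. x $ j *s h j)"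
  by (simp add: matrix_vector_mult_def vec_eq_iff mult.commute)

lemma span_columns:
  fixes h :: "'k::finite \<Rightarrow> complex ^ 'm::finite"
  shows "range ((*v) (\<chi> i j. h j $ i)) = vec.span (range h)"
proof -
  have "vec.span (range h) = range (\<lambda>x. \<Sum>j\<in>UNIV. x j *s h j)"
  proof safe
    fix y assume "y \<in> vec.span (range h)"
    thus "y \<in> range (\<lambda>x. \<Sum>j\<in>UNIV. x j *s h j)"
    proof (induction rule: vec.span_induct_alt)
      case base show ?case by (rule range_eqI[of _ _ "\<lambda>_. 0"]) simp
    next
      case (step k v y)
      then obtain j x where "v = h j" "y = (\<Sum>j\<in>UNIV. x j *s h j)" by auto
      moreover have "k *s h j + (\<Sum>j\<in>UNIV. x j *s h j) = (\<Sum>i\<in>UNIV. (x i + (if i = j then k else 0)) *s h i)"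
        by (simp add: vec.scale_left_distrib sum.distrib if_distrib[where f="\<lambda>k. k *s _"] sum.delta cong: if_cong)
      ultimately show ?case by (intro range_eqI[of _ _ "\<lambda>i. x i + (if i = j then k else 0)"]) simp
    qed
  next
    fix x show "(\<Sum>j\<in>UNIV. x j *s h j) \<in> vec.span (range h)"
      by (intro vec.span_sum vec.span_scale vec.span_base) auto
  qed
  also have "\<dots> = range (\<lambda>x. \<Sum>j\<in>UNIV. (x :: complex^'k) $ j *s h j)"
  proof safe
    fix x :: "'k \<Rightarrow> complex"
    show "(\<Sum>j\<in>UNIV. x j *s h j) \<in> range (\<lambda>x. \<Sum>j\<in>UNIV. (x :: complex^'k) $ j *s h j)"
      by (rule range_eqI[of _ _ "\<chi> j. x j"]) simp
  qed auto
  finally show ?thesis by (simp add: columns_matrix)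
qed

lemma adapted_frame:
  fixes S T :: "'n::finite amb set"
  assumes S: "S \<in> grassmannian (3 * CARD('n))" and T: "T \<in> grassmannian (4 * CARD('n))"
    and ST: "S \<subseteq> T"
  obtains f where "is_frame f" "flag_sub f (0, 0, 0) = S" "flag_sup f (0, 0, 0) = T"
proof -
  have sS: "vec.subspace S" "vec.dim S = 3 * CARD('n)" and sT: "vec.subspace T" "vec.dim T = 4 * CARD('n)"
    using S T by (auto simp: grassmannian_def)
  obtain B1 where B1: "B1 \<subseteq> S" "vec.independent B1" "S \<subseteq> vec.span B1" "card B1 = 3 * CARD('n)"
    using vec.basis_exists[of S] sS by metis
  obtain B2 where B2: "B1 \<subseteq> B2" "B2 \<subseteq> T" "vec.independent B2" "T \<subseteq> vec.span B2"
    using vec.maximal_independent_subset_extend[of B1 T] B1 ST by (metis order_trans)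
  obtain B3 :: "'n amb set" where B3: "B2 \<subseteq> B3" "vec.independent B3" "UNIV \<subseteq> vec.span B3"
    using vec.maximal_independent_subset_extend[of B2 UNIV] B2 by (metis subset_UNIV)
  have fin: "finite B3" "finite B2" "finite B1"
    using vec.finiteI_independent B1 B2 B3 by auto
  have sp1: "vec.span B1 = S" using B1 sS by (meson vec.span_minimal subset_antisym)
  have sp2: "vec.span B2 = T" using B2 sT by (meson vec.span_minimal subset_antisym)
  have c2: "card B2 = 4 * CARD('n)" using B2 sT vec.dim_span_eq_card_independent sp2 by metis
  have sp3: "vec.span B3 = UNIV" using B3 by auto
  have "vec.dim (UNIV :: 'n amb set) = CARD('n \<times> 8)" by (rule vec_dim_card)
  then have c3: "card B3 = 8 * CARD('n)"
    using B3 vec.dim_span_eq_card_independent[of B3] sp3 by (simp add: mult.commute)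
  obtain ha :: "'n \<times> 3 \<Rightarrow> 'n amb" where ha: "bij_betw ha UNIV B1"
    using finite_same_card_bij[of "UNIV :: ('n \<times> 3) set" B1] B1 fin by (auto simp: mult.commute)
  obtain hb :: "'n \<Rightarrow> 'n amb" where hb: "bij_betw hb UNIV (B2 - B1)"
    using finite_same_card_bij[of "UNIV :: 'n set" "B2 - B1"] B1 B2 c2 fin by (auto simp: card_Diff_subset)
  obtain hc :: "'n \<times> 4 \<Rightarrow> 'n amb" where hc: "bij_betw hc UNIV (B3 - B2)"
    using finite_same_card_bij[of "UNIV :: ('n \<times> 4) set" "B3 - B2"] B3 c2 c3 fin by (auto simp: card_Diff_subset mult.commute)
  define a :: "complex ^ ('n \<times> 3) ^ ('n \<times> 8)" where "a = (\<chi> i j. ha j $ i)"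
  define b :: "complex ^ 'n ^ ('n \<times> 8)" where "b = (\<chi> i j. hb j $ i)"
  define c :: "complex ^ ('n \<times> 4) ^ ('n \<times> 8)" where "c = (\<chi> i j. hc j $ i)"
  have ra: "range ((*v) a) = vec.span B1" unfolding a_def span_columns using ha by (simp add: bij_betw_def)
  have rb: "range ((*v) b) = vec.span (B2 - B1)" unfolding b_def span_columns using hb by (simp add: bij_betw_def)
  have rc: "range ((*v) c) = vec.span (B3 - B2)" unfolding c_def span_columns using hc by (simp add: bij_betw_def)
  have T_eq: "T = ssum (vec.span B1) (vec.span (B2 - B1))"
    unfolding sp2[symmetric] ssum_def using vec.span_Un[of B1 "B2 - B1"] B2(1) by (simp add: Un_absorb1 Un_commute)
  define h where "h = (\<lambda>k. case k of Inl i \<Rightarrow> ha i | Inr (Inl i) \<Rightarrow> hb i | Inr (Inr i) \<Rightarrow> hc i)"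
  have h_comb: "(\<Sum>k\<in>UNIV. x k *s h k) = a *v (\<chi> i. x (Inl i)) + b *v (\<chi> i. x (Inr (Inl i)))
      + c *v (\<chi> i. x (Inr (Inr i)))" for x
    by (simp add: UNIV_Plus_UNIV[symmetric] sum.Plus a_def b_def c_def columns_matrix h_def add.assoc
        del: UNIV_Plus_UNIV)
  have h: "bij_betw h UNIV B3"
  proof -
    have "inj h"
    proof (rule injI)
      fix k k' assume eq: "h k = h k'"
      have A: "ha i \<in> B1" "hb j \<in> B2" "hb j \<notin> B1" "hc l \<notin> B2" "hc l \<notin> B1" for i j l
        using bij_betw_apply[OF ha, of i] bij_betw_apply[OF hb, of j] bij_betw_apply[OF hc, of l] B2(1)
        by auto
      have I: "ha i = ha i' \<longleftrightarrow> i = i'" "hb j = hb j' \<longleftrightarrow> j = j'" "hc l = hc l' \<longleftrightarrow> l = l'"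
        for i i' j j' l l'
        using ha hb hc by (simp_all add: bij_betw_def inj_eq)
      have N: "ha i \<noteq> hb j" "hb j \<noteq> ha i" "ha i \<noteq> hc l" "hc l \<noteq> ha i" "hb j \<noteq> hc l" "hc l \<noteq> hb j" for i j l
        using A B2(1) by metis+
      show "k = k'" using eq by (simp add: h_def I N split: sum.splits)
    qed
    moreover have "range h = range ha \<union> (range hb \<union> range hc)"
      by (simp add: UNIV_sum h_def image_Un image_image)
    then have "range h = B1 \<union> ((B2 - B1) \<union> (B3 - B2))"
      using ha hb hc by (simp add: bij_betw_def)
    then have "range h = B3" using B2(1) B3(1) by blast
    ultimately show ?thesis by (simp add: bij_betw_def)
  qed
  have zero: "x k = 0" if "(\<Sum>k\<in>UNIV. x k *s h k) = 0" for x k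
  proof -
    have "(\<Sum>v\<in>B3. x (inv h v) *s v) = 0"
      using that h by (subst sum.reindex_bij_betw[OF h, symmetric]) (simp add: bij_betw_def)
    then have "x (inv h (h k)) = 0"
      using vec.independentD[OF B3(2) fin(1) subset_refl, of "\<lambda>v. x (inv h v)" "h k"] h
      by (auto simp: bij_betw_def)
    then show ?thesis using h by (simp add: bij_betw_def)
  qed
  have inj: "s = s' \<and> q = q' \<and> t = t'"
    if "a *v s + b *v q + c *v t = a *v s' + b *v q' + c *v t'" for s s' q q' t t'
  proof -
    define x where "x = (\<lambda>k. case k of Inl i \<Rightarrow> (s - s') $ i | Inr (Inl i) \<Rightarrow> (q - q') $ i
      | Inr (Inr i) \<Rightarrow> (t - t') $ i)"
    have "(\<Sum>k\<in>UNIV. x k *s h k) = a *v (s - s') + b *v (q - q') + c *v (t - t')"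
      unfolding h_comb by (simp add: x_def del: vector_minus_component)
    also have "\<dots> = 0" using that by (simp add: matrix_vector_mult_diff_distrib algebra_simps)
    finally have "\<And>k. x k = 0" using zero by blast
    then have "\<And>i. x (Inl i) = 0" "\<And>i. x (Inr (Inl i)) = 0" "\<And>i. x (Inr (Inr i)) = 0" by blast+
    then show ?thesis by (simp add: x_def vec_eq_iff)
  qed
  have surj: "\<exists>s q t. y = a *v s + b *v q + c *v t" for y
  proof -
    have "y \<in> vec.span (B2 \<union> (B3 - B2))" using sp3 B3(1) by (simp add: Un_absorb1)
    then obtain y1 y2 where y: "y = y1 + y2" "y1 \<in> T" "y2 \<in> range ((*v) c)"
      unfolding vec.span_Un rc sp2 by auto
    from y(2) obtain y3 y4 where "y1 = y3 + y4" "y3 \<in> range ((*v) a)" "y4 \<in> range ((*v) b)"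
      unfolding T_eq ra rb ssum_def by auto
    with y show ?thesis by auto
  qed
  have "is_frame (a, b, c)"
    unfolding is_frame_def prod.case
  proof (rule bijI)
    show "inj (\<lambda>(s, q, t). a *v s + b *v q + c *v t)" using inj by (auto simp: inj_def)
    show "surj (\<lambda>(s, q, t). a *v s + b *v q + c *v t)"
      unfolding surj_def
    proof
      fix y
      obtain s q t where "y = a *v s + b *v q + c *v t" using surj by blast
      then show "\<exists>p. y = (\<lambda>(s, q, t). a *v s + b *v q + c *v t) p"
        by (intro exI[of _ "(s, q, t)"]) simp
    qed
  qed
  moreover have "flag_sub (a, b, c) (0, 0, 0) = S"
    by (simp add: flag_sub_def ra sp1)
  moreover have "flag_sup (a, b, c) (0, 0, 0) = T"
    by (simp add: flag_sup_def flag_sub_def ra rb T_eq)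
  ultimately show ?thesis by (rule that)
qed

lemma carrier_Z_atlas: "carrier_of Z_atlas = (Z_space :: 'n::finite zpoint set)"
proof (intro subset_antisym subsetI)
  fix P :: "'n zpoint" assume "P \<in> carrier_of Z_atlas"
  then obtain d :: "('n zpoint, 'n zmodel) chart" where d: "d \<in> Z_atlas" "P \<in> fst d"
    unfolding carrier_of_def by (rule UN_E)
  obtain f g :: "'n frame" where "d = (Z_space \<inter> range (Z_param f g), inv (Z_param f g))"
    using d(1) unfolding Z_atlas_def mem_Collect_eq by (elim exE conjE)
  with d(2) show "P \<in> Z_space" by (simp only: fst_conv Int_iff)
next
  fix P :: "'n zpoint" assume P: "P \<in> Z_space"
  obtain z S1 S2 T1 T2 where Pe: "P = (z, S1, S2, T1, T2)" by (rule prod_cases5)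
  have gr: "S1 \<in> grassmannian (3 * CARD('n))" "T1 \<in> grassmannian (4 * CARD('n))" "S1 \<subseteq> T1"
      "S2 \<in> grassmannian (3 * CARD('n))" "T2 \<in> grassmannian (4 * CARD('n))" "S2 \<subseteq> T2"
    using P unfolding Z_space_def Pe mem_Collect_eq prod.case by blast+
  obtain f where f: "is_frame f" "flag_sub f (0, 0, 0) = S1" "flag_sup f (0, 0, 0) = T1"
    using adapted_frame[OF gr(1-3)] .
  obtain g where g: "is_frame g" "flag_sub g (0, 0, 0) = S2" "flag_sup g (0, 0, 0) = T2"
    using adapted_frame[OF gr(4-6)] .
  define d where "d = (Z_space \<inter> range (Z_param f g), inv (Z_param f g))"
  have "P = Z_param f g (z, (0, 0, 0), (0, 0, 0))"
    unfolding Z_param_def Pe prod.case f g ..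
  then have "P \<in> fst d" unfolding d_def fst_conv by (intro IntI P range_eqI)
  moreover have "d \<in> Z_atlas"
    unfolding Z_atlas_def d_def mem_Collect_eq by (rule exI[of _ f], rule exI[of _ g]) (simp only: f(1) g(1) simp_thms)
  ultimately show "P \<in> carrier_of Z_atlas" unfolding carrier_of_def by (intro UN_I)
qed

type_synonym 'n ztvec = "('n zpoint, 'n zmodel) tvec"

text \<open>The complex structure: multiplication by \<open>\<i>\<close> in the holomorphic coordinates
  (\<open>mat \<i>\<close> is the scalar matrix).\<close>

definition fcoord_i :: "'n::finite fcoord \<Rightarrow> 'n fcoord" where
  "fcoord_i = (\<lambda>(K, M, E). (mat \<i> ** K, mat \<i> ** M, mat \<i> ** E))"

definition zmodel_i :: "'n::finite zmodel \<Rightarrow> 'n zmodel" where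
  "zmodel_i = (\<lambda>(z, u, w). (\<i> *s z, fcoord_i u, fcoord_i w))"

definition J_Z :: "'n::finite ztvec \<Rightarrow> 'n ztvec" where
  "J_Z \<xi> = (\<lambda>d. zmodel_i (\<xi> d))"

text \<open>The \<open>\<complex>\<^sup>8\<^sup>n\<close>-component of a tangent vector of \<open>Z\<close> is its first coordinate in any chart.\<close>

definition D_Z :: "('n::finite zpoint, 'n zmodel) distrib" where
  "D_Z = (\<lambda>(z, S1, S2, T1, T2). {\<xi> \<in> tangent_space Z_atlas (z, S1, S2, T1, T2).
     \<forall>d\<in>Z_atlas. (z, S1, S2, T1, T2) \<in> fst d \<longrightarrow> fst (\<xi> d) \<in> ssum S1 T2})"

text \<open>\<open>Gr(n, D)\<close>: a complex \<open>k\<close>-plane is a \<open>J_Z\<close>-stable real subspace of real dimension \<open>2k\<close>;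
  linear algebra in a tangent space is done in a chart.\<close>

definition gr_D :: "('n::finite zpoint \<times> 'n ztvec set) set" where
  "gr_D = {(P, S). P \<in> Z_space \<and> S \<subseteq> D_Z P \<and> (\<forall>\<xi>\<in>S. J_Z \<xi> \<in> S) \<and>
     (\<forall>d\<in>Z_atlas. P \<in> fst d \<longrightarrow>
        subspace ((\<lambda>\<xi>. \<xi> d) ` S) \<and> dim ((\<lambda>\<xi>. \<xi> d) ` S) = 2 * CARD('n))}"

text \<open>The zero element of the quotient by \<open>D_Z P\<close> is the coset of the zero vector.\<close>

definition isotropy_locus :: "('n::finite zpoint \<times> 'n ztvec set) set" where
  "isotropy_locus = {(P, S) \<in> gr_D. \<forall>\<xi>\<in>S. \<forall>\<eta>\<in>S.
     torsion Z_atlas D_Z P \<xi> \<eta> = quot_class Z_atlas D_Z P (\<lambda>_. 0)}"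


section \<open>The differential relations\<close>

text \<open>\<open>L_bar\<close> is the composite of \<open>L\<close> with the projection to \<open>TZ/D\<close>. The complex structure of
  \<open>TZ/D\<close> maps a coset to its image under \<open>J_Z\<close>.\<close>

definition L_bar :: "'n::finite zpoint \<Rightarrow> (('a, 'e) tvec \<Rightarrow> 'n ztvec) \<Rightarrow>
    ('a, 'e) tvec \<Rightarrow> 'n ztvec set" where
  "L_bar z L v = quot_class Z_atlas D_Z z (L v)"

definition J_quot :: "'n::finite ztvec set \<Rightarrow> 'n ztvec set" where
  "J_quot q = J_Z ` q"

definition J_L :: "('a, 'e::euclidean_space) chart set \<Rightarrow> 'a \<Rightarrow> 'n::finite zpoint \<Rightarrow>
    (('a, 'e) tvec \<Rightarrow> 'n ztvec) \<Rightarrow> ('a, 'e) tvec \<Rightarrow> ('a, 'e) tvec" where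
  "J_L A x z L v = the_inv_into (tangent_space A x) (L_bar z L) (J_quot (L_bar z L v))"

definition dbar :: "('a, 'e::euclidean_space) chart set \<Rightarrow> 'a \<Rightarrow> 'n::finite zpoint \<Rightarrow>
    (('a, 'e) tvec \<Rightarrow> 'n ztvec) \<Rightarrow> ('a, 'e) tvec \<Rightarrow> 'n ztvec" where
  "dbar A x z L v = (\<lambda>d. (1/2) *\<^sub>R (L v d + J_Z (L (J_L A x z L v)) d))"

definition R_ac :: "('a, 'e::euclidean_space) chart set \<Rightarrow>
    ('a, 'e, 'n::finite zpoint, 'n zmodel) jet set" where
  "R_ac A = {(x, z, L) \<in> jet1 A Z_atlas.
     inj_on L (tangent_space A x) \<and>
     L ` tangent_space A x \<inter> J_Z ` (L ` tangent_space A x) = {\<lambda>_. 0} \<and>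
     L_bar z L ` tangent_space A x = quot_space Z_atlas D_Z z}"

definition R_I :: "('a, 'e::euclidean_space) chart set \<Rightarrow>
    ('a, 'e, 'n::finite zpoint, 'n zmodel) jet set" where
  "R_I A = {(x, z, L) \<in> R_ac A. (z, dbar A x z L ` tangent_space A x) \<in> isotropy_locus}"

end

theory Submission
  imports Defs
begin

text \<open>The jet at \<open>x\<close> lies over a point \<open>(0, S', S'', \<Sigma>', \<Sigma>'')\<close> of \<open>Z\<close> of which only \<open>S'\<close> depends on \<open>x\<close>.
  Fix \<open>\<complex>\<^sup>8\<^sup>n = \<Sigma>' \<oplus> \<Sigma>''\<close> with both summands identified with \<open>\<complex>\<^sup>4\<^sup>n\<close>. Since \<open>4n > 2n\<close>, a general
  position argument gives a continuous family of injective complex-linear maps \<open>l\<close> from the tangent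
  spaces of \<open>X\<close> to \<open>\<Sigma>'\<close>. Let \<open>S'\<close> be the orthogonal complement of the image of \<open>l\<close> in \<open>\<Sigma>'\<close>, and let
  \<open>L v\<close> be the tangent vector of \<open>Z\<close> that moves only the base point, by \<open>l v\<close> in \<open>\<Sigma>'\<close> plus the complex
  conjugate of \<open>l v\<close> in \<open>\<Sigma>''\<close>. The first part is complex-linear and complementary to \<open>D\<close>, so \<open>J_L = J\<close>;
  the second part is antilinear with values in \<open>D\<close>, so it is the antilinear part of \<open>L\<close>. Along
  translations of the base point \<open>D\<close> is constant, hence the torsion vanishes on such vectors and
  the image of the antilinear part is isotropic.\<close>

section \<open>Rational functions\<close>

lemma Ck_on_cong:
  assumes "open S" "\<And>y. y \<in> S \<Longrightarrow> f y = g y"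
  shows "Ck_on k S f \<longleftrightarrow> Ck_on k S g"
  using assms(2)
proof (induction k arbitrary: f g)
  case 0 then show ?case by (auto cong: continuous_on_cong)
next
  case (Suc k)
  have d: "(f has_derivative D) (at y) \<longleftrightarrow> (g has_derivative D) (at y)" if "y \<in> S" for y D
    using has_derivative_transform_within_open[OF _ assms(1) that, of f D UNIV g]
      has_derivative_transform_within_open[OF _ assms(1) that, of g D UNIV f] Suc.prems by auto
  have "frechet_derivative f (at y) = frechet_derivative g (at y)" if "y \<in> S" for y
    unfolding frechet_derivative_def using d[OF that] by simp
  then have "Ck_on k S (\<lambda>y. frechet_derivative f (at y) e) = Ck_on k S (\<lambda>y. frechet_derivative g (at y) e)" for e
    by (intro Suc.IH) simp
  then show ?case using d by (auto simp: differentiable_def)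
qed

lemma smooth_on_differentiable: "smooth_on S f \<Longrightarrow> y \<in> S \<Longrightarrow> f differentiable (at y)"
  unfolding smooth_on_def by (metis Ck_on.simps(2))

lemma smooth_on_frechet: "smooth_on S f \<Longrightarrow> smooth_on S (\<lambda>y. frechet_derivative f (at y) e)"
  unfolding smooth_on_def by (metis Ck_on.simps(2))

text \<open>The operators \<open>I\<close> and \<open>I2\<close> play the role of multiplication by \<open>\<i>\<close> on the source and on the target.\<close>

inductive rat :: "('m \<Rightarrow> 'm) \<Rightarrow> 'm set \<Rightarrow> ('m::euclidean_space \<Rightarrow> complex) \<Rightarrow> bool" for I S where
  rat_lin: "bounded_linear g \<Longrightarrow> (\<And>e. g (I e) = \<i> * g e) \<Longrightarrow> rat I S g"
| rat_const: "rat I S (\<lambda>_. c)"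
| rat_add: "rat I S f \<Longrightarrow> rat I S g \<Longrightarrow> rat I S (\<lambda>y. f y + g y)"
| rat_mult: "rat I S f \<Longrightarrow> rat I S g \<Longrightarrow> rat I S (\<lambda>y. f y * g y)"
| rat_inverse: "rat I S f \<Longrightarrow> (\<And>y. y \<in> S \<Longrightarrow> f y \<noteq> 0) \<Longrightarrow> rat I S (\<lambda>y. inverse (f y))"

lemma rat_subset: "rat I S f \<Longrightarrow> U \<subseteq> S \<Longrightarrow> rat I U f"
  by (induction rule: rat.induct) (auto intro: rat.intros)

lemma rat_uminus: "rat I S f \<Longrightarrow> rat I S (\<lambda>y. - f y)"
  using rat_mult[OF rat_const[of I S "-1"], of f] by simp

lemma rat_diff: "rat I S f \<Longrightarrow> rat I S g \<Longrightarrow> rat I S (\<lambda>y. f y - g y)"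
  using rat_add[OF _ rat_uminus, of I S f g] by simp

lemma rat_divide:
  "rat I S f \<Longrightarrow> rat I S g \<Longrightarrow> (\<And>y. y \<in> S \<Longrightarrow> g y \<noteq> 0) \<Longrightarrow> rat I S (\<lambda>y. f y / g y)"
  unfolding divide_inverse by (intro rat_mult rat_inverse)

lemma rat_sum: "(\<And>i. i \<in> J \<Longrightarrow> rat I S (f i)) \<Longrightarrow> rat I S (\<lambda>y. \<Sum>i\<in>J. f i y)"
  by (induction J rule: infinite_finite_induct) (auto intro: rat.intros)

lemma rat_prod: "(\<And>i. i \<in> J \<Longrightarrow> rat I S (f i)) \<Longrightarrow> rat I S (\<lambda>y. \<Prod>i\<in>J. f i y)"
  by (induction J rule: infinite_finite_induct) (auto intro: rat.intros)

lemma rat_has_derivative: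
  assumes "rat I S f"
  shows "\<exists>f'. (\<forall>y\<in>S. (f has_derivative f' y) (at y)) \<and> (\<forall>e. rat I S (\<lambda>y. f' y e)) \<and>
    (\<forall>y\<in>S. \<forall>e. f' y (I e) = \<i> * f' y e)"
  using assms
proof induction
  case (rat_lin g)
  then show ?case
    by (intro exI[of _ "\<lambda>_. g"]) (auto intro: bounded_linear_imp_has_derivative rat_const)
next
  case (rat_const c)
  show ?case by (intro exI[of _ "\<lambda>_ _. 0"]) (auto intro: rat.rat_const)
next
  case (rat_add f g)
  then obtain f' g' where "\<forall>y\<in>S. (f has_derivative f' y) (at y)" "\<forall>e. rat I S (\<lambda>y. f' y e)"
    "\<forall>y\<in>S. \<forall>e. f' y (I e) = \<i> * f' y e" "\<forall>y\<in>S. (g has_derivative g' y) (at y)"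
    "\<forall>e. rat I S (\<lambda>y. g' y e)" "\<forall>y\<in>S. \<forall>e. g' y (I e) = \<i> * g' y e" by blast
  then show ?case
    by (intro exI[of _ "\<lambda>y e. f' y e + g' y e"])
      (auto intro: has_derivative_add rat.rat_add simp: algebra_simps)
next
  case (rat_mult f g)
  then obtain f' g' where *: "\<forall>y\<in>S. (f has_derivative f' y) (at y)" "\<forall>e. rat I S (\<lambda>y. f' y e)"
    "\<forall>y\<in>S. \<forall>e. f' y (I e) = \<i> * f' y e" "\<forall>y\<in>S. (g has_derivative g' y) (at y)"
    "\<forall>e. rat I S (\<lambda>y. g' y e)" "\<forall>y\<in>S. \<forall>e. g' y (I e) = \<i> * g' y e" by blast
  show ?case
  proof (intro exI[of _ "\<lambda>y e. f y * g' y e + f' y e * g y"] conjI ballI allI)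
    show "((\<lambda>y. f y * g y) has_derivative (\<lambda>e. f y * g' y e + f' y e * g y)) (at y)" if "y \<in> S" for y
      using * that by (intro has_derivative_mult) auto
    show "rat I S (\<lambda>y. f y * g' y e + f' y e * g y)" for e
      using * rat_mult.hyps by (intro rat.rat_add rat.rat_mult) auto
  qed (use * in \<open>simp add: algebra_simps\<close>)
next
  case (rat_inverse f)
  then obtain f' where f': "\<forall>y\<in>S. (f has_derivative f' y) (at y)" "\<forall>e. rat I S (\<lambda>y. f' y e)"
    "\<forall>y\<in>S. \<forall>e. f' y (I e) = \<i> * f' y e" by blast
  have "((\<lambda>y. inverse (f y)) has_derivative (\<lambda>e. - (inverse (f y) * f' y e * inverse (f y)))) (at y)"
    if "y \<in> S" for y
    using rat_inverse.hyps(2) f'(1) that by (intro Deriv.has_derivative_inverse) auto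
  with f' rat_inverse.hyps show ?case
    by (intro exI[of _ "\<lambda>y e. - (inverse (f y) * f' y e * inverse (f y))"])
      (auto intro!: rat_uminus rat.rat_mult rat.rat_inverse)
qed

lemma rat_continuous_on: "rat I S f \<Longrightarrow> continuous_on S f"
  using rat_has_derivative[of I S f]
  by (metis has_derivative_at_withinI has_derivative_continuous_on)

inductive vrat :: "('m \<Rightarrow> 'm) \<Rightarrow> ('v \<Rightarrow> 'v) \<Rightarrow> 'm set \<Rightarrow>
    ('m::euclidean_space \<Rightarrow> 'v::real_normed_vector) \<Rightarrow> bool" for I I2 S where
  vrat_0: "vrat I I2 S (\<lambda>_. 0)"
| vrat_cons: "rat I S f \<Longrightarrow> bounded_linear T \<Longrightarrow> (\<And>c. T (\<i> * c) = I2 (T c)) \<Longrightarrow> vrat I I2 S F \<Longrightarrow>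
    vrat I I2 S (\<lambda>y. T (f y) + F y)"

lemma vrat_single:
  "rat I S f \<Longrightarrow> bounded_linear T \<Longrightarrow> (\<And>c. T (\<i> * c) = I2 (T c)) \<Longrightarrow> vrat I I2 S (\<lambda>y. T (f y))"
  using vrat_cons[OF _ _ _ vrat_0, of I S f T I2] by simp

lemma vrat_add: "vrat I I2 S F \<Longrightarrow> vrat I I2 S G \<Longrightarrow> vrat I I2 S (\<lambda>y. F y + G y)"
  by (induction rule: vrat.induct) (auto intro: vrat.intros simp: add.assoc)

lemma vrat_sum: "(\<And>i. i \<in> J \<Longrightarrow> vrat I I2 S (f i)) \<Longrightarrow> vrat I I2 S (\<lambda>y. \<Sum>i\<in>J. f i y)"
  by (induction J rule: infinite_finite_induct) (auto intro: vrat_0 vrat_add)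

lemma vrat_has_derivative:
  assumes "vrat I I2 S F" "linear I2"
  shows "\<exists>F'. (\<forall>y\<in>S. (F has_derivative F' y) (at y)) \<and> (\<forall>e. vrat I I2 S (\<lambda>y. F' y e)) \<and>
    (\<forall>y\<in>S. \<forall>e. F' y (I e) = I2 (F' y e))"
  using assms(1)
proof induction
  case vrat_0
  show ?case
    by (intro exI[of _ "\<lambda>_ _. 0"]) (auto intro: vrat.vrat_0 simp: linear_0[OF assms(2)])
next
  case (vrat_cons f T F)
  then obtain F' where F': "\<forall>y\<in>S. (F has_derivative F' y) (at y)" "\<forall>e. vrat I I2 S (\<lambda>y. F' y e)"
    "\<forall>y\<in>S. \<forall>e. F' y (I e) = I2 (F' y e)" by blast
  obtain f' where f': "\<forall>y\<in>S. (f has_derivative f' y) (at y)" "\<forall>e. rat I S (\<lambda>y. f' y e)"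
    "\<forall>y\<in>S. \<forall>e. f' y (I e) = \<i> * f' y e" using rat_has_derivative[OF vrat_cons.hyps(1)] by blast
  show ?case
  proof (intro exI[of _ "\<lambda>y e. T (f' y e) + F' y e"] conjI ballI allI)
    show "((\<lambda>y. T (f y) + F y) has_derivative (\<lambda>e. T (f' y e) + F' y e)) (at y)" if "y \<in> S" for y
      using f' F' that
      by (intro has_derivative_add bounded_linear.has_derivative[OF vrat_cons.hyps(2)]) blast+
    show "vrat I I2 S (\<lambda>y. T (f' y e) + F' y e)" for e
      using f' F' by (intro vrat.vrat_cons[OF _ vrat_cons.hyps(2,3)]) blast+
    show "T (f' y (I e)) + F' y (I e) = I2 (T (f' y e) + F' y e)" if "y \<in> S" for y e
      using f' F' vrat_cons.hyps(3) that by (simp add: linear_add[OF assms(2)])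
  qed
qed

lemma vrat_smooth_on:
  assumes "vrat I I2 S F" "linear I2" "open S"
  shows "smooth_on S F"
proof -
  have "Ck_on k S F" for k
    using assms(1)
  proof (induction k arbitrary: F)
    case 0
    then show ?case using vrat_has_derivative[OF 0 assms(2)]
      by simp (metis has_derivative_at_withinI has_derivative_continuous_on)
  next
    case (Suc k)
    obtain F' where F': "\<forall>y\<in>S. (F has_derivative F' y) (at y)" "\<forall>e. vrat I I2 S (\<lambda>y. F' y e)"
      using vrat_has_derivative[OF Suc.prems assms(2)] by blast
    have "Ck_on k S (\<lambda>y. frechet_derivative F (at y) e)" for e
    proof (subst Ck_on_cong[OF assms(3)])
      show "frechet_derivative F (at y) e = F' y e" if "y \<in> S" for y
        using F'(1) that by (metis frechet_derivative_at)
      show "Ck_on k S (\<lambda>y. F' y e)" using F'(2) by (intro Suc.IH) simp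
    qed
    then show ?case using F'(1) by (auto simp: differentiable_def)
  qed
  then show ?thesis by (simp add: smooth_on_def)
qed

definition mrat :: "('m \<Rightarrow> 'm) \<Rightarrow> 'm set \<Rightarrow> ('m::euclidean_space \<Rightarrow> complex ^ 'c ^ 'r) \<Rightarrow> bool" where
  "mrat I S M \<longleftrightarrow> (\<forall>i j. rat I S (\<lambda>y. M y $ i $ j))"

lemma mrat_const: "mrat I S (\<lambda>_. M)" by (simp add: mrat_def rat_const)
lemma mrat_add: "mrat I S M \<Longrightarrow> mrat I S N \<Longrightarrow> mrat I S (\<lambda>y. M y + N y)"
  by (simp add: mrat_def rat_add)
lemma mrat_diff: "mrat I S M \<Longrightarrow> mrat I S N \<Longrightarrow> mrat I S (\<lambda>y. M y - N y)"
  by (simp add: mrat_def rat_diff)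
lemma mrat_mult: "mrat I S M \<Longrightarrow> mrat I S N \<Longrightarrow> mrat I S (\<lambda>y. M y ** N y)"
  unfolding mrat_def matrix_matrix_mult_def by (auto intro!: rat_sum rat_mult)
lemma mrat_subset: "mrat I S M \<Longrightarrow> U \<subseteq> S \<Longrightarrow> mrat I U M"
  unfolding mrat_def using rat_subset by blast

lemma rat_det: "mrat I S M \<Longrightarrow> rat I S (\<lambda>y. det (M y))"
  unfolding det_def mrat_def by (rule rat_sum, rule rat_mult[OF rat_const], rule rat_prod) blast

lemma matrix_inv_mult:
  fixes A :: "'a::field ^ 'n ^ 'n"
  assumes "det A \<noteq> 0"
  shows "A ** matrix_inv A = mat 1" "matrix_inv A ** A = mat 1"
proof -
  obtain A' where "A ** A' = mat 1 \<and> A' ** A = mat 1"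
    using assms by (auto simp: invertible_det_nz[symmetric] invertible_def)
  then have "A ** matrix_inv A = mat 1 \<and> matrix_inv A ** A = mat 1"
    unfolding matrix_inv_def by (rule someI)
  then show "A ** matrix_inv A = mat 1" "matrix_inv A ** A = mat 1" by auto
qed

lemma matrix_inv_cramer:
  fixes A :: "'a::field ^ 'n ^ 'n"
  assumes "det A \<noteq> 0"
  shows "matrix_inv A $ k $ l = det (\<chi> i j. if j = k then mat 1 $ i $ l else A $ i $ j) / det A"
proof -
  have "A *v column l (matrix_inv A) = column l (mat 1)"
    unfolding matrix_inv_mult(1)[OF assms, symmetric]
    by (simp add: column_def matrix_vector_mult_def matrix_matrix_mult_def vec_eq_iff)
  from this[unfolded cramer[OF assms]] have "column l (matrix_inv A) $ k =
      det (\<chi> i j. if j = k then column l (mat 1) $ i else A $ i $ j) / det A" by simp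
  then show ?thesis by (simp add: column_def cong: if_cong)
qed

text \<open>Off the locus \<open>det \<noteq> 0\<close> the value of \<open>matrix_inv\<close> is unspecified, hence the restriction.\<close>

lemma mrat_inverse:
  assumes "mrat I S M" "\<And>y. y \<in> S \<Longrightarrow> det (M y) \<noteq> 0"
  obtains M' where "mrat I S M'" "\<And>y. y \<in> S \<Longrightarrow> matrix_inv (M y) = M' y"
proof
  let ?M' = "\<lambda>y. \<chi> k l. det (\<chi> i j. if j = k then mat 1 $ i $ l else M y $ i $ j) / det (M y)"
  have "mrat I S (\<lambda>y. \<chi> i j. if j = k then mat 1 $ i $ l else M y $ i $ j)" for k l
    unfolding mrat_def
  proof (intro allI)
    show "rat I S (\<lambda>y. (\<chi> i j. if j = k then mat 1 $ i $ l else M y $ i $ j) $ i $ j)" for i j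
      using assms(1) by (cases "j = k") (simp_all add: mrat_def rat_const)
  qed
  then show "mrat I S ?M'"
    using assms unfolding mrat_def[of I S ?M'] by (auto intro!: rat_divide rat_det)
  show "matrix_inv (M y) = ?M' y" if "y \<in> S" for y
    unfolding vec_eq_iff by (simp only: vec_lambda_beta matrix_inv_cramer[OF assms(2)[OF that]] simp_thms)
qed

section \<open>Flag charts\<close>

lemma vrat_comp_linear:
  assumes "vrat I I2 S F" "bounded_linear L" "\<And>x. L (I2 x) = I3 (L x)"
  shows "vrat I I3 S (\<lambda>y. L (F y))"
  using assms(1)
proof induction
  case vrat_0
  show ?case by (simp add: linear_0 bounded_linear.linear[OF assms(2)] vrat.vrat_0)
next
  case (vrat_cons f T F)
  have "vrat I I3 S (\<lambda>y. (L \<circ> T) (f y) + L (F y))"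
    using vrat_cons bounded_linear_compose[OF assms(2) vrat_cons.hyps(2)] assms(3)
    by (intro vrat.vrat_cons) (auto simp: o_def)
  then show ?case
    by (simp add: linear_add bounded_linear.linear[OF assms(2)])
qed

lemma vec_sum_axis: "(\<Sum>i\<in>UNIV. axis i (x $ i)) = (x :: 'b::comm_monoid_add ^ 'n::finite)"
  by (simp add: vec_eq_iff axis_def if_distrib[where f="\<lambda>v. v $ _"] sum.delta cong: if_cong)

lemma vrat_vector:
  fixes z :: "'m::euclidean_space \<Rightarrow> complex ^ 'k"
  assumes "\<And>i. rat I S (\<lambda>y. z y $ i)"
  shows "vrat I ((*s) \<i>) S z"
proof -
  have "vrat I ((*s) \<i>) S (\<lambda>y. axis i (z y $ i))" for i
    using assms
    by (intro vrat_single) (auto simp: axis_def vec_eq_iff linear_conv_bounded_linear[symmetric] intro!: linearI)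
  then have "vrat I ((*s) \<i>) S (\<lambda>y. \<Sum>i\<in>UNIV. axis i (z y $ i))"
    by (intro vrat_sum)
  then show ?thesis by (simp add: vec_sum_axis)
qed

lemma mat_scalar_mult: "mat c ** A = (\<chi> i j. c * A $ i $ j)" for A :: "complex ^ 'c ^ 'r"
  by (simp add: matrix_matrix_mult_def mat_def vec_eq_iff if_distribR if_distrib sum.delta cong: if_cong)

lemma vrat_matrix:
  fixes M :: "'m::euclidean_space \<Rightarrow> complex ^ 'c ^ 'r"
  assumes "mrat I S M"
  shows "vrat I ((**) (mat \<i>)) S M"
proof -
  have "vrat I ((**) (mat \<i>)) S (\<lambda>y. axis i (axis j (M y $ i $ j)))" for i j
    using assms unfolding mrat_def
    by (intro vrat_single) (auto simp: axis_def vec_eq_iff mat_scalar_mult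
        linear_conv_bounded_linear[symmetric] intro!: linearI)
  then have "vrat I ((**) (mat \<i>)) S (\<lambda>y. \<Sum>i\<in>UNIV. \<Sum>j\<in>UNIV. axis i (axis j (M y $ i $ j)))"
    by (intro vrat_sum)
  moreover have "(\<Sum>j\<in>UNIV. axis i (axis j (x $ i $ j))) = axis i (x $ i)" for i and x :: "complex ^ 'c ^ 'r"
  proof -
    have "(\<Sum>j\<in>UNIV. axis i (axis j (x $ i $ j))) = axis i (\<Sum>j\<in>UNIV. axis j (x $ i $ j))"
      by (simp add: vec_eq_iff axis_def)
    then show ?thesis by (simp add: vec_sum_axis)
  qed
  ultimately show ?thesis by (simp add: vec_sum_axis)
qed

lemma vrat_zmodel:
  fixes z :: "'m::euclidean_space \<Rightarrow> 'n::finite amb"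
  assumes "\<And>i. rat I S (\<lambda>y. z y $ i)"
    "mrat I S K" "mrat I S M" "mrat I S E" "mrat I S K'" "mrat I S M'" "mrat I S E'"
  shows "vrat I zmodel_i S (\<lambda>y. (z y, (K y, M y, E y), (K' y, M' y, E' y)))"
proof -
  have L: "vrat I zmodel_i S (\<lambda>y. f (F y))"
    if "vrat I i S F" "linear f" "\<And>x. f (i x) = zmodel_i (f x)"
    for F and f :: "'u::euclidean_space \<Rightarrow> 'n zmodel" and i
    using that by (intro vrat_comp_linear[of I i S F f zmodel_i]) (simp_all add: linear_conv_bounded_linear)
  note simps = zmodel_i_def fcoord_i_def zero_prod_def
  have "vrat I zmodel_i S (\<lambda>y. (z y, 0, 0))"
    by (rule L[OF vrat_vector[OF assms(1)], of "\<lambda>z. (z, 0, 0)"]) (auto intro!: linearI simp: simps)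
  moreover have "vrat I zmodel_i S (\<lambda>y. (0, (K y, 0, 0), 0))"
    by (rule L[OF vrat_matrix[OF assms(2)], of "\<lambda>z. (0, (z, 0, 0), 0)"]) (auto intro!: linearI simp: simps)
  moreover have "vrat I zmodel_i S (\<lambda>y. (0, (0, M y, 0), 0))"
    by (rule L[OF vrat_matrix[OF assms(3)], of "\<lambda>z. (0, (0, z, 0), 0)"]) (auto intro!: linearI simp: simps)
  moreover have "vrat I zmodel_i S (\<lambda>y. (0, (0, 0, E y), 0))"
    by (rule L[OF vrat_matrix[OF assms(4)], of "\<lambda>z. (0, (0, 0, z), 0)"]) (auto intro!: linearI simp: simps)
  moreover have "vrat I zmodel_i S (\<lambda>y. (0, 0, (K' y, 0, 0)))"
    by (rule L[OF vrat_matrix[OF assms(5)], of "\<lambda>z. (0, 0, (z, 0, 0))"]) (auto intro!: linearI simp: simps)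
  moreover have "vrat I zmodel_i S (\<lambda>y. (0, 0, (0, M' y, 0)))"
    by (rule L[OF vrat_matrix[OF assms(6)], of "\<lambda>z. (0, 0, (0, z, 0))"]) (auto intro!: linearI simp: simps)
  moreover have "vrat I zmodel_i S (\<lambda>y. (0, 0, (0, 0, E' y)))"
    by (rule L[OF vrat_matrix[OF assms(7)], of "\<lambda>z. (0, 0, (0, 0, z))"]) (auto intro!: linearI simp: simps)
  ultimately have "vrat I zmodel_i S (\<lambda>y. (z y, 0, 0) + ((0, (K y, 0, 0), 0) + ((0, (0, M y, 0), 0)
    + ((0, (0, 0, E y), 0) + ((0, 0, (K' y, 0, 0)) + ((0, 0, (0, M' y, 0)) + (0, 0, (0, 0, E' y))))))))"
    by (intro vrat_add)
  then show ?thesis by (simp add: zero_prod_def)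
qed

lemma fcoord_i_add: "fcoord_i (u + u') = fcoord_i u + fcoord_i u'"
  by (cases u; cases u') (simp add: fcoord_i_def matrix_add_ldistrib)

lemma fcoord_i_scaleR: "fcoord_i (r *\<^sub>R u) = r *\<^sub>R fcoord_i u"
  by (cases u) (simp add: fcoord_i_def mat_scalar_mult vec_eq_iff)

lemma linear_zmodel_i: "linear (zmodel_i :: 'n::finite zmodel \<Rightarrow> 'n zmodel)"
proof (rule linearI)
  show "zmodel_i (x + y) = zmodel_i x + zmodel_i y" for x y :: "'n zmodel"
    by (cases x; cases y) (simp add: zmodel_i_def fcoord_i_add[symmetric] vector_add_ldistrib)
  show "zmodel_i (r *\<^sub>R x) = r *\<^sub>R zmodel_i x" for x :: "'n zmodel" and r
    by (cases x) (simp add: zmodel_i_def fcoord_i_scaleR[symmetric] vec_eq_iff)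
qed

definition col1 :: "'n::finite frame \<Rightarrow> 'n fcoord \<Rightarrow> complex ^ ('n \<times> 3) ^ ('n \<times> 8)" where
  "col1 = (\<lambda>(a, b, c) (K, M, E). a + b ** K + c ** M)"

definition col2 :: "'n::finite frame \<Rightarrow> 'n fcoord \<Rightarrow> complex ^ 'n ^ ('n \<times> 8)" where
  "col2 = (\<lambda>(a, b, c) (K, M, E). b + c ** E)"

lemma col_simps: "col1 (a, b, c) (K, M, E) = a + b ** K + c ** M" "col2 (a, b, c) (K, M, E) = b + c ** E"
  by (simp_all add: col1_def col2_def)

lemma flag_sub_col: "flag_sub f u = range ((*v) (col1 f u))"
  by (cases f; cases u) (simp add: flag_sub_def col1_def)

lemma flag_sup_col: "flag_sup f u = ssum (range ((*v) (col1 f u))) (range ((*v) (col2 f u)))"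
  by (cases f; cases u) (simp add: flag_sup_def flag_sub_col col2_def)

locale dual_frame =
  fixes a :: "complex ^ ('n::finite \<times> 3) ^ ('n \<times> 8)" and b :: "complex ^ 'n ^ ('n \<times> 8)"
    and c :: "complex ^ ('n \<times> 4) ^ ('n \<times> 8)"
    and pa :: "complex ^ ('n \<times> 8) ^ ('n \<times> 3)" and pb :: "complex ^ ('n \<times> 8) ^ 'n"
    and pc :: "complex ^ ('n \<times> 8) ^ ('n \<times> 4)"
  assumes coord: "pa *v (a *v s + b *v q + c *v t) = s" "pb *v (a *v s + b *v q + c *v t) = q"
      "pc *v (a *v s + b *v q + c *v t) = t"
    and decomp: "a *v (pa *v w) + b *v (pb *v w) + c *v (pc *v w) = w"
begin

lemma coords: "pa *v (a *v s) = s" "pa *v (b *v q) = 0" "pa *v (c *v t) = 0"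
  "pb *v (a *v s) = 0" "pb *v (b *v q) = q" "pb *v (c *v t) = 0"
  "pc *v (a *v s) = 0" "pc *v (b *v q) = 0" "pc *v (c *v t) = t"
  using coord[of s 0 0] coord[of 0 q 0] coord[of 0 0 t] by simp_all

lemma eq_iff: "w = w' \<longleftrightarrow> pa *v w = pa *v w' \<and> pb *v w = pb *v w' \<and> pc *v w = pc *v w'"
  using decomp[of w] decomp[of w'] by metis

lemma mem_flag_sub:
  "w \<in> flag_sub (a, b, c) (K, M, E) \<longleftrightarrow> pb *v w = K *v (pa *v w) \<and> pc *v w = M *v (pa *v w)"
proof
  assume "w \<in> flag_sub (a, b, c) (K, M, E)"
  then show "pb *v w = K *v (pa *v w) \<and> pc *v w = M *v (pa *v w)"
    by (auto simp: flag_sub_mem coord)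
next
  assume "pb *v w = K *v (pa *v w) \<and> pc *v w = M *v (pa *v w)"
  then have "w = a *v (pa *v w) + b *v (K *v (pa *v w)) + c *v (M *v (pa *v w))"
    using decomp[of w] by simp
  then show "w \<in> flag_sub (a, b, c) (K, M, E)" unfolding flag_sub_mem by blast
qed

lemma mem_flag_sup:
  "w \<in> flag_sup (a, b, c) (K, M, E) \<longleftrightarrow>
    pc *v w = M *v (pa *v w) + E *v (pb *v w - K *v (pa *v w))"
proof
  assume "w \<in> flag_sup (a, b, c) (K, M, E)"
  then show "pc *v w = M *v (pa *v w) + E *v (pb *v w - K *v (pa *v w))"
    by (auto simp: flag_sup_mem coord)
next
  assume "pc *v w = M *v (pa *v w) + E *v (pb *v w - K *v (pa *v w))"
  then have "w = a *v (pa *v w) + b *v (K *v (pa *v w) + (pb *v w - K *v (pa *v w)))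
      + c *v (M *v (pa *v w) + E *v (pb *v w - K *v (pa *v w)))"
    using decomp[of w] by simp
  then show "w \<in> flag_sup (a, b, c) (K, M, E)" unfolding flag_sup_mem by blast
qed

lemma matrix_decomp: "a ** (pa ** X) + b ** (pb ** X) + c ** (pc ** X) = X" for X :: "complex ^ 'k ^ ('n \<times> 8)"
  unfolding matrix_eq
  by (simp add: matrix_vector_mult_add_rdistrib matrix_vector_mul_assoc[symmetric] decomp)

lemma col_inj: "col1 (a, b, c) u *v s = col2 (a, b, c) u *v q \<Longrightarrow> s = 0 \<and> q = 0"
proof -
  assume *: "col1 (a, b, c) u *v s = col2 (a, b, c) u *v q"
  obtain K M E where u: "u = (K, M, E)" by (cases u)
  have 1: "a *v s + b *v (K *v s) + c *v (M *v s) = b *v q + c *v (E *v q)"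
    using * by (simp add: u col1_def col2_def matrix_vector_mult_add_rdistrib matrix_vector_mul_assoc)
  from arg_cong[OF 1, of "(*v) pa"] have s: "s = 0"
    by (simp add: coord coords matrix_vector_right_distrib)
  from arg_cong[OF 1, of "(*v) pb"] show ?thesis
    by (simp add: coord coords matrix_vector_right_distrib s)
qed

lemma frame: "is_frame (a, b, c)"
  unfolding is_frame_def prod.case
  by (rule o_bij[of "\<lambda>w. (pa *v w, pb *v w, pc *v w)"]) (auto simp: coord decomp fun_eq_iff)

end

lemma is_frame_dual:
  assumes "is_frame (a, b, c)"
  obtains pa pb pc where "dual_frame a b c pa pb pc"
proof -
  define F where "F = (\<lambda>(s, q, t). a *v s + b *v q + c *v t)"
  have bij: "bij F" using assms by (simp add: is_frame_def F_def)
  have add: "F (s + s', q + q', t + t') = F (s, q, t) + F (s', q', t')" for s s' q q' t t'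
    by (simp add: F_def matrix_vector_right_distrib)
  have scale: "F (k *s s, k *s q, k *s t) = k *s F (s, q, t)" for k s q t
    by (simp add: F_def vec.scale_right_distrib matrix_vector_mult_scaleR vec.scale)
  have iF: "inv F (F x) = x" "F (inv F w) = w" for x w
    using bij by (simp_all add: bij_is_inj bij_is_surj surj_f_inv_f)
  have iadd: "inv F (x + y) = (fst (inv F x) + fst (inv F y), fst (snd (inv F x)) + fst (snd (inv F y)),
      snd (snd (inv F x)) + snd (snd (inv F y)))" for x y
    using add[of "fst (inv F x)" "fst (inv F y)" "fst (snd (inv F x))" "fst (snd (inv F y))"
      "snd (snd (inv F x))" "snd (snd (inv F y))"] iF by (metis prod.collapse)
  have iscale: "inv F (k *s x) = (k *s fst (inv F x), k *s fst (snd (inv F x)), k *s snd (snd (inv F x)))" for k x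
    using scale[of k "fst (inv F x)" "fst (snd (inv F x))" "snd (snd (inv F x))"] iF by (metis prod.collapse)
  have l: "Vector_Spaces.linear (*s) (*s) (\<lambda>w. fst (inv F w))"
    "Vector_Spaces.linear (*s) (*s) (\<lambda>w. fst (snd (inv F w)))"
    "Vector_Spaces.linear (*s) (*s) (\<lambda>w. snd (snd (inv F w)))"
    by (simp_all add: Vector_Spaces.linear_iff vec.vector_space_axioms iadd iscale)
  show ?thesis
  proof (rule that[of "matrix (\<lambda>w. fst (inv F w))" "matrix (\<lambda>w. fst (snd (inv F w)))" "matrix (\<lambda>w. snd (snd (inv F w)))"],
      unfold_locales)
    fix s q t w
    have "inv F (a *v s + b *v q + c *v t) = (s, q, t)" using iF(1)[of "(s, q, t)"] by (simp add: F_def)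
    then show "matrix (\<lambda>w. fst (inv F w)) *v (a *v s + b *v q + c *v t) = s"
      "matrix (\<lambda>w. fst (snd (inv F w))) *v (a *v s + b *v q + c *v t) = q"
      "matrix (\<lambda>w. snd (snd (inv F w))) *v (a *v s + b *v q + c *v t) = t"
      by (simp_all add: matrix_works[OF l(1)] matrix_works[OF l(2)] matrix_works[OF l(3)])
    show "a *v (matrix (\<lambda>w. fst (inv F w)) *v w) + b *v (matrix (\<lambda>w. fst (snd (inv F w))) *v w)
      + c *v (matrix (\<lambda>w. snd (snd (inv F w))) *v w) = w"
      using iF(2)[of w] unfolding matrix_works[OF l(1)] matrix_works[OF l(2)] matrix_works[OF l(3)]
      by (simp add: F_def split: prod.splits)
  qed
qed


lemma range_mult_invertible:
  fixes R :: "'a::field ^ 'k ^ 'm" and B :: "'a ^ 'k ^ 'k"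
  assumes "B ** A = mat 1"
  shows "range ((*v) (R ** B)) = range ((*v) R)"
proof (intro subset_antisym subsetI)
  fix w assume "w \<in> range ((*v) R)"
  then obtain s where "w = R *v s" by blast
  then have "w = (R ** B) *v (A *v s)"
    by (simp add: matrix_vector_mul_assoc matrix_mul_assoc[symmetric] assms)
  then show "w \<in> range ((*v) (R ** B))" by blast
qed (auto simp: matrix_vector_mul_assoc[symmetric])

lemma det_nz_iff_inj: "det A \<noteq> 0 \<longleftrightarrow> (\<forall>x. A *v x = 0 \<longrightarrow> x = 0)" for A :: "'a::field ^ 'k ^ 'k"
  by (simp add: invertible_det_nz[symmetric] invertible_left_inverse matrix_left_invertible_ker)

locale frame_pair = F: dual_frame a b c pa pb pc + G: dual_frame a' b' c' pa' pb' pc'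
  for a :: "complex ^ ('n::finite \<times> 3) ^ ('n \<times> 8)" and b c pa pb pc
    and a' :: "complex ^ ('n \<times> 3) ^ ('n \<times> 8)" and b' c' pa' pb' pc'
begin

text \<open>The flag with coordinates \<open>(K, M, E)\<close> in the frame \<open>(a, b, c)\<close> is spanned by the columns of
  \<open>A1\<close> and \<open>A2\<close>. Passing to the frame \<open>(a', b', c')\<close>, one normalizes these columns by column
  operations, with pivot blocks \<open>P1\<close> and \<open>P2\<close>.\<close>

abbreviation "A1 \<equiv> col1 (a, b, c)"
abbreviation "A2 \<equiv> col2 (a, b, c)"
definition "P1 u = pa' ** A1 u"
definition "B1 u = A1 u ** matrix_inv (P1 u)"
definition "A2' u = A2 u - B1 u ** (pa' ** A2 u)"
definition "P2 u = pb' ** A2' u"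
definition "change u = (pb' ** B1 u, pc' ** B1 u, pc' ** (A2' u ** matrix_inv (P2 u)))"

lemma flag_change:
  assumes "det (P1 u) \<noteq> 0" "det (P2 u) \<noteq> 0"
  shows "flag_sub (a', b', c') (change u) = flag_sub (a, b, c) u"
    and "flag_sup (a', b', c') (change u) = flag_sup (a, b, c) u"
proof -
  note i1 = matrix_inv_mult[OF assms(1)] and i2 = matrix_inv_mult[OF assms(2)]
  have 1: "pa' ** B1 u = mat 1" by (simp add: B1_def matrix_mul_assoc P1_def[symmetric] i1)
  have 2: "pa' ** A2' u = 0"
    by (simp add: A2'_def matrix_eq matrix_vector_mult_diff_rdistrib matrix_vector_mult_diff_distrib
        matrix_vector_mul_assoc[symmetric])
      (simp add: matrix_vector_mul_assoc matrix_mul_assoc 1)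
  have 3: "a' + b' ** (pb' ** B1 u) + c' ** (pc' ** B1 u) = B1 u"
    using G.matrix_decomp[of "B1 u"] by (simp add: 1)
  have 4: "b' + c' ** (pc' ** (A2' u ** matrix_inv (P2 u))) = A2' u ** matrix_inv (P2 u)"
    using G.matrix_decomp[of "A2' u ** matrix_inv (P2 u)"]
    by (simp add: matrix_mul_assoc 2 P2_def[symmetric] i2)
  have r1: "range ((*v) (B1 u)) = range ((*v) (A1 u))"
    unfolding B1_def by (rule range_mult_invertible[OF i1(2)])
  have r2: "range ((*v) (A2' u ** matrix_inv (P2 u))) = range ((*v) (A2' u))"
    by (rule range_mult_invertible[OF i2(2)])
  show s: "flag_sub (a', b', c') (change u) = flag_sub (a, b, c) u"
    unfolding flag_sub_col by (simp add: change_def col_simps 3 r1)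
  have "flag_sup (a', b', c') (change u) = ssum (range ((*v) (A1 u))) (range ((*v) (A2' u)))"
    using s by (simp add: change_def flag_sup_def 4 r2 flag_sub_col)
  also have "\<dots> = ssum (range ((*v) (A1 u))) (range ((*v) (A2 u)))"
  proof (intro subset_antisym subsetI)
    fix w assume "w \<in> ssum (range ((*v) (A1 u))) (range ((*v) (A2' u)))"
    then obtain s q where w: "w = A1 u *v s + A2' u *v q" by (auto simp: ssum_def)
    then have "w = A1 u *v (s - matrix_inv (P1 u) *v (pa' *v (A2 u *v q))) + A2 u *v q"
      by (simp add: A2'_def B1_def matrix_vector_mult_diff_rdistrib matrix_vector_mult_diff_distrib
          matrix_vector_mul_assoc matrix_mul_assoc)
    then show "w \<in> ssum (range ((*v) (A1 u))) (range ((*v) (A2 u)))" unfolding ssum_def by blast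
  next
    fix w assume "w \<in> ssum (range ((*v) (A1 u))) (range ((*v) (A2 u)))"
    then obtain s q where w: "w = A1 u *v s + A2 u *v q" by (auto simp: ssum_def)
    then have "w = A1 u *v (s + matrix_inv (P1 u) *v (pa' *v (A2 u *v q))) + A2' u *v q"
      by (simp add: A2'_def B1_def matrix_vector_mult_diff_rdistrib matrix_vector_right_distrib
          matrix_vector_mul_assoc matrix_mul_assoc)
    then show "w \<in> ssum (range ((*v) (A1 u))) (range ((*v) (A2' u)))" unfolding ssum_def by blast
  qed
  finally show "flag_sup (a', b', c') (change u) = flag_sup (a, b, c) u" by (simp add: flag_sup_col)
qed

lemma pivots_nz:
  assumes "flag_sub (a', b', c') u' = flag_sub (a, b, c) u" "flag_sup (a', b', c') u' = flag_sup (a, b, c) u"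
  shows "det (P1 u) \<noteq> 0 \<and> det (P2 u) \<noteq> 0"
proof -
  obtain K M E where u': "u' = (K, M, E)" by (cases u')
  have d1: "det (P1 u) \<noteq> 0"
    unfolding det_nz_iff_inj
  proof (intro allI impI)
    fix s assume "P1 u *v s = 0"
    then have 0: "pa' *v (A1 u *v s) = 0" by (simp add: P1_def matrix_vector_mul_assoc)
    have "A1 u *v s \<in> flag_sub (a', b', c') (K, M, E)" using assms(1) by (auto simp: flag_sub_col u')
    then have "A1 u *v s = 0" unfolding G.mem_flag_sub 0 using G.eq_iff[of "A1 u *v s" 0] 0 by simp
    then show "s = 0" using F.col_inj[of u s 0] by simp
  qed
  moreover have "det (P2 u) \<noteq> 0"
    unfolding det_nz_iff_inj
  proof (intro allI impI)
    fix q assume "P2 u *v q = 0"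
    then have 0: "pb' *v (A2' u *v q) = 0" by (simp add: P2_def matrix_vector_mul_assoc)
    have e: "A2' u *v q = A1 u *v (- (matrix_inv (P1 u) *v (pa' *v (A2 u *v q)))) + A2 u *v q"
      by (simp add: A2'_def B1_def matrix_vector_mult_diff_rdistrib vec.neg
          matrix_vector_mul_assoc matrix_mul_assoc)
    have "pa' ** B1 u = mat 1" by (simp add: B1_def matrix_mul_assoc P1_def[symmetric] matrix_inv_mult[OF d1])
    then have 1: "pa' *v (A2' u *v q) = 0"
      by (simp add: A2'_def matrix_vector_mult_diff_rdistrib matrix_vector_mult_diff_distrib
          matrix_vector_mul_assoc matrix_mul_assoc)
    have "A2' u *v q \<in> flag_sup (a', b', c') (K, M, E)"
      using assms(2) unfolding u' e flag_sup_col ssum_def by blast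
    then have "A2' u *v q = 0"
      unfolding G.mem_flag_sup using 0 1 G.eq_iff[of "A2' u *v q" 0] by simp
    then have "A1 u *v (matrix_inv (P1 u) *v (pa' *v (A2 u *v q))) = A2 u *v q"
      using e by (simp add: vec.neg)
    then show "q = 0" using F.col_inj by blast
  qed
  ultimately show ?thesis ..
qed

lemma mrat_change:
  assumes K: "mrat I S K" and M: "mrat I S M" and E: "mrat I S E" and "open S"
  defines "U \<equiv> {y \<in> S. det (P1 (K y, M y, E y)) \<noteq> 0 \<and> det (P2 (K y, M y, E y)) \<noteq> 0}"
  shows "open U"
    and "\<exists>K' M' E'. mrat I U K' \<and> mrat I U M' \<and> mrat I U E' \<and>
      (\<forall>y\<in>U. change (K y, M y, E y) = (K' y, M' y, E' y))"
proof -
  define u where "u y = (K y, M y, E y)" for y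
  have A1: "mrat I S (\<lambda>y. A1 (u y))" unfolding u_def col1_def prod.case
    by (intro mrat_add mrat_mult mrat_const K M)
  have A2: "mrat I S (\<lambda>y. A2 (u y))" unfolding u_def col2_def prod.case
    by (intro mrat_add mrat_mult mrat_const E)
  have P1: "mrat I S (\<lambda>y. P1 (u y))" unfolding P1_def by (intro mrat_mult mrat_const A1)
  define S1 where "S1 = {y \<in> S. det (P1 (u y)) \<noteq> 0}"
  have op: "open {y \<in> T. f y \<noteq> 0}" if "rat I T f" "open T" for T f
  proof -
    have "{y \<in> T. f y \<noteq> 0} = T \<inter> f -` (- {0})" by auto
    then show ?thesis using continuous_open_preimage[OF rat_continuous_on[OF that(1)] that(2), of "- {0}"]
      by (simp add: open_Compl)
  qed
  have oS1: "open S1" unfolding S1_def by (rule op[OF rat_det[OF P1] \<open>open S\<close>])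
  have S1: "S1 \<subseteq> S" by (auto simp: S1_def)
  obtain Q1 where Q1: "mrat I S1 Q1" "\<And>y. y \<in> S1 \<Longrightarrow> matrix_inv (P1 (u y)) = Q1 y"
    using mrat_inverse[OF mrat_subset[OF P1 S1]] by (auto simp: S1_def)
  define B where "B y = A1 (u y) ** Q1 y" for y
  define A where "A y = A2 (u y) - B y ** (pa' ** A2 (u y))" for y
  have B: "mrat I S1 B" unfolding B_def by (intro mrat_mult mrat_subset[OF A1 S1] Q1)
  have A: "mrat I S1 A" unfolding A_def by (intro mrat_diff mrat_mult mrat_const mrat_subset[OF A2 S1] B)
  have eqs: "B1 (u y) = B y" "A2' (u y) = A y" "P2 (u y) = pb' ** A y" if "y \<in> S1" for y
    using Q1(2)[OF that] by (simp_all add: B1_def B_def A2'_def A_def P2_def)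
  have P2: "mrat I S1 (\<lambda>y. pb' ** A y)" by (intro mrat_mult mrat_const A)
  have U: "U = {y \<in> S1. det (pb' ** A y) \<noteq> 0}"
    unfolding U_def u_def[symmetric] using eqs(3) by (auto simp: S1_def)
  show "open U" unfolding U by (rule op[OF rat_det[OF P2] oS1])
  have US: "U \<subseteq> S1" by (auto simp: U)
  obtain Q2 where Q2: "mrat I U Q2" "\<And>y. y \<in> U \<Longrightarrow> matrix_inv (pb' ** A y) = Q2 y"
    using mrat_inverse[OF mrat_subset[OF P2 US]] by (auto simp: U)
  show "\<exists>K' M' E'. mrat I U K' \<and> mrat I U M' \<and> mrat I U E' \<and>
      (\<forall>y\<in>U. change (K y, M y, E y) = (K' y, M' y, E' y))"
  proof (intro exI conjI ballI)
    show "mrat I U (\<lambda>y. pb' ** B y)" "mrat I U (\<lambda>y. pc' ** B y)" "mrat I U (\<lambda>y. pc' ** (A y ** Q2 y))"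
      by (intro mrat_mult mrat_const mrat_subset[OF A US] mrat_subset[OF B US] Q2)+
    show "change (K y, M y, E y) = (pb' ** B y, pc' ** B y, pc' ** (A y ** Q2 y))" if "y \<in> U" for y
      using that US eqs[of y] Q2(2)[OF that] unfolding u_def[symmetric] by (auto simp: change_def)
  qed
qed

end

section \<open>The atlas of the universal space\<close>

lemma eventually_inj_linear:
  fixes F :: "'t::topological_space \<Rightarrow> 'x::euclidean_space \<Rightarrow> 'y::euclidean_space"
  assumes lin: "\<And>y. linear (F y)" and inj: "inj (F y0)"
    and cont: "\<And>b. b \<in> Basis \<Longrightarrow> ((\<lambda>y. F y b) \<longlongrightarrow> F y0 b) (nhds y0)"
  shows "\<forall>\<^sub>F y in nhds y0. inj (F y)"
proof -
  obtain B where B: "B > 0" "\<And>x. B * norm x \<le> norm (F y0 x)"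
    using linear_inj_bounded_below_pos[OF lin inj] by blast
  have "((\<lambda>y. \<Sum>b\<in>Basis. norm (F y0 b - F y b)) \<longlongrightarrow> (\<Sum>b\<in>Basis. norm (F y0 b - F y0 b))) (nhds y0)"
    by (intro tendsto_intros cont)
  then have "\<forall>\<^sub>F y in nhds y0. (\<Sum>b\<in>Basis. norm (F y0 b - F y b)) < B"
    by (rule order_tendstoD(2)) (simp add: B)
  then show ?thesis
  proof eventually_elim
    case (elim y)
    show "inj (F y)"
      unfolding linear_injective_0[OF lin]
    proof (intro allI impI)
      fix x assume 0: "F y x = 0"
      have e: "F z x = (\<Sum>b\<in>Basis. (x \<bullet> b) *\<^sub>R F z b)" for z
        using arg_cong[OF euclidean_representation[of x, symmetric], of "F z"]
        by (simp add: linear_sum[OF lin] linear_cmul[OF lin])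
      have "B * norm x \<le> norm (F y0 x - F y x)" using B(2)[of x] 0 by simp
      also have "F y0 x - F y x = (\<Sum>b\<in>Basis. (x \<bullet> b) *\<^sub>R (F y0 b - F y b))"
        by (simp add: e[of y] e[of y0] scaleR_diff_right sum_subtractf)
      also have "norm \<dots> \<le> (\<Sum>b\<in>Basis. norm x * norm (F y0 b - F y b))"
        by (rule sum_norm_le) (auto intro!: mult_right_mono Basis_le_norm)
      also have "\<dots> = norm x * (\<Sum>b\<in>Basis. norm (F y0 b - F y b))" by (simp add: sum_distrib_left)
      finally have "norm x * (B - (\<Sum>b\<in>Basis. norm (F y0 b - F y b))) \<le> 0" by (simp add: algebra_simps)
      with elim show "x = 0" by (simp add: mult_le_0_iff)
    qed
  qed
qed

lemma subspace_range_mult: "vec.subspace (range ((*v) A))"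
  for A :: "'a::field ^ 'k ^ 'm"
  by (intro vec.linear_subspace_image vec.subspace_UNIV) simp

lemma dim_range_mult:
  fixes A :: "'a::field ^ 'k ^ 'm"
  assumes "\<And>x. A *v x = 0 \<Longrightarrow> x = 0"
  shows "vec.dim (range ((*v) A)) = CARD('k)"
proof -
  have "inj ((*v) A)" using assms by (simp add: vec.inj_iff_eq_0)
  then show ?thesis using vec.dim_image_eq[of "(*v) A" UNIV] by (simp add: card_cart_basis)
qed

lemma frame_dual: "is_frame f \<Longrightarrow> \<exists>a b c p q r. f = (a, b, c) \<and> dual_frame a b c p q r"
  using is_frame_dual by (metis prod_cases3)

lemma flag_in_grassmannian:
  fixes f :: "'n::finite frame"
  assumes "is_frame f"
  shows "flag_sub f u \<in> grassmannian (3 * CARD('n))" "flag_sup f u \<in> grassmannian (4 * CARD('n))"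
    "flag_sub f u \<subseteq> flag_sup f u"
proof -
  obtain a b c pa pb pc where f: "f = (a, b, c)" and "dual_frame a b c pa pb pc"
    using frame_dual[OF assms] by blast
  then interpret dual_frame a b c pa pb pc by blast
  have d1: "vec.dim (range ((*v) (col1 f u))) = 3 * CARD('n)"
    using dim_range_mult[of "col1 f u"] col_inj[of u _ 0] by (simp add: f mult.commute)
  have d2: "vec.dim (range ((*v) (col2 f u))) = CARD('n)"
    using dim_range_mult[of "col2 f u"] col_inj[of u 0] by (simp add: f)
  have int: "range ((*v) (col1 f u)) \<inter> range ((*v) (col2 f u)) = {0}"
  proof -
    have "w = 0" if "w = col1 f u *v s" "w = col2 f u *v q" for w s q
      using col_inj[of u s q] that by (simp add: f)
    moreover have "0 \<in> range ((*v) (col1 f u)) \<inter> range ((*v) (col2 f u))"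
      using rangeI[of "(*v) (col1 f u)" 0] rangeI[of "(*v) (col2 f u)" 0] by simp
    ultimately show ?thesis by blast
  qed
  show "flag_sub f u \<in> grassmannian (3 * CARD('n))"
    by (simp add: grassmannian_def flag_sub_col d1 subspace_range_mult)
  have "vec.dim (flag_sup f u) = 4 * CARD('n)"
    using vec.dim_sums_Int[OF subspace_range_mult[of "col1 f u"] subspace_range_mult[of "col2 f u"]]
    by (simp add: flag_sup_col ssum_def int d1 d2 conj_commute)
  moreover have "vec.subspace (flag_sup f u)"
    using vec.subspace_sums[OF subspace_range_mult[of "col1 f u"] subspace_range_mult[of "col2 f u"]]
    by (simp add: flag_sup_col ssum_def conj_commute)
  ultimately show "flag_sup f u \<in> grassmannian (4 * CARD('n))" by (simp add: grassmannian_def)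
  have "w \<in> flag_sup f u" if "w \<in> flag_sub f u" for w
  proof -
    have "w + 0 \<in> flag_sup f u"
      unfolding flag_sup_col ssum_def using that rangeI[of "(*v) (col2 f u)" 0]
      by (auto simp: flag_sub_col simp del: add_0_right)
    then show ?thesis by simp
  qed
  then show "flag_sub f u \<subseteq> flag_sup f u" by blast
qed

lemma ssum_UNIV_dim:
  fixes S T :: "'n::finite amb set"
  assumes "S \<in> grassmannian (4 * CARD('n))" "T \<in> grassmannian (4 * CARD('n))" "S \<inter> T = {0}"
  shows "ssum S T = UNIV"
proof -
  have S: "vec.subspace S" "vec.subspace T" "vec.dim S = 4 * CARD('n)" "vec.dim T = 4 * CARD('n)"
    using assms by (auto simp: grassmannian_def)
  have "vec.dim {s + t |s t. s \<in> S \<and> t \<in> T} = 8 * CARD('n)"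
    using vec.dim_sums_Int[OF S(1,2)] S(3,4) by (simp add: assms(3))
  moreover have "vec.subspace {s + t |s t. s \<in> S \<and> t \<in> T}"
    using vec.subspace_sums[OF S(1,2)] by simp
  ultimately show ?thesis
    unfolding ssum_def using vec.dim_eq_full[of "{s + t |s t. s \<in> S \<and> t \<in> T}"]
    by (simp add: vec.span_eq_iff[THEN iffD2] vec.dimension_def card_cart_basis mult.commute)
qed

lemma Z_param_in_Z_iff:
  fixes f g :: "'n::finite frame"
  assumes "is_frame f" "is_frame g"
  shows "Z_param f g (z, u, w) \<in> Z_space \<longleftrightarrow> flag_sup f u \<inter> flag_sup g w = {0}"
  using flag_in_grassmannian[OF assms(1), of u] flag_in_grassmannian[OF assms(2), of w]
    ssum_UNIV_dim[of "flag_sup f u" "flag_sup g w"]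
  by (auto simp: Z_param_def Z_space_def)

definition Z_dom :: "'n::finite frame \<Rightarrow> 'n frame \<Rightarrow> 'n zmodel set" where
  "Z_dom f g = {y. Z_param f g y \<in> Z_space}"

lemma mrat_zmodel_coords:
  "mrat zmodel_i S (\<lambda>y :: 'n::finite zmodel. fst (fst (snd y)))"
  "mrat zmodel_i S (\<lambda>y :: 'n zmodel. fst (snd (fst (snd y))))"
  "mrat zmodel_i S (\<lambda>y :: 'n zmodel. snd (snd (fst (snd y))))"
  "mrat zmodel_i S (\<lambda>y :: 'n zmodel. fst (snd (snd y)))"
  "mrat zmodel_i S (\<lambda>y :: 'n zmodel. fst (snd (snd (snd y))))"
  "mrat zmodel_i S (\<lambda>y :: 'n zmodel. snd (snd (snd (snd y))))"
  unfolding mrat_def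
  by (intro allI rat_lin; auto simp: zmodel_i_def fcoord_i_def mat_scalar_mult
      linear_conv_bounded_linear[symmetric] intro!: linearI)+

lemma rat_zmodel_z: "rat zmodel_i S (\<lambda>y :: 'n::finite zmodel. fst y $ i)"
  by (rule rat_lin) (auto simp: zmodel_i_def linear_conv_bounded_linear[symmetric] intro!: linearI)

lemma mrat_col:
  "mrat zmodel_i S (\<lambda>y :: 'n::finite zmodel. col1 f (fst (snd y)))"
  "mrat zmodel_i S (\<lambda>y :: 'n zmodel. col2 f (fst (snd y)))"
  "mrat zmodel_i S (\<lambda>y :: 'n zmodel. col1 f (snd (snd y)))"
  "mrat zmodel_i S (\<lambda>y :: 'n zmodel. col2 f (snd (snd y)))"
  by (cases f; simp only: col1_def col2_def prod.case case_prod_unfold fst_conv snd_conv;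
      intro mrat_add mrat_mult mrat_const mrat_zmodel_coords)+

lemma mrat_continuous_on:
  assumes "mrat I S M"
  shows "continuous_on S (\<lambda>y. M y *v x)"
  unfolding matrix_vector_mult_def
  using assms by (intro continuous_intros rat_continuous_on) (auto simp: mrat_def)

lemma matrix_vector_scaleR: "A *v (r *\<^sub>R x) = r *\<^sub>R (A *v x)" for A :: "complex ^ 'k ^ 'm"
  by (simp add: matrix_vector_mult_def vec_eq_iff scaleR_sum_right)

lemma scaleR_vec: "r *\<^sub>R x = complex_of_real r *s x" for x :: "complex ^ 'k"
  unfolding vec_eq_iff by (simp add: scaleR_conv_of_real[where 'a = complex])

lemma subspace_if_complex: "vec.subspace S \<Longrightarrow> subspace S" for S :: "(complex ^ 'k) set"
  unfolding subspace_def vec.subspace_def by (simp add: scaleR_vec)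

lemma open_Z_dom:
  fixes f g :: "'n::finite frame"
  assumes f: "is_frame f" and g: "is_frame g"
  shows "open (Z_dom f g)"
proof -
  define F where "F y = (\<lambda>(s, q, s', q'). col1 f (fst (snd y)) *v s + col2 f (fst (snd y)) *v q
      - (col1 g (snd (snd y)) *v s' + col2 g (snd (snd y)) *v q'))" for y :: "'n zmodel"
  obtain a b c pa pb pc where f': "f = (a, b, c)" and "dual_frame a b c pa pb pc" using frame_dual[OF f] by blast
  then interpret F: dual_frame a b c pa pb pc by blast
  obtain a' b' c' pa' pb' pc' where g': "g = (a', b', c')" and "dual_frame a' b' c' pa' pb' pc'" using frame_dual[OF g] by blast
  then interpret G: dual_frame a' b' c' pa' pb' pc' by blast
  have lin: "linear (F y)" for y
    by (rule linearI) (auto simp: F_def matrix_vector_right_distrib algebra_simps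
        matrix_vector_scaleR split: prod.splits)
  have cont: "((\<lambda>y. F y x) \<longlongrightarrow> F y0 x) (nhds y0)" for x y0
  proof -
    have "continuous_on UNIV (\<lambda>y. F y x)"
      by (cases x) (auto simp: F_def intro!: continuous_intros mrat_continuous_on mrat_col)
    then have "isCont (\<lambda>y. F y x) y0" by (rule continuous_on_interior) simp
    then show ?thesis
      unfolding isCont_def using tendsto_at_iff_tendsto_nhds[of "\<lambda>y. F y x" y0] by blast
  qed
  have iff: "y \<in> Z_dom f g \<longleftrightarrow> inj (F y)" for y
  proof -
    obtain z u w where y: "y = (z, u, w)" by (cases y)
    have "inj (F y) \<longleftrightarrow> (\<forall>s q s' q'. col1 f u *v s + col2 f u *v q = col1 g w *v s' + col2 g w *v q'
        \<longrightarrow> s = 0 \<and> q = 0 \<and> s' = 0 \<and> q' = 0)"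
      unfolding linear_injective_0[OF lin] by (simp add: F_def y zero_prod_def split_paired_All)
    also have "\<dots> \<longleftrightarrow> flag_sup f u \<inter> flag_sup g w = {0}" (is "?L \<longleftrightarrow> ?R")
    proof
      assume L: ?L
      have "v = 0" if "v \<in> flag_sup f u" "v \<in> flag_sup g w" for v
      proof -
        obtain s q where v: "v = col1 f u *v s + col2 f u *v q"
          using \<open>v \<in> flag_sup f u\<close> unfolding flag_sup_col ssum_def by blast
        obtain s' q' where "v = col1 g w *v s' + col2 g w *v q'"
          using \<open>v \<in> flag_sup g w\<close> unfolding flag_sup_col ssum_def by blast
        then have "s = 0 \<and> q = 0" using L v by metis
        then show ?thesis using v by simp
      qed
      moreover have "0 \<in> flag_sup f u" "0 \<in> flag_sup g w"
        using flag_in_grassmannian[OF f, of u] flag_in_grassmannian[OF g, of w]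
        by (auto simp: grassmannian_def intro: vec.subspace_0)
      ultimately show ?R by blast
    next
      assume R: ?R
      show ?L
      proof (intro allI impI)
        fix s q s' q' assume e: "col1 f u *v s + col2 f u *v q = col1 g w *v s' + col2 g w *v q'"
        have "col1 f u *v s + col2 f u *v q \<in> flag_sup f u" "col1 g w *v s' + col2 g w *v q' \<in> flag_sup g w"
          unfolding flag_sup_col ssum_def by blast+
        then have 0: "col1 f u *v s + col2 f u *v q = 0" "col1 g w *v s' + col2 g w *v q' = 0"
          using R unfolding e by auto
        then have "col1 f u *v s = col2 f u *v (- q)" "col1 g w *v s' = col2 g w *v (- q')"
          by (simp_all add: vec.neg eq_neg_iff_add_eq_0)
        then show "s = 0 \<and> q = 0 \<and> s' = 0 \<and> q' = 0"
          using F.col_inj[of u s "- q"] G.col_inj[of w s' "- q'"] by (simp add: f' g')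
      qed
    qed
    finally show ?thesis by (simp add: Z_dom_def y Z_param_in_Z_iff[OF f g])
  qed
  show ?thesis
    unfolding open_subopen[of "Z_dom f g"]
  proof
    fix y0 assume "y0 \<in> Z_dom f g"
    then have "\<forall>\<^sub>F y in nhds y0. inj (F y)"
      using iff by (intro eventually_inj_linear lin cont) auto
    then show "\<exists>T. open T \<and> y0 \<in> T \<and> T \<subseteq> Z_dom f g"
      unfolding eventually_nhds using iff by blast
  qed
qed

definition zchart :: "'n::finite frame \<Rightarrow> 'n frame \<Rightarrow> ('n zpoint, 'n zmodel) chart" where
  "zchart f g = (Z_space \<inter> range (Z_param f g), inv (Z_param f g))"

lemma mem_Z_atlas: "d \<in> Z_atlas \<longleftrightarrow> (\<exists>f g. d = zchart f g \<and> is_frame f \<and> is_frame g)"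
  by (simp only: Z_atlas_def zchart_def mem_Collect_eq)

lemma Z_atlasE:
  assumes "d \<in> Z_atlas"
  obtains f g where "is_frame f" "is_frame g" "d = zchart f g"
  using assms[unfolded mem_Z_atlas] that by metis

context
  fixes f g :: "'n::finite frame"
  assumes f: "is_frame f" and g: "is_frame g"
begin

lemma snd_zchart: "snd (zchart f g) (Z_param f g y) = y"
  by (simp add: zchart_def inj_Z_param[OF f g])

lemma mem_fst_zchart: "P \<in> fst (zchart f g) \<longleftrightarrow> (\<exists>y\<in>Z_dom f g. P = Z_param f g y)"
  unfolding zchart_def Z_dom_def fst_conv by blast

lemma inj_on_zchart: "inj_on (snd (zchart f g)) (fst (zchart f g))"
proof (rule inj_onI)
  fix P Q assume "P \<in> fst (zchart f g)" "Q \<in> fst (zchart f g)" and e: "snd (zchart f g) P = snd (zchart f g) Q"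
  then obtain y y' where "P = Z_param f g y" "Q = Z_param f g y'" unfolding mem_fst_zchart by (elim bexE)
  then show "P = Q" using e by (simp only: snd_zchart)
qed

lemma chart_inv_zchart: "y \<in> Z_dom f g \<Longrightarrow> chart_inv (zchart f g) y = Z_param f g y"
  unfolding chart_inv_def mem_fst_zchart
  by (rule inv_into_f_eq[OF inj_on_zchart _ snd_zchart], unfold mem_fst_zchart, rule bexI[of _ y]) (rule refl)

end

lemma inj_on_Z_chart: "d \<in> Z_atlas \<Longrightarrow> inj_on (snd d) (fst d)"
  by (metis Z_atlasE inj_on_zchart)

lemma Z_transition_rational:
  fixes c d :: "('n::finite zpoint, 'n zmodel) chart"
  assumes "c \<in> Z_atlas" "d \<in> Z_atlas"
  shows "open (snd c ` (fst c \<inter> fst d))"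
    and "\<exists>F. vrat zmodel_i zmodel_i (snd c ` (fst c \<inter> fst d)) F \<and>
      (\<forall>y \<in> snd c ` (fst c \<inter> fst d). transition c d y = F y)"
proof -
  obtain f g where f: "is_frame f" and g: "is_frame g" and c: "c = zchart f g" using assms(1) by (rule Z_atlasE)
  obtain f' g' where f': "is_frame f'" and g': "is_frame g'" and d: "d = zchart f' g'" using assms(2) by (rule Z_atlasE)
  obtain a1 b1 c1 p1 q1 r1 where e1: "f = (a1, b1, c1)" and D1: "dual_frame a1 b1 c1 p1 q1 r1" using frame_dual[OF f] by blast
  obtain a2 b2 c2 p2 q2 r2 where e2: "g = (a2, b2, c2)" and D2: "dual_frame a2 b2 c2 p2 q2 r2" using frame_dual[OF g] by blast
  obtain a3 b3 c3 p3 q3 r3 where e3: "f' = (a3, b3, c3)" and D3: "dual_frame a3 b3 c3 p3 q3 r3" using frame_dual[OF f'] by blast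
  obtain a4 b4 c4 p4 q4 r4 where e4: "g' = (a4, b4, c4)" and D4: "dual_frame a4 b4 c4 p4 q4 r4" using frame_dual[OF g'] by blast
  interpret F: frame_pair a1 b1 c1 p1 q1 r1 a3 b3 c3 p3 q3 r3 using D1 D3 by (rule frame_pair.intro)
  interpret G: frame_pair a2 b2 c2 p2 q2 r2 a4 b4 c4 p4 q4 r4 using D2 D4 by (rule frame_pair.intro)
  define U where "U = {y \<in> Z_dom f g. det (F.P1 (fst (fst (snd y)), fst (snd (fst (snd y))), snd (snd (fst (snd y))))) \<noteq> 0 \<and>
     det (F.P2 (fst (fst (snd y)), fst (snd (fst (snd y))), snd (snd (fst (snd y))))) \<noteq> 0}"
  define V where "V = {y \<in> U. det (G.P1 (fst (snd (snd y)), fst (snd (snd (snd y))), snd (snd (snd (snd y))))) \<noteq> 0 \<and>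
     det (G.P2 (fst (snd (snd y)), fst (snd (snd (snd y))), snd (snd (snd (snd y))))) \<noteq> 0}"
  note FU = F.mrat_change[OF mrat_zmodel_coords(1-3) open_Z_dom[OF f g], folded U_def]
  note GV = G.mrat_change[OF mrat_zmodel_coords(4-6) FU(1), folded V_def]
  have V_iff: "y \<in> V \<longleftrightarrow> y \<in> Z_dom f g \<and> det (F.P1 (fst (snd y))) \<noteq> 0 \<and> det (F.P2 (fst (snd y))) \<noteq> 0 \<and>
      det (G.P1 (snd (snd y))) \<noteq> 0 \<and> det (G.P2 (snd (snd y))) \<noteq> 0" for y
    by (auto simp: V_def U_def)
  define H where "H y = (fst y, F.change (fst (snd y)), G.change (snd (snd y)))" for y :: "'n zmodel"
  have V1: "Z_param f' g' (H y) = Z_param f g y \<and> H y \<in> Z_dom f' g'" if "y \<in> V" for y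
  proof -
    have "Z_param f' g' (H y) = Z_param f g y"
      using that F.flag_change[of "fst (snd y)"] G.flag_change[of "snd (snd y)"]
      by (cases y) (auto simp: V_iff Z_param_def H_def e1 e2 e3 e4)
    with that show ?thesis by (auto simp: V_iff Z_dom_def)
  qed
  have eq: "snd c ` (fst c \<inter> fst d) = V"
  proof (intro subset_antisym subsetI)
    fix y assume "y \<in> snd c ` (fst c \<inter> fst d)"
    then obtain P where P: "P \<in> fst c" "P \<in> fst d" "y = snd c P" by blast
    then have y: "y \<in> Z_dom f g" "P = Z_param f g y"
      unfolding c mem_fst_zchart[OF f g] using snd_zchart[OF f g] by auto
    obtain y' where y': "y' \<in> Z_dom f' g'" "P = Z_param f' g' y'"
      using P(2) unfolding d mem_fst_zchart[OF f' g'] by blast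
    have "Z_param f' g' y' = Z_param f g y" using y y' by simp
    then show "y \<in> V"
      using F.pivots_nz[of "fst (snd y')" "fst (snd y)"] G.pivots_nz[of "snd (snd y')" "snd (snd y)"] y(1)
      by (cases y; cases y') (auto simp: V_iff Z_param_def e1 e2 e3 e4)
  next
    fix y assume y: "y \<in> V"
    then have "Z_param f g y \<in> fst c" "Z_param f g y \<in> fst d"
      unfolding c d mem_fst_zchart[OF f g] mem_fst_zchart[OF f' g'] using V1[OF y] V_iff by metis+
    then show "y \<in> snd c ` (fst c \<inter> fst d)"
      using snd_zchart[OF f g, of y] unfolding c by (metis IntI imageI)
  qed
  show "open (snd c ` (fst c \<inter> fst d))" unfolding eq by (rule GV(1))
  obtain K M E where FK: "mrat zmodel_i U K" "mrat zmodel_i U M" "mrat zmodel_i U E"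
    "\<forall>y\<in>U. F.change (fst (fst (snd y)), fst (snd (fst (snd y))), snd (snd (fst (snd y)))) = (K y, M y, E y)"
    using FU(2) by blast
  obtain K' M' E' where GK: "mrat zmodel_i V K'" "mrat zmodel_i V M'" "mrat zmodel_i V E'"
    "\<forall>y\<in>V. G.change (fst (snd (snd y)), fst (snd (snd (snd y))), snd (snd (snd (snd y)))) = (K' y, M' y, E' y)"
    using GV(2) by blast
  have VU: "V \<subseteq> U" by (auto simp: V_def)
  have "vrat zmodel_i zmodel_i V (\<lambda>y. (fst y, (K y, M y, E y), (K' y, M' y, E' y)))"
    by (intro vrat_zmodel rat_zmodel_z mrat_subset[OF _ VU] FK(1-3) GK(1-3))
  moreover have "transition c d y = (fst y, (K y, M y, E y), (K' y, M' y, E' y))" if "y \<in> V" for y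
  proof -
    have "transition c d y = snd d (Z_param f g y)"
      using that V_iff chart_inv_zchart[OF f g] unfolding c by (simp add: transition_def)
    also have "\<dots> = H y" using V1[OF that] snd_zchart[OF f' g'] unfolding d by metis
    finally show ?thesis using FK(4) GK(4) that VU by (auto simp: H_def)
  qed
  ultimately show "\<exists>F. vrat zmodel_i zmodel_i (snd c ` (fst c \<inter> fst d)) F \<and>
      (\<forall>y \<in> snd c ` (fst c \<inter> fst d). transition c d y = F y)"
    unfolding eq by blast
qed

definition zshift :: "'n::finite amb \<Rightarrow> 'n zpoint \<Rightarrow> 'n zpoint" where
  "zshift t = (\<lambda>(z, S). (z + t, S))"

lemma zshift_zchart:
  assumes "d \<in> Z_atlas" "P \<in> fst d"
  shows "zshift t P \<in> fst d" "snd d (zshift t P) = snd d P + (t, 0)" "fst (snd d P) = fst P"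
proof -
  obtain f g where fg: "is_frame f" "is_frame g" and d: "d = zchart f g" using assms(1) by (rule Z_atlasE)
  obtain z u w where y: "(z, u, w) \<in> Z_dom f g" "P = Z_param f g (z, u, w)"
    using assms(2) unfolding d mem_fst_zchart[OF fg] by auto
  have *: "zshift t P = Z_param f g (z + t, u, w)" by (simp add: y zshift_def Z_param_def)
  have "(z + t, u, w) \<in> Z_dom f g" using y(1) by (simp add: Z_dom_def Z_param_in_Z_iff[OF fg])
  then show "zshift t P \<in> fst d" unfolding d mem_fst_zchart[OF fg] * by blast
  have 1: "snd d P = (z, u, w)" unfolding d y(2) snd_zchart[OF fg] ..
  have "snd d (zshift t P) = (z + t, u, w)" unfolding d * snd_zchart[OF fg] ..
  then show "snd d (zshift t P) = snd d P + (t, 0)" unfolding 1 by simp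
  show "fst (snd d P) = fst P" unfolding 1 unfolding y(2) by (simp add: Z_param_def)
qed

section \<open>Tangent spaces\<close>

locale diff_atlas =
  fixes A :: "('a, 'e::euclidean_space) chart set"
  assumes inj_chart: "c \<in> A \<Longrightarrow> inj_on (snd c) (fst c)"
    and open_overlap: "c \<in> A \<Longrightarrow> d \<in> A \<Longrightarrow> open (snd c ` (fst c \<inter> fst d))"
    and transition_differentiable: "c \<in> A \<Longrightarrow> d \<in> A \<Longrightarrow> x \<in> fst c \<Longrightarrow> x \<in> fst d \<Longrightarrow>
      transition c d differentiable (at (snd c x))"
begin

lemma chart_inv_chart: "c \<in> A \<Longrightarrow> x \<in> fst c \<Longrightarrow> chart_inv c (snd c x) = x"
  unfolding chart_inv_def by (simp add: inj_chart inv_into_f_f)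

lemma transition_chart: "c \<in> A \<Longrightarrow> x \<in> fst c \<Longrightarrow> transition c d (snd c x) = snd d x"
  by (simp add: transition_def chart_inv_chart)

lemma transition_has_derivative:
  "c \<in> A \<Longrightarrow> d \<in> A \<Longrightarrow> x \<in> fst c \<Longrightarrow> x \<in> fst d \<Longrightarrow>
    (transition c d has_derivative frechet_derivative (transition c d) (at (snd c x))) (at (snd c x))"
  using transition_differentiable frechet_derivative_works by blast

lemma transition_self:
  assumes "c \<in> A" "x \<in> fst c"
  shows "frechet_derivative (transition c c) (at (snd c x)) = id"
proof -
  have "(transition c c has_derivative id) (at (snd c x))"
  proof (rule has_derivative_transform_within_open[of id id])
    show "open (snd c ` (fst c \<inter> fst c))" using assms open_overlap by blast
  qed (use assms in \<open>auto simp: transition_chart\<close>)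
  then show ?thesis using frechet_derivative_at by metis
qed

lemma transition_cocycle:
  assumes "c \<in> A" "d \<in> A" "e \<in> A" "x \<in> fst c" "x \<in> fst d" "x \<in> fst e"
  shows "frechet_derivative (transition c e) (at (snd c x)) =
    frechet_derivative (transition d e) (at (snd d x)) \<circ> frechet_derivative (transition c d) (at (snd c x))"
proof -
  have "(transition d e \<circ> transition c d has_derivative
      frechet_derivative (transition d e) (at (snd d x)) \<circ> frechet_derivative (transition c d) (at (snd c x)))
      (at (snd c x))"
    by (rule diff_chain_at) (use assms transition_has_derivative in \<open>auto simp: transition_chart\<close>)
  then have "(transition c e has_derivative
      frechet_derivative (transition d e) (at (snd d x)) \<circ> frechet_derivative (transition c d) (at (snd c x)))
      (at (snd c x))"
  proof (rule has_derivative_transform_within_open)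
    show "open (snd c ` (fst c \<inter> fst d))" using assms open_overlap by blast
  qed (use assms in \<open>auto simp: transition_chart\<close>)
  then show ?thesis using frechet_derivative_at by metis
qed

lemma linear_transition:
  "c \<in> A \<Longrightarrow> d \<in> A \<Longrightarrow> x \<in> fst c \<Longrightarrow> x \<in> fst d \<Longrightarrow> linear (frechet_derivative (transition c d) (at (snd c x)))"
  using transition_has_derivative has_derivative_linear by blast

lemma tangent_transition:
  "v \<in> tangent_space A x \<Longrightarrow> c \<in> A \<Longrightarrow> d \<in> A \<Longrightarrow> x \<in> fst c \<Longrightarrow> x \<in> fst d \<Longrightarrow>
    v d = frechet_derivative (transition c d) (at (snd c x)) (v c)"
  unfolding tangent_space_def by blast

lemma tangent_outside: "v \<in> tangent_space A x \<Longrightarrow> \<not> (c \<in> A \<and> x \<in> fst c) \<Longrightarrow> v c = 0"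
  unfolding tangent_space_def by blast

lemma tangent_eqI:
  assumes "v \<in> tangent_space A x" "w \<in> tangent_space A x" "c \<in> A" "x \<in> fst c" "v c = w c"
  shows "v = w"
proof
  show "v d = w d" for d
  proof (cases "d \<in> A \<and> x \<in> fst d")
    case True
    then show ?thesis
      using tangent_transition[OF assms(1) assms(3) _ assms(4), of d]
        tangent_transition[OF assms(2) assms(3) _ assms(4), of d] assms(5) by simp
  next
    case False
    then show ?thesis using tangent_outside[OF assms(1) False] tangent_outside[OF assms(2) False] by simp
  qed
qed

lemma tangent_spaceI:
  assumes "c \<in> A" "x \<in> fst c" "\<And>d. \<not> (d \<in> A \<and> x \<in> fst d) \<Longrightarrow> v d = 0"
    "\<And>d. d \<in> A \<Longrightarrow> x \<in> fst d \<Longrightarrow> v d = frechet_derivative (transition c d) (at (snd c x)) (v c)"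
  shows "v \<in> tangent_space A x"
  unfolding tangent_space_def
proof (intro CollectI conjI allI ballI impI)
  fix d e assume de: "d \<in> A" "e \<in> A" "x \<in> fst d" "x \<in> fst e"
  show "v e = frechet_derivative (transition d e) (at (snd d x)) (v d)"
    using assms(4)[OF de(1,3)] assms(4)[OF de(2,4)] transition_cocycle[of c d e x] assms(1,2) de by simp
qed (rule assms(3))

lemma tvec_of_self: "c \<in> A \<Longrightarrow> x \<in> fst c \<Longrightarrow> tvec_of A x c e c = e"
  by (simp add: tvec_of_def transition_self)

lemma tvec_of_tangent: "c \<in> A \<Longrightarrow> x \<in> fst c \<Longrightarrow> tvec_of A x c e \<in> tangent_space A x"
  by (rule tangent_spaceI[of c]) (auto simp: tvec_of_def transition_self)

lemma tvec_of_eq: "v \<in> tangent_space A x \<Longrightarrow> c \<in> A \<Longrightarrow> x \<in> fst c \<Longrightarrow> tvec_of A x c (v c) = v"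
  by (rule tangent_eqI[of _ x _ c]) (auto simp: tvec_of_tangent tvec_of_self)

lemma tangent_add:
  assumes "v \<in> tangent_space A x" "w \<in> tangent_space A x"
  shows "(\<lambda>c. v c + w c) \<in> tangent_space A x"
  unfolding tangent_space_def
proof (intro CollectI conjI allI ballI impI)
  fix d e assume de: "d \<in> A" "e \<in> A" "x \<in> fst d" "x \<in> fst e"
  show "v e + w e = frechet_derivative (transition d e) (at (snd d x)) (v d + w d)"
    using tangent_transition[OF assms(1) de] tangent_transition[OF assms(2) de] linear_transition[OF de]
    by (simp add: linear_add)
qed (simp add: tangent_outside[OF assms(1)] tangent_outside[OF assms(2)])

lemma tangent_scaleR:
  assumes "v \<in> tangent_space A x"
  shows "(\<lambda>c. r *\<^sub>R v c) \<in> tangent_space A x"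
  unfolding tangent_space_def
proof (intro CollectI conjI allI ballI impI)
  fix d e assume de: "d \<in> A" "e \<in> A" "x \<in> fst d" "x \<in> fst e"
  show "r *\<^sub>R v e = frechet_derivative (transition d e) (at (snd d x)) (r *\<^sub>R v d)"
    using tangent_transition[OF assms(1) de] linear_transition[OF de] by (simp add: linear_cmul)
qed (simp add: tangent_outside[OF assms])

lemma tangent_zero: "(\<lambda>_. 0) \<in> tangent_space A x"
  unfolding tangent_space_def using linear_transition by (auto simp: linear_0)

lemma tangent_minus: "v \<in> tangent_space A x \<Longrightarrow> (\<lambda>c. - v c) \<in> tangent_space A x"
  using tangent_scaleR[of v x "-1"] by simp

lemma tangent_diff:
  "v \<in> tangent_space A x \<Longrightarrow> w \<in> tangent_space A x \<Longrightarrow> (\<lambda>c. v c - w c) \<in> tangent_space A x"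
  using tangent_add[OF _ tangent_minus, of v x w] by simp

lemma tvec_of_add: "c \<in> A \<Longrightarrow> x \<in> fst c \<Longrightarrow>
    tvec_of A x c (e + e') = (\<lambda>d. tvec_of A x c e d + tvec_of A x c e' d)"
  by (rule tangent_eqI[of _ x _ c]) (auto simp: tvec_of_self intro: tvec_of_tangent tangent_add)

lemma tvec_of_scaleR: "c \<in> A \<Longrightarrow> x \<in> fst c \<Longrightarrow>
    tvec_of A x c (r *\<^sub>R e) = (\<lambda>d. r *\<^sub>R tvec_of A x c e d)"
  by (rule tangent_eqI[of _ x _ c]) (auto simp: tvec_of_self intro: tvec_of_tangent tangent_scaleR)

end

lemma Z_transition_derivative:
  fixes c d :: "('n::finite zpoint, 'n zmodel) chart"
  assumes "c \<in> Z_atlas" "d \<in> Z_atlas" "P \<in> fst c" "P \<in> fst d"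
  shows "\<exists>D. (transition c d has_derivative D) (at (snd c P)) \<and> (\<forall>e. D (zmodel_i e) = zmodel_i (D e))"
proof -
  obtain F where F: "vrat zmodel_i zmodel_i (snd c ` (fst c \<inter> fst d)) F"
    "\<forall>y\<in>snd c ` (fst c \<inter> fst d). transition c d y = F y"
    using Z_transition_rational(2)[OF assms(1,2)] by blast
  have y: "snd c P \<in> snd c ` (fst c \<inter> fst d)" using assms by blast
  obtain D where D: "(F has_derivative D) (at (snd c P))" "\<forall>e. D (zmodel_i e) = zmodel_i (D e)"
    using vrat_has_derivative[OF F(1) linear_zmodel_i] y by blast
  have "(transition c d has_derivative D) (at (snd c P))"
    by (rule has_derivative_transform_within_open[OF D(1) Z_transition_rational(1)[OF assms(1,2)] y])
      (rule bspec[OF F(2), symmetric])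
  with D(2) show ?thesis by blast
qed

interpretation Z: diff_atlas "Z_atlas :: ('n::finite zpoint, 'n zmodel) chart set"
  by unfold_locales (use Z_transition_derivative in
    \<open>blast intro: inj_on_Z_chart Z_transition_rational(1) differentiableI\<close>)+

lemma Z_transition_i:
  assumes "c \<in> Z_atlas" "d \<in> Z_atlas" "P \<in> fst c" "P \<in> fst d"
  shows "frechet_derivative (transition c d) (at (snd c P)) (zmodel_i e) =
    zmodel_i (frechet_derivative (transition c d) (at (snd c P)) e)"
  using Z_transition_derivative[OF assms] frechet_derivative_at by metis

lemma Z_transition_shift:
  assumes "c \<in> Z_atlas" "d \<in> Z_atlas" "P \<in> fst c" "P \<in> fst d"
  shows "transition c d (snd c P + (t, 0)) = transition c d (snd c P) + (t, 0)"
  using zshift_zchart(2)[OF assms(1,3), of t] zshift_zchart(2)[OF assms(2,4), of t]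
    Z.transition_chart[OF assms(1) zshift_zchart(1)[OF assms(1,3), of t], of d]
    Z.transition_chart[OF assms(1,3), of d] by simp

lemma Z_transition_derivative_shift:
  fixes c d :: "('n::finite zpoint, 'n zmodel) chart"
  assumes "c \<in> Z_atlas" "d \<in> Z_atlas" "P \<in> fst c" "P \<in> fst d"
  shows "frechet_derivative (transition c d) (at (snd c (zshift t P))) =
    frechet_derivative (transition c d) (at (snd c P))"
proof -
  let ?D = "frechet_derivative (transition c d) (at (snd c (zshift t P)))"
  note t = zshift_zchart(1,2)[OF assms(1,3), of t] zshift_zchart(1)[OF assms(2,4), of t]
  have "(transition c d \<circ> (\<lambda>y. y + (t, 0)) has_derivative ?D \<circ> (\<lambda>e. e)) (at (snd c P))"
  proof (rule diff_chain_at)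
    show "((\<lambda>y. y + (t, 0)) has_derivative (\<lambda>e. e)) (at (snd c P))"
      by (auto intro!: derivative_eq_intros)
    show "(transition c d has_derivative ?D) (at (snd c P + (t, 0)))"
      using Z.transition_has_derivative[OF assms(1,2) t(1) t(3)] by (simp add: t(2))
  qed
  then have "((\<lambda>y. transition c d (y + (t, 0)) - (t, 0)) has_derivative ?D) (at (snd c P))"
    by (auto simp: o_def intro: derivative_eq_intros)
  then have "(transition c d has_derivative ?D) (at (snd c P))"
  proof (rule has_derivative_transform_within_open)
    show "open (snd c ` (fst c \<inter> fst d))" using assms Z.open_overlap by blast
  qed (use assms in \<open>auto simp: Z_transition_shift\<close>)
  then show ?thesis using frechet_derivative_at by metis
qed

lemma Z_transition_fst:
  fixes c d :: "('n::finite zpoint, 'n zmodel) chart"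
  assumes "c \<in> Z_atlas" "d \<in> Z_atlas" "P \<in> fst c" "P \<in> fst d"
  shows "fst (frechet_derivative (transition c d) (at (snd c P)) e) = fst e"
proof -
  have "((\<lambda>y. fst (transition c d y)) has_derivative
      (\<lambda>e. fst (frechet_derivative (transition c d) (at (snd c P)) e))) (at (snd c P))"
    by (intro has_derivative_fst Z.transition_has_derivative assms)
  moreover have "((\<lambda>y. fst (transition c d y)) has_derivative fst) (at (snd c P))"
  proof (rule has_derivative_transform_within_open[of fst])
    show "(fst has_derivative fst) (at (snd c P))"
      by (rule bounded_linear_imp_has_derivative[OF bounded_linear_fst])
    show "open (snd c ` (fst c \<inter> fst d))" using assms Z.open_overlap by blast
  qed (use assms in \<open>auto simp: Z.transition_chart zshift_zchart(3)\<close>)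
  ultimately show ?thesis by (metis has_derivative_unique)
qed

lemma Z_transition_horizontal:
  fixes c d :: "('n::finite zpoint, 'n zmodel) chart"
  assumes "c \<in> Z_atlas" "d \<in> Z_atlas" "P \<in> fst c" "P \<in> fst d"
  shows "frechet_derivative (transition c d) (at (snd c P)) (t, 0) = (t, 0)"
proof -
  let ?D = "frechet_derivative (transition c d) (at (snd c P))"
  have "((transition c d \<circ> (\<lambda>r. snd c P + r *\<^sub>R (t, 0))) has_derivative ?D \<circ> (\<lambda>r. r *\<^sub>R (t, 0))) (at (0::real))"
  proof (rule diff_chain_at)
    show "((\<lambda>r. snd c P + r *\<^sub>R (t, 0)) has_derivative (\<lambda>r. r *\<^sub>R (t, 0))) (at 0)"
      by (auto intro!: derivative_eq_intros)
  qed (use Z.transition_has_derivative[OF assms] in \<open>simp add: zero_prod_def[symmetric]\<close>)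
  moreover have "transition c d \<circ> (\<lambda>r. snd c P + r *\<^sub>R (t, 0)) = (\<lambda>r. transition c d (snd c P) + r *\<^sub>R (t, 0))"
    using Z_transition_shift[OF assms] by (simp add: fun_eq_iff)
  moreover have "((\<lambda>r. transition c d (snd c P) + r *\<^sub>R (t, 0)) has_derivative (\<lambda>r. r *\<^sub>R (t, 0))) (at (0::real))"
    by (auto intro!: derivative_eq_intros)
  ultimately have "?D \<circ> (\<lambda>r. r *\<^sub>R (t, 0)) = (\<lambda>r::real. r *\<^sub>R (t, 0))" by (metis has_derivative_unique)
  from fun_cong[OF this, of 1] show ?thesis by simp
qed

text \<open>The tangent vector of \<open>Z\<close> at \<open>P\<close> that moves only the base point, with velocity \<open>w\<close>.\<close>

definition hz :: "'n::finite zpoint \<Rightarrow> 'n amb \<Rightarrow> 'n ztvec" where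
  "hz P w = (\<lambda>d. if d \<in> Z_atlas \<and> P \<in> fst d then (w, 0) else 0)"

lemma zmodel_i_simps: "zmodel_i 0 = 0" "zmodel_i (w, 0) = (\<i> *s w, 0)"
  by (auto simp: zmodel_i_def zero_prod_def fcoord_i_def)

lemma fcoord_i_fcoord_i: "fcoord_i (fcoord_i u) = - u"
  by (cases u) (simp add: fcoord_i_def mat_scalar_mult vec_eq_iff)

lemma zmodel_i_zmodel_i: "zmodel_i (zmodel_i y) = - y"
  by (cases y) (simp add: zmodel_i_def fcoord_i_fcoord_i vec_eq_iff)

lemma J_Z_hz: "J_Z (hz P w) = hz P (\<i> *s w)"
  by (auto simp: J_Z_def hz_def zmodel_i_simps)

lemma J_Z_J_Z: "J_Z (J_Z \<xi>) = (\<lambda>d. - \<xi> d)"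
  by (simp add: J_Z_def zmodel_i_zmodel_i)

lemma hz_add: "hz P (w + w') = (\<lambda>d. hz P w d + hz P w' d)"
  by (auto simp: hz_def)

lemma hz_scaleR: "hz P (r *\<^sub>R w) = (\<lambda>d. r *\<^sub>R hz P w d)"
  by (auto simp: hz_def)

lemma hz_zero: "hz P 0 = (\<lambda>_. 0)"
  by (auto simp: hz_def zero_prod_def)

lemma Z_chart_exists: "P \<in> Z_space \<Longrightarrow> \<exists>d\<in>Z_atlas. P \<in> fst d"
  using carrier_Z_atlas by (auto simp: carrier_of_def)

lemma hz_tangent: "hz P w \<in> tangent_space Z_atlas P"
  unfolding tangent_space_def by (auto simp: hz_def Z_transition_horizontal)

lemma J_Z_tangent:
  assumes xi: "\<xi> \<in> tangent_space Z_atlas P"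
  shows "J_Z \<xi> \<in> tangent_space Z_atlas P"
  unfolding tangent_space_def
proof (intro CollectI conjI allI ballI impI)
  show "J_Z \<xi> c = 0" if "\<not> (c \<in> Z_atlas \<and> P \<in> fst c)" for c
    using Z.tangent_outside[OF xi that] by (simp add: J_Z_def zmodel_i_simps)
  show "J_Z \<xi> d = frechet_derivative (transition c d) (at (snd c P)) (J_Z \<xi> c)"
    if cd: "c \<in> Z_atlas" "d \<in> Z_atlas" "P \<in> fst c" "P \<in> fst d" for c d
    unfolding J_Z_def Z_transition_i[OF cd] Z.tangent_transition[OF xi cd] ..
qed

lemma tangent_fst_eq:
  assumes "\<xi> \<in> tangent_space Z_atlas P" "c \<in> Z_atlas" "d \<in> Z_atlas" "P \<in> fst c" "P \<in> fst d"
  shows "fst (\<xi> d) = fst (\<xi> c)"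
  using Z.tangent_transition[OF assms] Z_transition_fst[OF assms(2-5)] by simp

definition D_fibre :: "'n::finite zpoint \<Rightarrow> 'n amb set" where
  "D_fibre = (\<lambda>(z, S1, S2, T1, T2). ssum S1 T2)"

lemma D_Z_iff:
  assumes "d \<in> Z_atlas" "P \<in> fst d"
  shows "\<xi> \<in> D_Z P \<longleftrightarrow> \<xi> \<in> tangent_space Z_atlas P \<and> fst (\<xi> d) \<in> D_fibre P"
  using assms tangent_fst_eq[OF _ assms(1) _ assms(2)]
  by (cases P) (auto simp: D_Z_def D_fibre_def)

lemma subspace_D_fibre:
  fixes P :: "'n::finite zpoint"
  assumes "P \<in> Z_space"
  shows "vec.subspace (D_fibre P)" "subspace (D_fibre P)"
proof -
  obtain z S1 S2 T1 T2 where P: "P = (z, S1, S2, T1, T2)" by (cases P)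
  have "vec.subspace S1" "vec.subspace T2" using assms by (auto simp: P Z_space_def grassmannian_def)
  from vec.subspace_sums[OF this] show 1: "vec.subspace (D_fibre P)"
    by (simp add: D_fibre_def P ssum_def)
  then show "subspace (D_fibre P)" by (rule subspace_if_complex)
qed

lemma D_Z_diff:
  assumes "P \<in> Z_space" "\<xi> \<in> D_Z P" "\<eta> \<in> D_Z P"
  shows "(\<lambda>d. \<xi> d - \<eta> d) \<in> D_Z P"
proof -
  obtain d where d: "d \<in> Z_atlas" "P \<in> fst d" using Z_chart_exists[OF assms(1)] by blast
  show ?thesis
    using assms(2,3) subspace_diff[OF subspace_D_fibre(2)[OF assms(1)]]
    unfolding D_Z_iff[OF d] by (auto intro: Z.tangent_diff)
qed

lemma quot_class_eq_zero:
  assumes "P \<in> Z_space" "\<xi> \<in> D_Z P"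
  shows "quot_class Z_atlas D_Z P \<xi> = quot_class Z_atlas D_Z P (\<lambda>_. 0)"
proof -
  have "(\<lambda>d. \<zeta> d - \<xi> d) \<in> D_Z P \<longleftrightarrow> (\<lambda>d. \<zeta> d - 0) \<in> D_Z P" for \<zeta>
  proof
    have 0: "(\<lambda>d. \<xi> d - \<xi> d) \<in> D_Z P" using D_Z_diff[OF assms(1) assms(2) assms(2)] .
    assume "(\<lambda>d. \<zeta> d - \<xi> d) \<in> D_Z P"
    from D_Z_diff[OF assms(1) this D_Z_diff[OF assms(1) 0 assms(2)]] show "(\<lambda>d. \<zeta> d - 0) \<in> D_Z P"
      by (simp add: algebra_simps)
  qed (use D_Z_diff[OF assms(1) _ assms(2)] in auto)
  then show ?thesis by (simp add: quot_class_def)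
qed

section \<open>Torsion of horizontal vectors\<close>

lemma zshift_mem_iff: "d \<in> Z_atlas \<Longrightarrow> zshift t P \<in> fst d \<longleftrightarrow> P \<in> fst d"
  using zshift_zchart(1)[of d P t] zshift_zchart(1)[of d "zshift t P" "- t"]
  by (auto simp: zshift_def split: prod.splits)

lemma continuous_map_chart_topology:
  assumes "\<And>c O'. c \<in> A \<Longrightarrow> open O' \<Longrightarrow> openin T {x \<in> topspace T. f x \<in> fst c \<and> snd c (f x) \<in> O'}"
    and "\<And>x. x \<in> topspace T \<Longrightarrow> f x \<in> carrier_of A"
  shows "continuous_map T (chart_topology A) f"
  unfolding chart_topology_def
proof (rule continuous_on_generated_topo)
  fix U assume "U \<in> {fst c \<inter> snd c -` O' |c O'. c \<in> A \<and> open O'}"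
  then obtain c O' where U: "U = fst c \<inter> snd c -` O'" "c \<in> A" "open O'" by blast
  have "f -` U \<inter> topspace T = {x \<in> topspace T. f x \<in> fst c \<and> snd c (f x) \<in> O'}" unfolding U(1) by blast
  then show "openin T (f -` U \<inter> topspace T)" using assms(1)[OF U(2,3)] by simp
next
  show "f ` topspace T \<subseteq> \<Union> {fst c \<inter> snd c -` O' |c O'. c \<in> A \<and> open O'}"
  proof (rule image_subsetI)
    fix x assume "x \<in> topspace T"
    from assms(2)[OF this] obtain c where c: "c \<in> A" "f x \<in> fst c" unfolding carrier_of_def by (rule UN_E)
    have "fst c \<inter> snd c -` UNIV \<in> {fst c \<inter> snd c -` O' |c O'. c \<in> A \<and> open O'}"
      using c(1) open_UNIV by blast
    then show "f x \<in> \<Union> {fst c \<inter> snd c -` O' |c O'. c \<in> A \<and> open O'}"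
      by (rule UnionI) (simp add: c(2))
  qed
qed

lemma zshift_eventually:
  fixes P :: "'n::finite zpoint"
  assumes "openin (chart_topology Z_atlas) W" "P \<in> W" "P \<in> Z_space"
  shows "\<forall>\<^sub>F r in at 0. zshift (r *\<^sub>R w) P \<in> W"
proof -
  have "continuous_map euclidean (chart_topology Z_atlas) (\<lambda>r::real. zshift (r *\<^sub>R w) P)"
  proof (rule continuous_map_chart_topology)
    fix c :: "('n zpoint, 'n zmodel) chart" and O' :: "'n zmodel set"
    assume c: "c \<in> Z_atlas" and O': "open O'"
    show "openin euclidean {r \<in> topspace euclidean. zshift (r *\<^sub>R w) P \<in> fst c \<and> snd c (zshift (r *\<^sub>R w) P) \<in> O'}"
    proof (cases "P \<in> fst c")
      case True
      have "open ((\<lambda>r::real. snd c P + (r *\<^sub>R w, 0)) -` O')"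
        using O' by (intro open_vimage continuous_intros)
      then show ?thesis by (simp add: zshift_mem_iff[OF c] zshift_zchart(2)[OF c True] True vimage_def)
    qed (simp add: zshift_mem_iff[OF c])
  next
    obtain d where d: "d \<in> Z_atlas" "P \<in> fst d" using Z_chart_exists[OF assms(3)] by blast
    then show "zshift (r *\<^sub>R w) P \<in> carrier_of Z_atlas" for r
      unfolding carrier_of_def using zshift_mem_iff by blast
  qed
  from openin_continuous_map_preimage[OF this assms(1)]
  have "open {r. zshift (r *\<^sub>R w) P \<in> W}" by simp
  moreover have "zshift ((0::real) *\<^sub>R w) P \<in> W" using assms(2) by (simp add: zshift_def split: prod.splits)
  ultimately show ?thesis
    unfolding eventually_at_filter eventually_nhds by blast
qed

lemma vector_derivative_in_subspace:
  fixes h :: "real \<Rightarrow> 'v::euclidean_space"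
  assumes "(h has_vector_derivative D) (at 0)" "subspace V" "\<forall>\<^sub>F r in at 0. h r \<in> V" "h 0 \<in> V"
  shows "D \<in> V"
proof (rule Lim_in_closed_set[OF closed_subspace[OF assms(2)]])
  show "((\<lambda>r. (h (0 + r) - h 0) /\<^sub>R r) \<longlongrightarrow> D) (at 0)"
  proof (rule Lim_null[THEN iffD2], rule tendsto_norm_zero_cancel, rule Lim_transform_eventually)
    show "((\<lambda>r. norm (h (0 + r) - h 0 - r *\<^sub>R D) / norm r) \<longlongrightarrow> 0) (at 0)"
      using assms(1) unfolding has_vector_derivative_def has_derivative_at by blast
    have "norm (h (0 + r) - h 0 - r *\<^sub>R D) / norm r = norm ((h (0 + r) - h 0) /\<^sub>R r - D)" if "r \<noteq> 0" for r
    proof -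
      have "(h (0 + r) - h 0) /\<^sub>R r - D = (h (0 + r) - h 0 - r *\<^sub>R D) /\<^sub>R r"
        using that by (simp add: scaleR_diff_right)
      then show ?thesis by (simp add: divide_inverse_commute)
    qed
    then show "\<forall>\<^sub>F r in at 0. norm (h (0 + r) - h 0 - r *\<^sub>R D) / norm r = norm ((h (0 + r) - h 0) /\<^sub>R r - D)"
      unfolding eventually_at_filter by simp
  qed
  show "\<forall>\<^sub>F r in at 0. (h (0 + r) - h 0) /\<^sub>R r \<in> V"
    using assms(3) by eventually_elim (use assms in \<open>auto intro!: subspace_scale subspace_diff\<close>)
qed simp

text \<open>Both \<open>D\<close> and the transition maps are invariant under translations of the base point, so the
  derivative of a section of \<open>D\<close> in a horizontal direction is again in \<open>D\<close>.\<close>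

definition hderiv :: "('n::finite zpoint, 'n zmodel) vfield \<Rightarrow> 'n amb \<Rightarrow> ('n zpoint, 'n zmodel) vfield" where
  "hderiv \<eta> w P = (\<lambda>c. if c \<in> Z_atlas \<and> P \<in> fst c
     then frechet_derivative (in_chart c \<eta>) (at (snd c P)) (w, 0) else 0)"

lemma hderiv_in_D:
  assumes sec: "local_section Z_atlas D_Z W \<eta>" and P: "P \<in> W" "P \<in> Z_space"
  shows "hderiv \<eta> w P \<in> D_Z P"
proof -
  define h where "h c r = \<eta> (zshift (r *\<^sub>R w) P) c" for c and r :: real
  have W: "\<forall>\<^sub>F r in at 0. zshift (r *\<^sub>R w) P \<in> W"
    using sec P zshift_eventually unfolding local_section_def by blast
  have z0: "zshift ((0::real) *\<^sub>R w) P = P" by (simp add: zshift_def split: prod.splits)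
  have inD: "\<eta> Q \<in> D_Z Q" if "Q \<in> W" for Q using sec that by (simp add: local_section_def)
  have tan: "\<eta> Q \<in> tangent_space Z_atlas Q" if "Q \<in> W" for Q
    using inD[OF that] by (auto simp: D_Z_def split: prod.splits)
  have deriv: "(h c has_vector_derivative hderiv \<eta> w P c) (at 0)" if c: "c \<in> Z_atlas" "P \<in> fst c" for c
  proof -
    have "smooth_on (snd c ` (W \<inter> fst c)) (in_chart c \<eta>)" using sec c by (simp add: local_section_def)
    then have "in_chart c \<eta> differentiable (at (snd c P))"
      by (rule smooth_on_differentiable) (use P c in auto)
    then have "(in_chart c \<eta> has_derivative frechet_derivative (in_chart c \<eta>) (at (snd c P))) (at (snd c P))"
      by (simp add: frechet_derivative_works)
    then have D: "(in_chart c \<eta> \<circ> (\<lambda>r. snd c P + r *\<^sub>R (w, 0)) has_derivative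
        frechet_derivative (in_chart c \<eta>) (at (snd c P)) \<circ> (\<lambda>r. r *\<^sub>R (w, 0))) (at 0)"
      by (intro diff_chain_at) (auto intro!: derivative_eq_intros simp: zero_prod_def[symmetric])
    have "in_chart c \<eta> \<circ> (\<lambda>r. snd c P + r *\<^sub>R (w, 0)) = h c"
    proof
      fix r :: real
      have "snd c P + r *\<^sub>R (w, 0) = snd c (zshift (r *\<^sub>R w) P)" using zshift_zchart(2)[OF c] by simp
      then show "(in_chart c \<eta> \<circ> (\<lambda>r. snd c P + r *\<^sub>R (w, 0))) r = h c r"
        by (simp add: in_chart_def h_def Z.chart_inv_chart[OF c(1) zshift_zchart(1)[OF c]])
    qed
    moreover have "linear (frechet_derivative (in_chart c \<eta>) (at (snd c P)))"
      using \<open>in_chart c \<eta> differentiable _\<close> linear_frechet_derivative by blast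
    ultimately show ?thesis
      using D c by (simp add: has_vector_derivative_def o_def linear_cmul hderiv_def del: scaleR_Pair)
  qed
  obtain c where c: "c \<in> Z_atlas" "P \<in> fst c" using Z_chart_exists[OF P(2)] by blast
  have "hderiv \<eta> w P \<in> tangent_space Z_atlas P"
  proof (rule Z.tangent_spaceI[OF c])
    fix d assume d: "d \<in> Z_atlas" "P \<in> fst d"
    let ?D = "frechet_derivative (transition c d) (at (snd c P))"
    have ev: "\<forall>\<^sub>F r in at 0. ?D (h c r) = h d r"
      using W
    proof eventually_elim
      case (elim r)
      show ?case
        using Z.tangent_transition[OF tan[OF elim] c(1) d(1)] c d
        by (simp add: zshift_mem_iff h_def Z_transition_derivative_shift)
    qed
    have "bounded_linear ?D" using Z.transition_has_derivative[OF c(1) d(1) c(2) d(2)] has_derivative_bounded_linear by blast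
    from bounded_linear.has_vector_derivative[OF this deriv[OF c]]
    have "((\<lambda>r. ?D (h c r)) has_vector_derivative ?D (hderiv \<eta> w P c)) (at 0)" .
    then have "(h d has_vector_derivative ?D (hderiv \<eta> w P c)) (at 0)"
      unfolding has_vector_derivative_def
      by (rule has_derivative_transform_eventually[OF _ ev])
        (use Z.tangent_transition[OF tan[OF P(1)] c(1) d(1) c(2) d(2)] z0 in \<open>simp_all add: h_def\<close>)
    then show "hderiv \<eta> w P d = ?D (hderiv \<eta> w P c)"
      using deriv[OF d] vector_derivative_unique_at by blast
  qed (auto simp: hderiv_def)
  moreover have "fst (hderiv \<eta> w P c) \<in> D_fibre P"
  proof (rule vector_derivative_in_subspace[OF _ subspace_D_fibre(2)[OF P(2)]])
    show "((\<lambda>r. fst (h c r)) has_vector_derivative fst (hderiv \<eta> w P c)) (at 0)"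
      by (rule bounded_linear.has_vector_derivative[OF bounded_linear_fst deriv[OF c]])
    have fib: "D_fibre (zshift t P) = D_fibre P" for t
      by (cases P) (simp add: D_fibre_def zshift_def)
    show "\<forall>\<^sub>F r in at 0. fst (h c r) \<in> D_fibre P"
      using W
    proof eventually_elim
      case (elim r)
      show ?case
        using inD[OF elim] D_Z_iff[OF c(1) zshift_zchart(1)[OF c]] by (simp add: h_def fib)
    qed
    show "fst (h c 0) \<in> D_fibre P" using inD[OF P(1)] D_Z_iff[OF c] z0 by (simp add: h_def)
  qed
  ultimately show ?thesis using D_Z_iff[OF c] by blast
qed

lemma rat_linear_vrat:
  assumes "vrat I I2 S F" "bounded_linear g" "\<And>e. g (I2 e) = \<i> * g e"
  shows "rat I S (\<lambda>y. g (F y))"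
  using assms(1)
proof induction
  case vrat_0
  show ?case by (simp add: linear_0 bounded_linear.linear[OF assms(2)] rat_const)
next
  case (vrat_cons f T F)
  have "g (T c) = c * g (T 1)" for c
  proof -
    have "c = Re c *\<^sub>R 1 + Im c *\<^sub>R (\<i> * 1)" by (simp add: complex_eq_iff)
    then have "g (T c) = g (T (Re c *\<^sub>R 1 + Im c *\<^sub>R (\<i> * 1)))" by simp
    also have "\<dots> = (Re c *\<^sub>R 1 + Im c *\<^sub>R (\<i> * 1)) * g (T 1)"
      using bounded_linear.linear[OF assms(2)] bounded_linear.linear[OF vrat_cons.hyps(2)]
      by (simp only: linear_add linear_cmul vrat_cons.hyps(3) assms(3)) (simp add: algebra_simps)
    finally show ?thesis by (simp add: complex_eq_iff)
  qed
  then have "(\<lambda>y. g (T (f y) + F y)) = (\<lambda>y. f y * g (T 1) + g (F y))"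
    using bounded_linear.linear[OF assms(2)] by (metis linear_add)
  with vrat_cons show ?case by (auto intro!: rat_add rat_mult rat_const)
qed

lemma rat_compose:
  assumes "rat I2 T h" "vrat I I2 S F" "F ` S \<subseteq> T"
  shows "rat I S (\<lambda>y. h (F y))"
  using assms(1)
proof induction
  case (rat_lin g)
  then show ?case using rat_linear_vrat[OF assms(2)] by blast
next
  case (rat_inverse f)
  then show ?case using assms(3) by (intro rat.rat_inverse) auto
next
  case (rat_add f g)
  show ?case by (rule rat.rat_add) fact+
next
  case (rat_mult f g)
  show ?case by (rule rat.rat_mult) fact+
qed (rule rat_const)

lemma local_section_extension:
  fixes P :: "'n::finite zpoint"
  assumes P: "P \<in> Z_space" and w: "w \<in> snd (snd (snd (snd P)))"
    and c: "c \<in> Z_atlas" "P \<in> fst c"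
  obtains \<eta> where "local_section Z_atlas D_Z (fst c) \<eta>" "\<eta> P = hz P w"
proof -
  obtain f g where f: "is_frame f" and g: "is_frame g" and cc: "c = zchart f g" using c(1) by (rule Z_atlasE)
  have Pc: "Q = Z_param f g (snd c Q)" if "Q \<in> fst c" for Q
    using that unfolding cc mem_fst_zchart[OF f g] using snd_zchart[OF f g] by auto
  have T: "snd (snd (snd (snd Q))) = flag_sup g (snd (snd (snd c Q)))" if "Q \<in> fst c" for Q
    using arg_cong[OF Pc[OF that], of "\<lambda>Q. snd (snd (snd (snd Q)))"]
    by (simp add: Z_param_def split: prod.splits)
  obtain s q where sq: "w = col1 g (snd (snd (snd c P))) *v s + col2 g (snd (snd (snd c P))) *v q"
    using w T[OF c(2)] unfolding flag_sup_col ssum_def by blast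
  define G where "G y = col1 g (snd (snd y)) *v s + col2 g (snd (snd y)) *v q" for y :: "'n zmodel"
  define \<eta> where "\<eta> Q = hz Q (G (snd c Q))" for Q
  have "local_section Z_atlas D_Z (fst c) \<eta>"
    unfolding local_section_def
  proof (intro conjI ballI)
    have "fst c \<inter> snd c -` UNIV \<in> {fst c \<inter> snd c -` O' |c O'. c \<in> Z_atlas \<and> open O'}"
      using c(1) open_UNIV by blast
    then show "openin (chart_topology Z_atlas) (fst c)"
      unfolding chart_topology_def by (intro topology_generated_by_Basis) simp
    fix Q assume Q: "Q \<in> fst c"
    have QZ: "Q \<in> Z_space" using Q carrier_Z_atlas c(1) by (auto simp: carrier_of_def)
    have "G (snd c Q) \<in> snd (snd (snd (snd Q)))"
      unfolding T[OF Q] G_def flag_sup_col ssum_def by blast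
    moreover have "snd (snd (snd (snd Q))) \<subseteq> D_fibre Q"
    proof -
      have "0 \<in> fst (snd Q)" using QZ by (auto simp: Z_space_def grassmannian_def intro: vec.subspace_0)
      then show ?thesis by (cases Q) (force simp: D_fibre_def ssum_def)
    qed
    ultimately show "\<eta> Q \<in> D_Z Q"
      unfolding D_Z_iff[OF c(1) Q] using c(1) Q by (auto simp: \<eta>_def hz_tangent) (simp add: hz_def subset_iff)
  next
    fix d :: "('n zpoint, 'n zmodel) chart" assume d: "d \<in> Z_atlas"
    let ?O = "snd d ` (fst d \<inter> fst c)"
    obtain F where F: "vrat zmodel_i zmodel_i ?O F" "\<forall>y\<in>?O. transition d c y = F y"
      using Z_transition_rational(2)[OF d c(1)] by blast
    have "rat zmodel_i UNIV (\<lambda>y :: 'n zmodel. col1 g (snd (snd y)) $ i $ j)"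
      "rat zmodel_i UNIV (\<lambda>y :: 'n zmodel. col2 g (snd (snd y)) $ i $ k)" for i j k
      using mrat_col(3,4)[of UNIV g] unfolding mrat_def by blast+
    then have "rat zmodel_i UNIV (\<lambda>y. G y $ i)" for i
      unfolding G_def matrix_vector_mult_def vector_add_component vec_lambda_beta
      by (intro rat_add rat_sum rat_mult rat_const)
    then have "rat zmodel_i ?O (\<lambda>y. G (F y) $ i)" for i
      using rat_compose[OF _ F(1), of UNIV "\<lambda>y. G y $ i"] by simp
    from vrat_zmodel[OF this mrat_const mrat_const mrat_const mrat_const mrat_const mrat_const, of 0 0 0 0 0 0]
    have v: "vrat zmodel_i zmodel_i ?O (\<lambda>y. (G (F y), 0) :: 'n zmodel)" by (simp add: zero_prod_def)
    have "smooth_on ?O (\<lambda>y. (G (F y), 0) :: 'n zmodel)"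
      by (rule vrat_smooth_on[OF v linear_zmodel_i Z.open_overlap[OF d c(1)]])
    moreover have "in_chart d \<eta> y = (G (F y), 0)" if y: "y \<in> ?O" for y
    proof -
      obtain Q where Q: "Q \<in> fst d" "Q \<in> fst c" "y = snd d Q" using y by blast
      have "in_chart d \<eta> y = (G (snd c Q), 0)"
        using Q d by (simp add: in_chart_def Z.chart_inv_chart \<eta>_def hz_def)
      also have "snd c Q = F y" using bspec[OF F(2) y] Z.transition_chart[OF d Q(1), of c] Q(3) by simp
      finally show ?thesis .
    qed
    ultimately show "smooth_on (snd d ` (fst c \<inter> fst d)) (in_chart d \<eta>)"
      unfolding smooth_on_def using Ck_on_cong[OF Z.open_overlap[OF d c(1)]] by (metis (no_types, lifting) Int_commute)
  qed
  moreover have "\<eta> P = hz P w" by (simp add: \<eta>_def G_def sq)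
  ultimately show ?thesis by (rule that)
qed

lemma torsion_horizontal:
  fixes P :: "'n::finite zpoint"
  assumes P: "P \<in> Z_space" and w: "w1 \<in> snd (snd (snd (snd P)))" "w2 \<in> snd (snd (snd (snd P)))"
  shows "torsion Z_atlas D_Z P (hz P w1) (hz P w2) = quot_class Z_atlas D_Z P (\<lambda>_. 0)"
  unfolding torsion_def
proof (rule the_equality)
  have bracket: "quot_class Z_atlas D_Z P (lie_bracket Z_atlas \<xi> \<eta> P) = quot_class Z_atlas D_Z P (\<lambda>_. 0)"
    if s: "P \<in> W" "local_section Z_atlas D_Z W \<xi>" "local_section Z_atlas D_Z W \<eta>"
      "\<xi> P = hz P w1" "\<eta> P = hz P w2" for W \<xi> \<eta>
  proof -
    have "lie_bracket Z_atlas \<xi> \<eta> P = (\<lambda>c. hderiv \<eta> w1 P c - hderiv \<xi> w2 P c)"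
      by (auto simp: fun_eq_iff lie_bracket_def hderiv_def s(4,5) hz_def)
    then have "lie_bracket Z_atlas \<xi> \<eta> P \<in> D_Z P"
      using D_Z_diff[OF P hderiv_in_D[OF s(3,1) P] hderiv_in_D[OF s(2,1) P]] by simp
    then show ?thesis by (rule quot_class_eq_zero[OF P])
  qed
  let ?Q = "\<lambda>q. \<exists>W \<xi>' \<eta>'. P \<in> W \<and>
     local_section Z_atlas D_Z W \<xi>' \<and> local_section Z_atlas D_Z W \<eta>' \<and> \<xi>' P = hz P w1 \<and> \<eta>' P = hz P w2 \<and>
     q = quot_class Z_atlas D_Z P (lie_bracket Z_atlas \<xi>' \<eta>' P)"
  show "q = quot_class Z_atlas D_Z P (\<lambda>_. 0)" if "?Q q" for q
    using that bracket by blast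
  obtain c where c: "c \<in> Z_atlas" "P \<in> fst c" using Z_chart_exists[OF P] by blast
  obtain \<xi> where xi: "local_section Z_atlas D_Z (fst c) \<xi>" "\<xi> P = hz P w1"
    using local_section_extension[OF P w(1) c] .
  obtain \<eta> where eta: "local_section Z_atlas D_Z (fst c) \<eta>" "\<eta> P = hz P w2"
    using local_section_extension[OF P w(2) c] .
  show "?Q (quot_class Z_atlas D_Z P (\<lambda>_. 0))"
    using bracket[OF c(2) xi(1) eta(1) xi(2) eta(2)] xi eta c(2) by metis
qed

section \<open>Jets with horizontal values\<close>

lemma subspace_D_Z:
  assumes "P \<in> Z_space"
  shows "(\<lambda>_. 0) \<in> D_Z P"
    and "\<xi> \<in> D_Z P \<Longrightarrow> \<eta> \<in> D_Z P \<Longrightarrow> (\<lambda>d. \<xi> d + \<eta> d) \<in> D_Z P"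
    and "\<xi> \<in> D_Z P \<Longrightarrow> (\<lambda>d. - \<xi> d) \<in> D_Z P"
    and "\<xi> \<in> D_Z P \<Longrightarrow> J_Z \<xi> \<in> D_Z P"
proof -
  obtain d where d: "d \<in> Z_atlas" "P \<in> fst d" using Z_chart_exists[OF assms] by blast
  note D = D_Z_iff[OF d] and V = subspace_D_fibre[OF assms]
  show "(\<lambda>_. 0) \<in> D_Z P" unfolding D using Z.tangent_zero subspace_0[OF V(2)] by simp
  show "(\<lambda>d. \<xi> d + \<eta> d) \<in> D_Z P" if "\<xi> \<in> D_Z P" "\<eta> \<in> D_Z P"
    using that subspace_add[OF V(2)] unfolding D by (auto intro: Z.tangent_add)
  show "(\<lambda>d. - \<xi> d) \<in> D_Z P" if "\<xi> \<in> D_Z P"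
    using that subspace_neg[OF V(2)] unfolding D by (auto intro: Z.tangent_minus)
  show "J_Z \<xi> \<in> D_Z P" if "\<xi> \<in> D_Z P"
  proof -
    have "fst (J_Z \<xi> d) = \<i> *s fst (\<xi> d)" by (simp add: J_Z_def zmodel_i_def split: prod.splits)
    then show ?thesis
      using that vec.subspace_scale[OF V(1)] unfolding D by (auto intro: J_Z_tangent)
  qed
qed

lemma quot_class_eq_iff:
  assumes "P \<in> Z_space" "\<xi> \<in> tangent_space Z_atlas P"
  shows "quot_class Z_atlas D_Z P \<xi> = quot_class Z_atlas D_Z P \<eta> \<longleftrightarrow> (\<lambda>d. \<xi> d - \<eta> d) \<in> D_Z P"
proof
  assume "quot_class Z_atlas D_Z P \<xi> = quot_class Z_atlas D_Z P \<eta>"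
  moreover have "\<xi> \<in> quot_class Z_atlas D_Z P \<xi>"
    using assms(2) subspace_D_Z(1)[OF assms(1)] by (simp add: quot_class_def)
  ultimately show "(\<lambda>d. \<xi> d - \<eta> d) \<in> D_Z P" by (simp add: quot_class_def)
next
  assume D: "(\<lambda>d. \<xi> d - \<eta> d) \<in> D_Z P"
  have "(\<lambda>d. \<zeta> d - \<xi> d) \<in> D_Z P \<longleftrightarrow> (\<lambda>d. \<zeta> d - \<eta> d) \<in> D_Z P" for \<zeta>
    using subspace_D_Z(2)[OF assms(1) _ D, of "\<lambda>d. \<zeta> d - \<xi> d"] D_Z_diff[OF assms(1) _ D, of "\<lambda>d. \<zeta> d - \<eta> d"]
    by auto
  then show "quot_class Z_atlas D_Z P \<xi> = quot_class Z_atlas D_Z P \<eta>" by (simp add: quot_class_def)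
qed

lemma J_quot_quot_class:
  assumes "P \<in> Z_space"
  shows "J_quot (quot_class Z_atlas D_Z P \<xi>) = quot_class Z_atlas D_Z P (J_Z \<xi>)"
proof -
  have "J_Z \<zeta> \<in> quot_class Z_atlas D_Z P (J_Z \<xi>)" if "\<zeta> \<in> quot_class Z_atlas D_Z P \<xi>" for \<zeta> \<xi>
  proof -
    have "J_Z (\<lambda>d. \<zeta> d - \<xi> d) = (\<lambda>d. J_Z \<zeta> d - J_Z \<xi> d)"
      by (simp add: J_Z_def linear_diff[OF linear_zmodel_i])
    then show ?thesis using that subspace_D_Z(4)[OF assms, of "\<lambda>d. \<zeta> d - \<xi> d"]
      by (simp add: quot_class_def J_Z_tangent)
  qed
  note * = this
  show ?thesis
  proof (intro subset_antisym subsetI)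
    fix \<zeta> assume z: "\<zeta> \<in> quot_class Z_atlas D_Z P (J_Z \<xi>)"
    define \<zeta>' where "\<zeta>' = (\<lambda>d. - J_Z \<zeta> d)"
    have "(\<lambda>d. J_Z \<zeta> d - (- \<xi> d)) \<in> D_Z P" "J_Z \<zeta> \<in> tangent_space Z_atlas P"
      using *[OF z] by (simp_all add: quot_class_def J_Z_J_Z)
    from subspace_D_Z(3)[OF assms this(1)] Z.tangent_minus[OF this(2)]
    have "\<zeta>' \<in> quot_class Z_atlas D_Z P \<xi>" by (simp add: quot_class_def \<zeta>'_def)
    moreover have "\<zeta> = J_Z \<zeta>'"
      by (simp add: \<zeta>'_def J_Z_def linear_neg[OF linear_zmodel_i] zmodel_i_zmodel_i)
    ultimately show "\<zeta> \<in> J_quot (quot_class Z_atlas D_Z P \<xi>)" unfolding J_quot_def by blast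
  qed (use * in \<open>auto simp: J_quot_def\<close>)
qed

locale horizontal_jet = X: diff_atlas A
  for A :: "('a, 'e::euclidean_space) chart set" +
  fixes x :: 'a and J :: "('a, 'e) tvec \<Rightarrow> ('a, 'e) tvec" and P :: "'n::finite zpoint"
    and l al :: "('a, 'e) tvec \<Rightarrow> 'n amb"
  assumes x: "x \<in> carrier_of A" and dim: "DIM('e) = 2 * CARD('n)" and P: "P \<in> Z_space"
    and J: "\<And>v. v \<in> tangent_space A x \<Longrightarrow> J v \<in> tangent_space A x"
      "\<And>v. v \<in> tangent_space A x \<Longrightarrow> J (J v) = (\<lambda>c. - v c)"
    and l_lin: "\<And>v w. v \<in> tangent_space A x \<Longrightarrow> w \<in> tangent_space A x \<Longrightarrow> l (\<lambda>c. v c + w c) = l v + l w"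
      "\<And>r v. v \<in> tangent_space A x \<Longrightarrow> l (\<lambda>c. r *\<^sub>R v c) = r *\<^sub>R l v"
    and l_J: "\<And>v. v \<in> tangent_space A x \<Longrightarrow> l (J v) = \<i> *s l v"
    and al_lin: "\<And>v w. v \<in> tangent_space A x \<Longrightarrow> w \<in> tangent_space A x \<Longrightarrow> al (\<lambda>c. v c + w c) = al v + al w"
      "\<And>r v. v \<in> tangent_space A x \<Longrightarrow> al (\<lambda>c. r *\<^sub>R v c) = r *\<^sub>R al v"
    and al_J: "\<And>v. v \<in> tangent_space A x \<Longrightarrow> al (J v) = - (\<i> *s al v)"
    and al_inj: "\<And>v. v \<in> tangent_space A x \<Longrightarrow> al v = 0 \<Longrightarrow> v = (\<lambda>_. 0)"
    and al_fibre: "\<And>v. v \<in> tangent_space A x \<Longrightarrow> al v \<in> snd (snd (snd (snd P)))"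
    and l_inj: "\<And>v. v \<in> tangent_space A x \<Longrightarrow> l v \<in> D_fibre P \<Longrightarrow> v = (\<lambda>_. 0)"
    and l_surj: "\<And>w. \<exists>v\<in>tangent_space A x. w - l v \<in> D_fibre P"
begin

definition L where "L = restrict (\<lambda>v. hz P (l v + al v)) (tangent_space A x)"

lemma L_eq: "v \<in> tangent_space A x \<Longrightarrow> L v = hz P (l v + al v)" by (simp add: L_def)

lemma fibre_D: "w \<in> snd (snd (snd (snd P))) \<Longrightarrow> w \<in> D_fibre P"
proof -
  assume "w \<in> snd (snd (snd (snd P)))"
  moreover have "0 \<in> fst (snd P)" using P by (auto simp: Z_space_def grassmannian_def intro: vec.subspace_0)
  ultimately show ?thesis by (cases P) (force simp: D_fibre_def ssum_def)
qed

lemma al_D: "v \<in> tangent_space A x \<Longrightarrow> al v \<in> D_fibre P"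
  by (intro fibre_D al_fibre)

lemma l_diff: "v \<in> tangent_space A x \<Longrightarrow> w \<in> tangent_space A x \<Longrightarrow> l (\<lambda>c. v c - w c) = l v - l w"
  using l_lin(1)[of v "\<lambda>c. - 1 *\<^sub>R w c"] l_lin(2)[of w "- 1"] X.tangent_scaleR[of w x "-1"] by simp

lemma hz_D_iff: "hz P w \<in> D_Z P \<longleftrightarrow> w \<in> D_fibre P"
proof -
  obtain d where d: "d \<in> Z_atlas" "P \<in> fst d" using Z_chart_exists[OF P] by blast
  show ?thesis unfolding D_Z_iff[OF d] using d by (simp add: hz_tangent) (simp add: hz_def)
qed

lemma hz_diff: "hz P (w - w') = (\<lambda>d. hz P w d - hz P w' d)"
  by (auto simp: hz_def)

lemma hz_inj: "hz P w = hz P w' \<Longrightarrow> w = w'"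
proof -
  obtain d where d: "d \<in> Z_atlas" "P \<in> fst d" using Z_chart_exists[OF P] by blast
  assume "hz P w = hz P w'"
  from fun_cong[OF this, of d] show ?thesis using d by (simp add: hz_def)
qed

lemma eq_if_mod_D:
  assumes "v \<in> tangent_space A x" "w \<in> tangent_space A x" "l v - l w \<in> D_fibre P"
  shows "v = w"
proof -
  have "(\<lambda>c. v c - w c) = (\<lambda>_. 0)"
    using assms by (intro l_inj X.tangent_diff) (simp_all add: l_diff)
  then show ?thesis by (simp add: fun_eq_iff)
qed

lemma L_hom: "L \<in> tangent_hom A x Z_atlas P"
proof -
  have "L (\<lambda>c. v c + w c) = (\<lambda>d. L v d + L w d)" if "v \<in> tangent_space A x" "w \<in> tangent_space A x" for v w
    using that by (simp add: L_eq X.tangent_add l_lin al_lin hz_add[symmetric] algebra_simps)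
  moreover have "L (\<lambda>c. r *\<^sub>R v c) = (\<lambda>d. r *\<^sub>R L v d)" if "v \<in> tangent_space A x" for r v
    using that by (simp add: L_eq X.tangent_scaleR l_lin al_lin hz_scaleR[symmetric] scaleR_add_right)
  ultimately show ?thesis unfolding tangent_hom_def by (auto simp: L_def hz_tangent)
qed

lemma L_bar_eq_iff:
  assumes "v \<in> tangent_space A x" "w \<in> tangent_space A x"
  shows "L_bar P L v = L_bar P L w \<longleftrightarrow> v = w"
proof
  assume "L_bar P L v = L_bar P L w"
  then have "(l v + al v) - (l w + al w) \<in> D_fibre P"
    using assms unfolding L_bar_def L_eq[OF assms(1)] L_eq[OF assms(2)] quot_class_eq_iff[OF P hz_tangent]
    by (simp add: hz_diff[symmetric] hz_D_iff)
  moreover have "al v - al w \<in> D_fibre P"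
    using al_D assms subspace_diff[OF subspace_D_fibre(2)[OF P]] by blast
  ultimately have "(l v + al v) - (l w + al w) - (al v - al w) \<in> D_fibre P"
    by (rule subspace_diff[OF subspace_D_fibre(2)[OF P]])
  then show "v = w" by (intro eq_if_mod_D assms) simp
qed simp

lemma L_bar_J: "v \<in> tangent_space A x \<Longrightarrow> L_bar P L (J v) = J_quot (L_bar P L v)"
proof -
  assume v: "v \<in> tangent_space A x"
  have "(l (J v) + al (J v)) - \<i> *s (l v + al v) = (- 2 * \<i>) *s al v"
    using v by (simp add: l_J al_J vec.scale_right_distrib vec_eq_iff)
  then have "(l (J v) + al (J v)) - \<i> *s (l v + al v) \<in> D_fibre P"
    using vec.subspace_scale[OF subspace_D_fibre(1)[OF P] al_D[OF v], of "- 2 * \<i>"] by simp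
  then show ?thesis
    unfolding L_bar_def J_quot_quot_class[OF P] L_eq[OF v] L_eq[OF J(1)[OF v]] J_Z_hz
    unfolding quot_class_eq_iff[OF P hz_tangent] by (simp add: hz_diff[symmetric] hz_D_iff)
qed

lemma J_L_eq: "v \<in> tangent_space A x \<Longrightarrow> J_L A x P L v = J v"
  unfolding J_L_def by (rule the_inv_into_f_eq) (auto simp: inj_on_def L_bar_eq_iff L_bar_J J)

lemma dbar_eq:
  assumes v: "v \<in> tangent_space A x"
  shows "dbar A x P L v = hz P (al v)"
proof -
  have "(1 / 2) *\<^sub>R ((l v + al v) + \<i> *s (l (J v) + al (J v))) = al v"
    using v by (simp add: l_J al_J vec.scale_right_distrib vec_eq_iff)
  from arg_cong[OF this, of "hz P"] show ?thesis
    unfolding hz_scaleR hz_add[of P "l v + al v"]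
    by (simp add: dbar_def J_L_eq[OF v] L_eq[OF v] L_eq[OF J(1)[OF v]] J_Z_hz)
qed

lemma dbar_gr_D: "(P, dbar A x P L ` tangent_space A x) \<in> gr_D"
proof -
  define S where "S = dbar A x P L ` tangent_space A x"
  have S: "S = (\<lambda>v. hz P (al v)) ` tangent_space A x" by (simp add: S_def dbar_eq)
  have "S \<subseteq> D_Z P" by (auto simp: S hz_D_iff al_D)
  moreover have "J_Z \<xi> \<in> S" if xi: "\<xi> \<in> S" for \<xi>
  proof -
    obtain v where v: "v \<in> tangent_space A x" "\<xi> = hz P (al v)" using xi S by blast
    have "al (\<lambda>c. - 1 *\<^sub>R J v c) = \<i> *s al v" using v J by (simp only: al_lin al_J) (simp add: vec_eq_iff)
    moreover have "(\<lambda>c. - 1 *\<^sub>R J v c) \<in> tangent_space A x" by (rule X.tangent_scaleR[OF J(1)[OF v(1)]])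
    ultimately show ?thesis unfolding S v(2) J_Z_hz by (intro image_eqI) simp_all
  qed
  moreover have "subspace ((\<lambda>\<xi>. \<xi> d) ` S) \<and> dim ((\<lambda>\<xi>. \<xi> d) ` S) = 2 * CARD('n)"
    if d: "d \<in> Z_atlas" "P \<in> fst d" for d
  proof -
    obtain c where c: "c \<in> A" "x \<in> fst c" using x by (auto simp: carrier_of_def)
    define F where "F e = (al (tvec_of A x c e), 0 :: 'n fcoord \<times> 'n fcoord)" for e
    have lin: "linear F"
      using c by (intro linearI) (auto simp: F_def X.tvec_of_add X.tvec_of_scaleR al_lin X.tvec_of_tangent)
    have "tangent_space A x = range (tvec_of A x c)"
      using X.tvec_of_eq[OF _ c] X.tvec_of_tangent[OF c] by (metis (no_types, lifting) rangeE range_eqI subsetI subset_antisym)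
    then have img: "(\<lambda>\<xi>. \<xi> d) ` S = range F"
      using d by (simp add: S image_image hz_def F_def)
    have "inj F"
      unfolding linear_injective_0[OF lin]
    proof (intro allI impI)
      fix e assume "F e = 0"
      then have "tvec_of A x c e = (\<lambda>_. 0)" using al_inj[OF X.tvec_of_tangent[OF c]] by (simp add: F_def zero_prod_def)
      then show "e = 0" using X.tvec_of_self[OF c, of e] by simp
    qed
    then show ?thesis
      unfolding img using dim_image_eq[OF lin, of UNIV] linear_subspace_image[OF lin subspace_UNIV] dim by simp
  qed
  ultimately show ?thesis unfolding S_def[symmetric] gr_D_def using P by simp
qed

lemma L_zero: "L (\<lambda>_. 0) = (\<lambda>_. 0)"
  using l_lin(2)[OF X.tangent_zero, of 0] al_lin(2)[OF X.tangent_zero, of 0]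
  by (simp add: L_eq X.tangent_zero hz_zero)

lemma jet_in_R_I: "(x, P, L) \<in> R_I A"
proof -
  have "L_bar P L ` tangent_space A x = quot_space Z_atlas D_Z P"
  proof (intro subset_antisym subsetI)
    fix q assume "q \<in> quot_space Z_atlas D_Z P"
    then obtain \<xi> where \<xi>: "\<xi> \<in> tangent_space Z_atlas P" "q = quot_class Z_atlas D_Z P \<xi>" by (auto simp: quot_space_def)
    obtain d where d: "d \<in> Z_atlas" "P \<in> fst d" using Z_chart_exists[OF P] by blast
    obtain v where v: "v \<in> tangent_space A x" "fst (\<xi> d) - l v \<in> D_fibre P" using l_surj by blast
    have "fst (\<xi> d) - l v - al v \<in> D_fibre P"
      by (rule subspace_diff[OF subspace_D_fibre(2)[OF P] v(2) al_D[OF v(1)]])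
    then have "(\<lambda>d. \<xi> d - L v d) \<in> D_Z P"
      unfolding D_Z_iff[OF d] L_eq[OF v(1)]
      using d Z.tangent_diff[OF \<xi>(1) hz_tangent] by (simp add: hz_def diff_diff_eq)
    then have "q = L_bar P L v" unfolding \<xi>(2) L_bar_def using quot_class_eq_iff[OF P \<xi>(1)] by blast
    then show "q \<in> L_bar P L ` tangent_space A x" using v(1) by blast
  qed (auto simp: L_bar_def quot_space_def L_eq hz_tangent)
  moreover have "inj_on L (tangent_space A x)"
  proof (rule inj_onI)
    fix v w assume vw: "v \<in> tangent_space A x" "w \<in> tangent_space A x" and "L v = L w"
    then have "L_bar P L v = L_bar P L w" by (simp add: L_bar_def)
    then show "v = w" using L_bar_eq_iff[OF vw] by simp
  qed
  moreover have "L ` tangent_space A x \<inter> J_Z ` (L ` tangent_space A x) = {\<lambda>_. 0}"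
  proof -
    have "\<xi> = (\<lambda>_. 0)" if "v \<in> tangent_space A x" "w \<in> tangent_space A x" "\<xi> = L v" "\<xi> = J_Z (L w)" for \<xi> v w
    proof -
      have e: "l v + al v = \<i> *s (l w + al w)" using that by (intro hz_inj) (simp add: L_eq J_Z_hz)
      then have "l v - l (J w) = - (al v + al (J w))"
        using that(2) by (simp add: l_J al_J vec.scale_right_distrib algebra_simps)
      also have "\<dots> \<in> D_fibre P"
        by (intro subspace_neg[OF subspace_D_fibre(2)[OF P]] subspace_add[OF subspace_D_fibre(2)[OF P]] al_D J that)
      finally have vJ: "v = J w" using that J by (intro eq_if_mod_D) auto
      then have "al v = - al v" using e that(2) by (simp add: l_J al_J vec.scale_right_distrib)
      then have "al v = 0" by (simp add: equal_neg_zero vec_eq_iff)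
      then have "v = (\<lambda>_. 0)" by (rule al_inj[OF that(1)])
      then show ?thesis using L_zero that(3) by simp
    qed
    moreover have "(\<lambda>_. 0) \<in> L ` tangent_space A x" "(\<lambda>_. 0) \<in> J_Z ` (L ` tangent_space A x)"
    proof -
      show 1: "(\<lambda>_. 0) \<in> L ` tangent_space A x"
        by (rule image_eqI[of _ L "\<lambda>_. 0"]) (simp_all add: L_zero X.tangent_zero)
      show "(\<lambda>_. 0) \<in> J_Z ` (L ` tangent_space A x)"
        by (rule image_eqI[of _ J_Z "\<lambda>_. 0"]) (use 1 in \<open>simp_all add: J_Z_def zmodel_i_simps\<close>)
    qed
    ultimately show ?thesis by blast
  qed
  ultimately have "(x, P, L) \<in> R_ac A"
    unfolding R_ac_def jet1_def using x P L_hom by (simp add: carrier_Z_atlas)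
  moreover have "(P, dbar A x P L ` tangent_space A x) \<in> isotropy_locus"
  proof -
    have "torsion Z_atlas D_Z P \<xi> \<eta> = quot_class Z_atlas D_Z P (\<lambda>_. 0)"
      if "\<xi> \<in> dbar A x P L ` tangent_space A x" "\<eta> \<in> dbar A x P L ` tangent_space A x" for \<xi> \<eta>
      using that al_fibre torsion_horizontal[OF P] by (auto simp: dbar_eq)
    then show ?thesis unfolding isotropy_locus_def using dbar_gr_D by simp
  qed
  ultimately show ?thesis unfolding R_I_def by simp
qed

end

section \<open>Bump functions\<close>

lemma differentiable_local:
  assumes "f differentiable (at x)" "open U" "x \<in> U" "\<And>y. y \<in> U \<Longrightarrow> f y = g y"
  shows "g differentiable (at x)"
  using assms has_derivative_transform_within_open unfolding differentiable_def by metis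

definition cutoff :: "real \<Rightarrow> real" where "cutoff t = (max 0 t)\<^sup>2"

lemma cutoff_nonneg: "0 \<le> cutoff t" and cutoff_pos: "0 < t \<Longrightarrow> 0 < cutoff t"
  and cutoff_zero: "t \<le> 0 \<Longrightarrow> cutoff t = 0"
  by (auto simp: cutoff_def max_def)

lemma cutoff_differentiable: "cutoff differentiable (at t)"
proof (cases "t = 0")
  case True
  have "((\<lambda>h. (cutoff (0 + h) - cutoff 0) / h) \<longlongrightarrow> 0) (at 0)"
  proof (rule Lim_null_comparison)
    show "\<forall>\<^sub>F h in at 0. norm ((cutoff (0 + h) - cutoff 0) / h) \<le> \<bar>h\<bar>"
      by (rule always_eventually) (auto simp: cutoff_def max_def power2_eq_square)
    show "((\<lambda>h::real. \<bar>h\<bar>) \<longlongrightarrow> 0) (at 0)" by (rule tendsto_rabs_zero) simp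
  qed
  then have "(cutoff has_real_derivative 0) (at 0)" by (simp add: DERIV_def)
  then show ?thesis using True by (auto simp: has_field_derivative_def differentiable_def)
next
  case False
  show ?thesis
  proof (cases "t > 0")
    case True
    show ?thesis
      by (rule differentiable_local[of "\<lambda>t. t\<^sup>2" t "{0<..}"]) (use True in \<open>auto simp: cutoff_def\<close>)
  next
    case F: False
    show ?thesis
      by (rule differentiable_local[of "\<lambda>t. 0" t "{..<0}"]) (use F False in \<open>auto simp: cutoff_def\<close>)
  qed
qed

locale almost_complex =
  fixes X :: "'a topology" and A :: "('a, 'e::euclidean_space) chart set"
    and J :: "'a \<Rightarrow> ('a, 'e) tvec \<Rightarrow> ('a, 'e) tvec"
  assumes almost_complex: "almost_complex_manifold X A J"
begin

lemma mfd: "Hausdorff_space X" "second_countable X" "topspace X = carrier_of A"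
  and chart_open: "c \<in> A \<Longrightarrow> openin X (fst c)" "c \<in> A \<Longrightarrow> open (snd c ` fst c)"
  and chart_homeo: "c \<in> A \<Longrightarrow> homeomorphic_map (subtopology X (fst c)) (top_of_set (snd c ` fst c)) (snd c)"
  and transition_smooth: "c \<in> A \<Longrightarrow> d \<in> A \<Longrightarrow> smooth_on (snd c ` (fst c \<inter> fst d)) (transition c d)"
  using almost_complex unfolding almost_complex_manifold_def smooth_manifold_def by blast+

lemma chart_subset: "c \<in> A \<Longrightarrow> fst c \<subseteq> topspace X"
  using chart_open(1) openin_subset by blast

lemma open_image:
  assumes c: "c \<in> A" and U: "openin X U"
  shows "open (snd c ` (fst c \<inter> U))"
proof -
  have "openin (subtopology X (fst c)) (fst c \<inter> U)"
    using U by (metis Int_commute openin_subtopology)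
  then have "openin (top_of_set (snd c ` fst c)) (snd c ` (fst c \<inter> U))"
    using homeomorphic_map_openness_eq[OF chart_homeo[OF c]] by blast
  then show ?thesis using chart_open(2)[OF c] openin_open_trans by blast
qed

lemma inj_chart: "c \<in> A \<Longrightarrow> inj_on (snd c) (fst c)"
  using homeomorphic_imp_injective_map[OF chart_homeo] chart_subset by (simp add: Int_absorb1 topspace_subtopology)

lemma openin_preimage:
  assumes c: "c \<in> A" and V: "open V"
  shows "openin X {x \<in> fst c. snd c x \<in> V}"
proof -
  have "continuous_map (subtopology X (fst c)) (top_of_set (snd c ` fst c)) (snd c)"
    using chart_homeo[OF c] homeomorphic_imp_continuous_map by blast
  then have "openin (subtopology X (fst c)) {x \<in> topspace (subtopology X (fst c)). snd c x \<in> snd c ` fst c \<inter> V}"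
    by (rule openin_continuous_map_preimage) (use V openin_open_Int in blast)
  moreover have "{x \<in> topspace (subtopology X (fst c)). snd c x \<in> snd c ` fst c \<inter> V} = {x \<in> fst c. snd c x \<in> V}"
    using chart_subset[OF c] by (auto simp: topspace_subtopology)
  ultimately show ?thesis using chart_open(1)[OF c] by (simp add: openin_open_subtopology)
qed

end

sublocale almost_complex \<subseteq> diff_atlas A
proof
  fix c d x assume c: "c \<in> A" and d: "d \<in> A"
  show "open (snd c ` (fst c \<inter> fst d))" by (rule open_image[OF c chart_open(1)[OF d]])
  assume "x \<in> fst c" "x \<in> fst d"
  then show "transition c d differentiable (at (snd c x))"
    by (intro smooth_on_differentiable[OF transition_smooth[OF c d]]) blast
qed (rule inj_chart)

context almost_complex
begin

definition cdiff :: "('a \<Rightarrow> 'v::real_normed_vector) \<Rightarrow> bool" where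
  "cdiff g \<longleftrightarrow> (\<forall>c\<in>A. \<forall>x\<in>fst c. (\<lambda>y. g (chart_inv c y)) differentiable (at (snd c x)))"

lemma chart_inv_local:
  assumes "c \<in> A" "openin X U" "x \<in> fst c" "x \<in> U" "(\<lambda>y. g (chart_inv c y)) differentiable (at (snd c x))"
    "\<And>x. x \<in> fst c \<Longrightarrow> x \<in> U \<Longrightarrow> g x = h x"
  shows "(\<lambda>y. h (chart_inv c y)) differentiable (at (snd c x))"
  by (rule differentiable_local[OF assms(5) open_image[OF assms(1,2)]])
    (use assms in \<open>auto simp: chart_inv_chart\<close>)

lemma cdiff_compose:
  fixes f :: "'v::real_normed_vector \<Rightarrow> 'w::real_normed_vector"
  assumes "cdiff g" "\<And>t. f differentiable (at t)"
  shows "cdiff (\<lambda>x. f (g x))"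
  using assms differentiable_compose unfolding cdiff_def by blast

lemma cdiff_openin:
  fixes g :: "'a \<Rightarrow> real"
  assumes "cdiff g"
  shows "openin X {x \<in> topspace X. r < g x}"
  unfolding openin_subopen[of X "{x \<in> topspace X. r < g x}"]
proof
  fix x assume x: "x \<in> {x \<in> topspace X. r < g x}"
  then obtain c where c: "c \<in> A" "x \<in> fst c" using mfd(3) by (auto simp: carrier_of_def)
  have "continuous_on (snd c ` fst c) (\<lambda>y. g (chart_inv c y))"
    using assms c(1) unfolding cdiff_def
    by (intro continuous_at_imp_continuous_on ballI) (auto intro: differentiable_imp_continuous_within)
  then have o: "open (snd c ` fst c \<inter> (\<lambda>y. g (chart_inv c y)) -` {r<..})"
    by (rule continuous_open_preimage) (use chart_open(2)[OF c(1)] in auto)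
  have "{x \<in> fst c. snd c x \<in> snd c ` fst c \<inter> (\<lambda>y. g (chart_inv c y)) -` {r<..}} \<subseteq> {x \<in> topspace X. r < g x}"
  proof
    fix x' assume x': "x' \<in> {x \<in> fst c. snd c x \<in> snd c ` fst c \<inter> (\<lambda>y. g (chart_inv c y)) -` {r<..}}"
    then have "r < g (chart_inv c (snd c x'))" by blast
    then show "x' \<in> {x \<in> topspace X. r < g x}"
      using x' chart_subset[OF c(1)] chart_inv_chart[OF c(1), of x'] by auto
  qed
  moreover have "x \<in> {x \<in> fst c. snd c x \<in> snd c ` fst c \<inter> (\<lambda>y. g (chart_inv c y)) -` {r<..}}"
    using c x by (auto simp: chart_inv_chart)
  ultimately show "\<exists>T. openin X T \<and> x \<in> T \<and> T \<subseteq> {x \<in> topspace X. r < g x}"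
    using openin_preimage[OF c(1) o] by blast
qed

lemma bump:
  assumes "x0 \<in> topspace X"
  shows "\<exists>c C g. c \<in> A \<and> closedin X C \<and> C \<subseteq> fst c \<and> (\<forall>x. x \<notin> C \<longrightarrow> g x = 0) \<and> 0 < g x0
    \<and> (\<forall>x. 0 \<le> g x) \<and> cdiff (g :: 'a \<Rightarrow> real)"
proof -
  obtain c where c: "c \<in> A" "x0 \<in> fst c" using assms mfd(3) by (auto simp: carrier_of_def)
  define y0 where "y0 = snd c x0"
  obtain r where r: "r > 0" "cball y0 r \<subseteq> snd c ` fst c"
    using chart_open(2)[OF c(1)] c(2) unfolding y0_def open_contains_cball by blast
  define \<psi> where "\<psi> y = cutoff (r\<^sup>2 - (y - y0) \<bullet> (y - y0))" for y
  define C where "C = {x \<in> fst c. snd c x \<in> cball y0 r}"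
  define g where "g x = (if x \<in> fst c then \<psi> (snd c x) else 0)" for x
  have img: "snd c ` C = cball y0 r" using r(2) by (auto simp: C_def)
  have "compactin (top_of_set (snd c ` fst c)) (snd c ` C)"
    unfolding img using r(2) by (simp add: compactin_subtopology)
  then have "compactin (subtopology X (fst c)) C"
    using homeomorphic_map_compactness_eq[OF chart_homeo[OF c(1)], of C] chart_subset[OF c(1)]
    by (auto simp: C_def topspace_subtopology)
  then have C: "closedin X C" "C \<subseteq> fst c"
    using compactin_imp_closedin[OF mfd(1)] by (auto simp: compactin_subtopology)
  have g0: "g x = 0" if "x \<notin> C" for x
  proof (cases "x \<in> fst c")
    case True
    then have "r < dist (snd c x) y0" using that by (auto simp: C_def dist_commute)
    then have "r\<^sup>2 < (dist (snd c x) y0)\<^sup>2" using r(1) by (intro power_strict_mono) auto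
    then show ?thesis using True
      by (simp add: g_def \<psi>_def cutoff_zero dist_norm power2_norm_eq_inner)
  qed (simp add: g_def)
  have \<psi>: "\<psi> differentiable (at y)" for y
  proof -
    have "(\<lambda>y. r\<^sup>2 - (y - y0) \<bullet> (y - y0)) differentiable (at y)"
      unfolding differentiable_def by (rule exI) (rule derivative_eq_intros refl)+
    from differentiable_compose[OF cutoff_differentiable this] show ?thesis unfolding \<psi>_def .
  qed
  have "cdiff g"
    unfolding cdiff_def
  proof (intro ballI)
    fix d x assume d: "d \<in> A" "x \<in> fst d"
    show "(\<lambda>y. g (chart_inv d y)) differentiable (at (snd d x))"
    proof (cases "x \<in> fst c")
      case True
      have "(\<lambda>y. \<psi> (transition d c y)) differentiable (at (snd d x))"
        by (rule differentiable_compose[OF \<psi> transition_differentiable[OF d(1) c(1) d(2) True]])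
      then have "(\<lambda>y. \<psi> (snd c (chart_inv d y))) differentiable (at (snd d x))"
        by (simp add: transition_def)
      then show ?thesis
        by (rule chart_inv_local[OF d(1) chart_open(1)[OF c(1)] d(2) True]) (simp add: g_def)
    next
      case False
      have "openin X (topspace X - C)" using C(1) by blast
      then show ?thesis
        by (rule chart_inv_local[of d _ x "\<lambda>_. 0", OF d(1) _ d(2)])
          (use False C(2) d chart_subset[OF d(1)] g0 in auto)
    qed
  qed
  moreover have "0 < g x0" using c(2) r(1) by (simp add: g_def \<psi>_def y0_def cutoff_pos)
  moreover have "0 \<le> g x" for x by (simp add: g_def \<psi>_def cutoff_nonneg)
  ultimately show ?thesis 
    by (intro exI[of _ c] exI[of _ C] exI[of _ g] conjI allI impI c(1) C g0)
qed

lemma locally_finite_bumps: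
  assumes "topspace X \<noteq> {}"
  obtains c :: "nat \<Rightarrow> ('a, 'e) chart" and C :: "nat \<Rightarrow> 'a set" and h :: "nat \<Rightarrow> 'a \<Rightarrow> real" where
    "\<And>i. c i \<in> A" "\<And>i. closedin X (C i)" "\<And>i. C i \<subseteq> fst (c i)" "\<And>i x. x \<notin> C i \<Longrightarrow> h i x = 0"
    "\<And>i. cdiff (h i)" "\<And>x. x \<in> topspace X \<Longrightarrow> \<exists>i. h i x \<noteq> 0"
    "\<And>x. x \<in> topspace X \<Longrightarrow> \<exists>U N. openin X U \<and> x \<in> U \<and> (\<forall>i\<ge>N. \<forall>x'\<in>U. h i x' = 0)"
proof -
  obtain c0 C0 g0 where b: "\<And>x0. x0 \<in> topspace X \<Longrightarrow> c0 x0 \<in> A \<and> closedin X (C0 x0) \<and> C0 x0 \<subseteq> fst (c0 x0)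
    \<and> (\<forall>x. x \<notin> C0 x0 \<longrightarrow> g0 x0 x = 0) \<and> 0 < g0 x0 x0 \<and> (\<forall>x. 0 \<le> g0 x0 x) \<and> cdiff (g0 x0 :: 'a \<Rightarrow> real)"
    using bump by metis
  define U0 where "U0 x0 = {x \<in> topspace X. 0 < g0 x0 x}" for x0
  have "\<forall>U\<in>U0 ` topspace X. openin X U" using b cdiff_openin by (auto simp: U0_def)
  moreover have "\<Union>(U0 ` topspace X) = topspace X" using b by (fastforce simp: U0_def)
  ultimately have "\<exists>\<V>. countable \<V> \<and> \<V> \<subseteq> U0 ` topspace X \<and> \<Union>\<V> = topspace X"
    using second_countable_imp_Lindelof_space[OF mfd(2), unfolded Lindelof_space_def, THEN spec, THEN mp,
        of "U0 ` topspace X"] by simp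
  then obtain \<V> where V: "countable \<V>" "\<V> \<subseteq> U0 ` topspace X" "\<Union>\<V> = topspace X" by (elim exE conjE)
  obtain D where D: "countable D" "D \<subseteq> topspace X" "\<V> = U0 ` D"
    using countable_subset_image[THEN iffD1, OF conjI[OF V(1,2)]] by (elim exE conjE)
  have "D \<noteq> {}"
  proof
    assume "D = {}"
    then have "topspace X = {}" unfolding V(3)[symmetric] D(3) by (simp only: image_empty Union_empty)
    then show False using assms by (rule notE[rotated])
  qed
  define e where "e = from_nat_into D"
  have e: "e i \<in> topspace X" for i using from_nat_into[OF \<open>D \<noteq> {}\<close>] D(2) by (auto simp: e_def)
  have cover: "\<exists>i. 0 < g0 (e i) x" if x: "x \<in> topspace X" for x
  proof -
    obtain x0 where x0: "x0 \<in> D" "x \<in> U0 x0" using x V(3) D(3) by blast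
    obtain i where "e i = x0" using from_nat_into_surj[OF D(1) x0(1)] unfolding e_def by blast
    then show ?thesis using x0(2) unfolding U0_def by blast
  qed
  txt \<open>The cutoffs kill the \<open>i\<close>-th function of the cover where an earlier one exceeds \<open>1 / (i + 1)\<close>.
    This makes the family locally finite without any compactness argument.\<close>
  define h where "h i x = g0 (e i) x * (\<Prod>j<i. cutoff (1 / (real i + 1) - g0 (e j) x))" for i x
  have g_cd: "cdiff (g0 (e i))" for i using b[OF e] by blast
  show ?thesis
  proof (rule that[of "\<lambda>i. c0 (e i)" "\<lambda>i. C0 (e i)" h])
    show "c0 (e i) \<in> A" "closedin X (C0 (e i))" "C0 (e i) \<subseteq> fst (c0 (e i))" for i using b[OF e] by blast+
    show "h i x = 0" if "x \<notin> C0 (e i)" for i x using b[OF e] that by (simp add: h_def)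
    show "cdiff (h i)" for i
    proof -
      have cd: "cdiff (\<lambda>x. cutoff (r - g0 (e j) x))" for j r
        by (rule cdiff_compose[OF g_cd, of "\<lambda>t. cutoff (r - t)"])
          (auto intro!: differentiable_compose[OF cutoff_differentiable])
      have "cdiff (\<lambda>x. \<Prod>j\<in>I. cutoff (r - g0 (e j) x))" if "finite I" for I r
        using that
      proof induction
        case (insert j I)
        with cd[of r j] show ?case unfolding cdiff_def by simp
      qed (simp add: cdiff_def)
      from this[of "{..<i}" "1 / (real i + 1)"] g_cd[of i] show ?thesis
        unfolding cdiff_def h_def by simp
    qed
  next
    fix x assume x: "x \<in> topspace X"
    define i where "i = (LEAST i. 0 < g0 (e i) x)"
    have i: "0 < g0 (e i) x" unfolding i_def using cover[OF x] by (rule LeastI_ex)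
    have "g0 (e j) x = 0" if "j < i" for j
      using not_less_Least[of j "\<lambda>i. 0 < g0 (e i) x"] that b[OF e, of j] unfolding i_def by (metis order_le_less)
    then have "0 < h i x" using i by (simp add: h_def cutoff_pos)
    then show "\<exists>i. h i x \<noteq> 0" by (metis less_irrefl)
  next
    fix x assume x: "x \<in> topspace X"
    obtain i where i: "0 < g0 (e i) x" using cover[OF x] by blast
    define U where "U = {x' \<in> topspace X. g0 (e i) x / 2 < g0 (e i) x'}"
    obtain N0 where "inverse (real (Suc N0)) < g0 (e i) x / 2"
      using reals_Archimedean[OF half_gt_zero[OF i]] by (elim exE)
    then have N0: "1 / (real N0 + 1) < g0 (e i) x / 2" by (simp add: inverse_eq_divide add.commute)
    have "h k x' = 0" if "k \<ge> max N0 (Suc i)" "x' \<in> U" for k x'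
    proof -
      have "1 / (real k + 1) \<le> 1 / (real N0 + 1)" using that(1) by (intro divide_left_mono) auto
      then have "cutoff (1 / (real k + 1) - g0 (e i) x') = 0"
        using N0 that(2) by (intro cutoff_zero) (simp add: U_def)
      then have "(\<Prod>j<k. cutoff (1 / (real k + 1) - g0 (e j) x')) = 0"
        using that(1) by (intro prod_zero) auto
      then show ?thesis by (simp add: h_def)
    qed
    moreover have "openin X U" unfolding U_def by (rule cdiff_openin[OF g_cd])
    moreover have "x \<in> U" unfolding U_def using x i by simp
    ultimately show "\<exists>U N. openin X U \<and> x \<in> U \<and> (\<forall>i\<ge>N. \<forall>x'\<in>U. h i x' = 0)" by blast
  qed
qed

end

section \<open>A complex-linear monomorphism of the tangent bundle into a trivial bundle\<close>

lemma dependent_choice_prefix: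
  assumes P0: "\<And>a. P 0 (a :: nat \<Rightarrow> 'b)"
    and step: "\<And>k a. P k a \<Longrightarrow> \<exists>w. P (Suc k) (a(k := w))"
    and local: "\<And>k a a'. P k a \<Longrightarrow> (\<And>j. j < k \<Longrightarrow> a j = a' j) \<Longrightarrow> P k a'"
  shows "\<exists>a. \<forall>k. P k a"
proof -
  obtain f where f: "\<And>k. P k (f k)" "\<And>k. \<exists>w. f (Suc k) = (f k)(k := w)"
    using dependent_nat_choice[of P "\<lambda>k a a'. \<exists>w. a' = a(k := w)"] P0 step by metis
  have *: "f (j + i) k = f j k" if "k < j" for i j k
  proof (induction i)
    case (Suc i)
    obtain w where "f (Suc (j + i)) = (f (j + i))(j + i := w)" using f(2) by blast
    then show ?case using Suc that by simp
  qed simp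
  have "P k (\<lambda>j. f (Suc j) j)" for k
  proof (rule local[OF f(1)])
    show "f k j = f (Suc j) j" if "j < k" for j
      using *[of j "Suc j" "k - Suc j"] that by simp
  qed
  then show ?thesis by blast
qed

lemma differentiable_bounded_linear:
  "bounded_linear f \<Longrightarrow> g differentiable (at x) \<Longrightarrow> (\<lambda>y. f (g y)) differentiable (at x)"
  unfolding differentiable_def using bounded_linear.has_derivative by blast

context almost_complex
begin

lemma J_tangent: "x \<in> topspace X \<Longrightarrow> v \<in> tangent_space A x \<Longrightarrow> J x v \<in> tangent_space A x"
  and J_J: "x \<in> topspace X \<Longrightarrow> v \<in> tangent_space A x \<Longrightarrow> J x (J x v) = (\<lambda>c. - v c)"
  and J_add: "x \<in> topspace X \<Longrightarrow> v \<in> tangent_space A x \<Longrightarrow> w \<in> tangent_space A x \<Longrightarrow>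
    J x (\<lambda>c. v c + w c) = (\<lambda>c. J x v c + J x w c)"
  and J_scaleR: "x \<in> topspace X \<Longrightarrow> v \<in> tangent_space A x \<Longrightarrow> J x (\<lambda>c. r *\<^sub>R v c) = (\<lambda>c. r *\<^sub>R J x v c)"
  and J_smooth: "c \<in> A \<Longrightarrow> smooth_on (snd c ` fst c) (\<lambda>y. J (chart_inv c y) (tvec_of A (chart_inv c y) c e) c)"
proof -
  have J: "almost_complex_structure A J" using almost_complex by (simp add: almost_complex_manifold_def)
  have h: "J x \<in> tangent_hom A x A x" if "x \<in> topspace X" for x
    using J that mfd(3) unfolding almost_complex_structure_def by blast
  show "J x v \<in> tangent_space A x" if "x \<in> topspace X" "v \<in> tangent_space A x"
    using h[OF that(1)] that(2) unfolding tangent_hom_def by blast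
  show "J x (J x v) = (\<lambda>c. - v c)" if "x \<in> topspace X" "v \<in> tangent_space A x"
    using J that mfd(3) unfolding almost_complex_structure_def by blast
  show "J x (\<lambda>c. v c + w c) = (\<lambda>c. J x v c + J x w c)"
    if "x \<in> topspace X" "v \<in> tangent_space A x" "w \<in> tangent_space A x"
    using h[OF that(1)] that(2,3) unfolding tangent_hom_def by blast
  show "J x (\<lambda>c. r *\<^sub>R v c) = (\<lambda>c. r *\<^sub>R J x v c)" if "x \<in> topspace X" "v \<in> tangent_space A x"
    using h[OF that(1)] that(2) unfolding tangent_hom_def by blast
  show "smooth_on (snd c ` fst c) (\<lambda>y. J (chart_inv c y) (tvec_of A (chart_inv c y) c e) c)" if "c \<in> A"
    using J that unfolding almost_complex_structure_def by blast
qed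

text \<open>Twice the complex-linear part of the \<open>b\<close>-coordinate functional of the chart \<open>d\<close>.\<close>

definition ccoord :: "('a, 'e) chart \<Rightarrow> 'e \<Rightarrow> 'a \<Rightarrow> ('a, 'e) tvec \<Rightarrow> complex" where
  "ccoord d b x v = complex_of_real (v d \<bullet> b) - \<i> * complex_of_real (J x v d \<bullet> b)"

lemma ccoord_add: "x \<in> topspace X \<Longrightarrow> v \<in> tangent_space A x \<Longrightarrow> w \<in> tangent_space A x \<Longrightarrow>
    ccoord d b x (\<lambda>c. v c + w c) = ccoord d b x v + ccoord d b x w"
  by (simp add: ccoord_def J_add inner_add_left algebra_simps)

lemma ccoord_scaleR: "x \<in> topspace X \<Longrightarrow> v \<in> tangent_space A x \<Longrightarrow>
    ccoord d b x (\<lambda>c. r *\<^sub>R v c) = r *\<^sub>R ccoord d b x v"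
  by (simp add: ccoord_def J_scaleR scaleR_conv_of_real algebra_simps)

lemma ccoord_J: "x \<in> topspace X \<Longrightarrow> v \<in> tangent_space A x \<Longrightarrow> ccoord d b x (J x v) = \<i> * ccoord d b x v"
  by (simp add: ccoord_def J_J algebra_simps)

lemma ccoord_differentiable:
  assumes c: "c \<in> A" "x \<in> fst c" and d: "d \<in> A" "x \<in> fst d"
  shows "(\<lambda>y. ccoord d b (chart_inv c y) (tvec_of A (chart_inv c y) c e)) differentiable (at (snd c x))"
proof -
  let ?D = "\<lambda>y. frechet_derivative (transition c d) (at y)"
  define g where "g y = J (chart_inv c y) (tvec_of A (chart_inv c y) c e) c" for y
  have O: "open (snd c ` (fst c \<inter> fst d))" "snd c x \<in> snd c ` (fst c \<inter> fst d)"
    using c d open_overlap by blast+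
  have D: "(\<lambda>y. ?D y u) differentiable (at (snd c x))" for u
    by (rule smooth_on_differentiable[OF smooth_on_frechet[OF transition_smooth[OF c(1) d(1)]] O(2)])
  have "g differentiable (at (snd c x))"
    unfolding g_def using smooth_on_differentiable[OF J_smooth[OF c(1)]] c(2) by blast
  then have g: "(\<lambda>y. g y \<bullet> u) differentiable (at (snd c x))" for u
    by (rule differentiable_bounded_linear[OF bounded_linear_inner_left])
  have "(\<lambda>y. complex_of_real (?D y e \<bullet> b) - \<i> * complex_of_real ((\<Sum>u\<in>Basis. (g y \<bullet> u) *\<^sub>R ?D y u) \<bullet> b))
      differentiable (at (snd c x))"
  proof -
    have i: "(\<lambda>y. f y \<bullet> b) differentiable (at z)" if "f differentiable (at z)" for f :: "'e \<Rightarrow> 'e" and z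
      using that by (rule differentiable_bounded_linear[OF bounded_linear_inner_left])
    have r: "(\<lambda>y. complex_of_real (f y)) differentiable (at z)" if "f differentiable (at z)" for f :: "'e \<Rightarrow> real" and z
      using that by (rule differentiable_bounded_linear[OF bounded_linear_of_real])
    show ?thesis
      by (intro differentiable_diff differentiable_mult differentiable_const r i differentiable_sum
          differentiable_scaleR D g ballI finite_Basis)
  qed
  then show ?thesis
  proof (rule differentiable_local[OF _ O])
    fix y assume "y \<in> snd c ` (fst c \<inter> fst d)"
    then obtain x' where x': "x' \<in> fst c" "x' \<in> fst d" "y = snd c x'" by blast
    have inv: "chart_inv c y = x'" using x' chart_inv_chart[OF c(1)] by simp
    let ?v = "tvec_of A x' c e"
    have v: "?v \<in> tangent_space A x'" by (rule tvec_of_tangent[OF c(1) x'(1)])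
    have Jv: "J x' ?v \<in> tangent_space A x'" using J_tangent v chart_subset[OF c(1)] x'(1) by blast
    have "?v d = ?D y e"
      using tangent_transition[OF v c(1) d(1) x'(1,2)] by (simp add: tvec_of_self[OF c(1) x'(1)] x'(3))
    moreover have "J x' ?v d = (\<Sum>u\<in>Basis. (g y \<bullet> u) *\<^sub>R ?D y u)"
    proof -
      have "J x' ?v d = ?D y (g y)"
        using tangent_transition[OF Jv c(1) d(1) x'(1,2)] by (simp add: g_def inv x'(3)[symmetric])
      also have "\<dots> = ?D y (\<Sum>u\<in>Basis. (g y \<bullet> u) *\<^sub>R u)" by (simp add: euclidean_representation)
      also have "\<dots> = (\<Sum>u\<in>Basis. (g y \<bullet> u) *\<^sub>R ?D y u)"
        using linear_transition[OF c(1) d(1) x'(1,2)] unfolding x'(3) by (simp add: linear_sum linear_cmul)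
      finally show ?thesis .
    qed
    ultimately show "complex_of_real (?D y e \<bullet> b) - \<i> * complex_of_real ((\<Sum>u\<in>Basis. (g y \<bullet> u) *\<^sub>R ?D y u) \<bullet> b) =
        ccoord d b (chart_inv c y) (tvec_of A (chart_inv c y) c e)"
      by (simp add: ccoord_def inv)
  qed
qed

definition Lam :: "('a \<Rightarrow> real) \<Rightarrow> ('a, 'e) chart \<Rightarrow> 'e \<Rightarrow> 'a \<Rightarrow> ('a, 'e) tvec \<Rightarrow> complex" where
  "Lam h d b x v = complex_of_real (h x) * ccoord d b x v"

lemma Lam_differentiable:
  assumes h: "cdiff h" "closedin X C" "C \<subseteq> fst d" "\<And>x. x \<notin> C \<Longrightarrow> h x = 0" and d: "d \<in> A"
    and c: "c \<in> A" "x \<in> fst c"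
  shows "(\<lambda>p. Lam h d b (chart_inv c (fst p)) (tvec_of A (chart_inv c (fst p)) c (snd p)))
    differentiable (at (snd c x, e))"
proof -
  have 1: "(\<lambda>y. Lam h d b (chart_inv c y) (tvec_of A (chart_inv c y) c u)) differentiable (at (snd c x))" for u
  proof (cases "x \<in> fst d")
    case True
    have "(\<lambda>y. h (chart_inv c y)) differentiable (at (snd c x))" using h(1) c by (simp add: cdiff_def)
    then have "(\<lambda>y. complex_of_real (h (chart_inv c y))) differentiable (at (snd c x))"
      by (rule differentiable_bounded_linear[OF bounded_linear_of_real])
    then show ?thesis
      unfolding Lam_def by (rule differentiable_mult) (rule ccoord_differentiable[OF c d True])
  next
    case False
    have U: "openin X (topspace X - C)" using h(2) by blast
    show ?thesis
      by (rule chart_inv_local[of c _ x "\<lambda>_. 0" "\<lambda>x. Lam h d b x (tvec_of A x c u)", OF c(1) U c(2)])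
        (use False h(3,4) chart_subset[OF c(1)] c in \<open>auto simp: Lam_def\<close>)
  qed
  have "(\<lambda>p. \<Sum>u\<in>Basis. (snd p \<bullet> u) *\<^sub>R Lam h d b (chart_inv c (fst p)) (tvec_of A (chart_inv c (fst p)) c u))
      differentiable (at (snd c x, e))"
  proof (intro differentiable_sum differentiable_scaleR ballI finite_Basis)
    fix u :: 'e
    show "(\<lambda>p. snd p \<bullet> u) differentiable (at (snd c x, e))"
      unfolding differentiable_def by (rule exI, rule has_derivative_inner_left, rule has_derivative_snd, rule has_derivative_ident)
    have "fst differentiable (at (snd c x, e))"
      using bounded_linear_imp_differentiable[OF bounded_linear_fst] by blast
    then show "(\<lambda>p. Lam h d b (chart_inv c (fst p)) (tvec_of A (chart_inv c (fst p)) c u)) differentiable (at (snd c x, e))"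
      using differentiable_compose[of "\<lambda>y. Lam h d b (chart_inv c y) (tvec_of A (chart_inv c y) c u)" fst "(snd c x, e)"] 1
      by simp
  qed
  then show ?thesis
  proof (rule differentiable_local[where U = "snd c ` fst c \<times> UNIV"])
    show "open (snd c ` fst c \<times> (UNIV :: 'e set))" using chart_open(2)[OF c(1)] by (simp add: open_Times)
    show "(snd c x, e) \<in> snd c ` fst c \<times> UNIV" using c(2) by simp
    fix p :: "'e \<times> 'e" assume "p \<in> snd c ` fst c \<times> UNIV"
    then obtain x' e' where p: "x' \<in> fst c" "p = (snd c x', e')" by auto
    have x': "x' \<in> topspace X" using p chart_subset[OF c(1)] by blast
    let ?F = "\<lambda>e. Lam h d b x' (tvec_of A x' c e)"
    have lin: "linear ?F"
      using c(1) p(1) x' by (intro linearI) (auto simp: Lam_def tvec_of_add tvec_of_scaleR ccoord_add ccoord_scaleR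
          tvec_of_tangent algebra_simps)
    have "?F (\<Sum>u\<in>Basis. (e' \<bullet> u) *\<^sub>R u) = (\<Sum>u\<in>Basis. (e' \<bullet> u) *\<^sub>R ?F u)"
      using linear_sum[OF lin, of "\<lambda>u. (e' \<bullet> u) *\<^sub>R u" Basis] linear_cmul[OF lin] by simp
    then show "(\<Sum>u\<in>Basis. (snd p \<bullet> u) *\<^sub>R Lam h d b (chart_inv c (fst p)) (tvec_of A (chart_inv c (fst p)) c u)) =
        Lam h d b (chart_inv c (fst p)) (tvec_of A (chart_inv c (fst p)) c (snd p))"
      using chart_inv_chart[OF c(1) p(1)] by (simp add: p(2) euclidean_representation)
  qed
qed

lemma bounded_linear_scale_vec: "bounded_linear (\<lambda>c. c *s (a :: complex ^ 'k))"
  unfolding linear_conv_bounded_linear[symmetric] by (rule linearI) (simp_all add: vec.scale_left_distrib vec_eq_iff)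

text \<open>The vector \<open>a k\<close> is chosen off the image of a differentiable map defined on a space of real dimension
  \<open>2 DIM('e) < 2 CARD('k)\<close>. No smallness is needed: where the new functional vanishes the partial sum
  does not change, and where it does not vanish the choice of \<open>a k\<close> makes the sum nonzero.\<close>

lemma generic_vectors:
  fixes h :: "nat \<Rightarrow> 'a \<Rightarrow> real" and d :: "nat \<Rightarrow> ('a, 'e) chart" and b :: "nat \<Rightarrow> 'e"
  assumes h: "\<And>k. cdiff (h k)" "\<And>k. closedin X (C k)" "\<And>k. C k \<subseteq> fst (d k)" "\<And>k x. x \<notin> C k \<Longrightarrow> h k x = 0"
    and d: "\<And>k. d k \<in> A" and dim: "DIM('e) < CARD('k::finite)"
  obtains a :: "nat \<Rightarrow> complex ^ 'k" where
    "\<And>k x v. x \<in> topspace X \<Longrightarrow> v \<in> tangent_space A x \<Longrightarrow> \<exists>j<k. Lam (h j) (d j) (b j) x v \<noteq> 0 \<Longrightarrow>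
      (\<Sum>j<k. Lam (h j) (d j) (b j) x v *s a j) \<noteq> 0"
proof -
  define L where "L k = Lam (h k) (d k) (b k)" for k
  define P where "P k (a :: nat \<Rightarrow> complex ^ 'k) \<longleftrightarrow> (\<forall>x\<in>topspace X. \<forall>v\<in>tangent_space A x. (\<exists>j<k. L j x v \<noteq> 0) \<longrightarrow>
      (\<Sum>j<k. L j x v *s a j) \<noteq> 0)" for k a
  have "\<exists>a. \<forall>k. P k a"
  proof (rule dependent_choice_prefix[of P])
    show "P 0 a" for a by (simp add: P_def)
    show "P k a'" if "P k a" "\<And>j. j < k \<Longrightarrow> a j = a' j" for k a a'
      using that unfolding P_def by simp
    fix k a assume Pk: "P k a"
    define c where "c = d k"
    have c: "c \<in> A" by (simp add: c_def d)
    define M where "M j p = L j (chart_inv c (fst p)) (tvec_of A (chart_inv c (fst p)) c (snd p))" for j and p :: "'e \<times> 'e"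
    define S where "S = {p \<in> snd c ` fst c \<times> UNIV. M k p \<noteq> 0}"
    define G where "G p = (\<Sum>j<k. (- (M j p / M k p)) *s a j)" for p
    have M: "M j differentiable (at p)" if p: "p \<in> S" for j p
    proof -
      obtain x e where "x \<in> fst c" "p = (snd c x, e)" using p by (auto simp: S_def)
      then show ?thesis unfolding M_def L_def using Lam_differentiable[OF h d c] by simp
    qed
    have "G differentiable (at p)" if p: "p \<in> S" for p
      unfolding G_def
    proof (intro differentiable_sum ballI)
      fix j
      have "(\<lambda>p. - (M j p / M k p)) differentiable (at p)"
        using p by (intro differentiable_minus differentiable_divide M[OF p]) (simp add: S_def)
      then show "(\<lambda>p. (- (M j p / M k p)) *s a j) differentiable (at p)"
        by (rule differentiable_bounded_linear[OF bounded_linear_scale_vec])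
    qed simp
    then have "G differentiable_on S" using differentiable_at_imp_differentiable_on by blast
    then have "negligible (G ` S)"
      using dim by (intro negligible_differentiable_image_lowdim) auto
    then obtain w where w: "w \<notin> G ` S" using non_negligible_UNIV by (metis UNIV_eq_I)
    have "P (Suc k) (a(k := w))"
      unfolding P_def
    proof (intro ballI impI)
      fix x v assume x: "x \<in> topspace X" and v: "v \<in> tangent_space A x" and ex: "\<exists>j<Suc k. L j x v \<noteq> 0"
      have s: "(\<Sum>j<Suc k. L j x v *s (a(k := w)) j) = (\<Sum>j<k. L j x v *s a j) + L k x v *s w" by simp
      show "(\<Sum>j<Suc k. L j x v *s (a(k := w)) j) \<noteq> 0"
      proof (cases "L k x v = 0")
        case True
        then have "\<exists>j<k. L j x v \<noteq> 0" using ex less_Suc_eq by metis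
        then show ?thesis using Pk x v unfolding s P_def by (simp add: True)
      next
        case False
        then have "h k x \<noteq> 0" by (auto simp: L_def Lam_def)
        then have xc: "x \<in> fst c" using h(3,4) unfolding c_def by blast
        have Mx: "M j (snd c x, v c) = L j x v" for j
          by (simp add: M_def chart_inv_chart[OF c xc] tvec_of_eq[OF v c xc])
        have "(snd c x, v c) \<in> S" using False xc by (simp add: S_def Mx)
        then have ne: "w \<noteq> (\<Sum>j<k. (- (L j x v / L k x v)) *s a j)"
          using w by (auto simp: G_def Mx[symmetric])
        show ?thesis
        proof
          assume "(\<Sum>j<Suc k. L j x v *s (a(k := w)) j) = 0"
          then have "L k x v *s w = - (\<Sum>j<k. L j x v *s a j)" unfolding s by (metis add.commute add_eq_0_iff)
          then have "(1 / L k x v) *s (L k x v *s w) = (1 / L k x v) *s (- (\<Sum>j<k. L j x v *s a j))" by simp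
          then have "w = (\<Sum>j<k. (- (L j x v / L k x v)) *s a j)"
            using False by (simp add: vec.scale_sum_right sum_negf)
          then show False using ne by simp
        qed
      qed
    qed
    then show "\<exists>w. P (Suc k) (a(k := w))" by blast
  qed
  then obtain a where a: "\<And>k. P k a" by blast
  show ?thesis
  proof (rule that)
    show "(\<Sum>j<k. Lam (h j) (d j) (b j) x v *s a j) \<noteq> 0"
      if "x \<in> topspace X" "v \<in> tangent_space A x" "\<exists>j<k. Lam (h j) (d j) (b j) x v \<noteq> 0" for k x v
      using a[of k] that unfolding P_def L_def by simp
  qed
qed

end

locale tangent_mono = almost_complex X A J
  for X :: "'a topology" and A :: "('a, 'e::euclidean_space) chart set" and J +
  fixes l :: "'a \<Rightarrow> ('a, 'e) tvec \<Rightarrow> complex ^ 'k"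
  assumes l_add: "\<And>x v w. x \<in> topspace X \<Longrightarrow> v \<in> tangent_space A x \<Longrightarrow> w \<in> tangent_space A x \<Longrightarrow>
      l x (\<lambda>c. v c + w c) = l x v + l x w"
    and l_scaleR: "\<And>x v r. x \<in> topspace X \<Longrightarrow> v \<in> tangent_space A x \<Longrightarrow> l x (\<lambda>c. r *\<^sub>R v c) = r *\<^sub>R l x v"
    and l_J: "\<And>x v. x \<in> topspace X \<Longrightarrow> v \<in> tangent_space A x \<Longrightarrow> l x (J x v) = \<i> *s l x v"
    and l_inj: "\<And>x v. x \<in> topspace X \<Longrightarrow> v \<in> tangent_space A x \<Longrightarrow> l x v = 0 \<Longrightarrow> v = (\<lambda>_. 0)"
    and l_cont: "\<And>x c e. c \<in> A \<Longrightarrow> x \<in> fst c \<Longrightarrow>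
      isCont (\<lambda>y. l (chart_inv c y) (tvec_of A (chart_inv c y) c e)) (snd c x)"

lemma (in almost_complex) tangent_monomorphism:
  assumes dim: "DIM('e) < CARD('k::finite)"
  shows "\<exists>l :: 'a \<Rightarrow> ('a, 'e) tvec \<Rightarrow> complex ^ 'k. tangent_mono X A J l"
proof (cases "topspace X = {}")
  case False
  show ?thesis
  proof (rule locally_finite_bumps[OF False])
    fix c C and h :: "nat \<Rightarrow> 'a \<Rightarrow> real"
    assume ch: "\<And>i. c i \<in> A" "\<And>i. closedin X (C i)" "\<And>i. C i \<subseteq> fst (c i)"
      "\<And>i x. x \<notin> C i \<Longrightarrow> h i x = 0" "\<And>i. cdiff (h i)" "\<And>x. x \<in> topspace X \<Longrightarrow> \<exists>i. h i x \<noteq> 0"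
      "\<And>x. x \<in> topspace X \<Longrightarrow> \<exists>U N. openin X U \<and> x \<in> U \<and> (\<forall>i\<ge>N. \<forall>x'\<in>U. h i x' = 0)"
    define m where "m = DIM('e)"
    have m: "m > 0" by (simp add: m_def)
    obtain \<beta> :: "nat \<Rightarrow> 'e" where \<beta>: "bij_betw \<beta> {..<m} Basis"
      using ex_bij_betw_nat_finite[OF finite_Basis] by (auto simp: m_def atLeast0LessThan)
    define L where "L k = Lam (h (k div m)) (c (k div m)) (\<beta> (k mod m))" for k
    obtain a :: "nat \<Rightarrow> complex ^ 'k" where a: "\<And>k x v. x \<in> topspace X \<Longrightarrow> v \<in> tangent_space A x \<Longrightarrow>
        \<exists>j<k. L j x v \<noteq> 0 \<Longrightarrow> (\<Sum>j<k. L j x v *s a j) \<noteq> 0"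
      using generic_vectors[of "\<lambda>k. h (k div m)" "\<lambda>k. C (k div m)" "\<lambda>k. c (k div m)" "\<lambda>k. \<beta> (k mod m)", OF ch(5,2,3,4,1) dim]
      unfolding L_def by blast
    define l where "l x v = (\<Sum>j | h (j div m) x \<noteq> 0. L j x v *s a j)" for x v
    have l_eq: "l x v = (\<Sum>j<N * m. L j x v *s a j)" if N: "\<forall>i\<ge>N. h i x = 0" for x v N
      unfolding l_def
    proof (rule sum.mono_neutral_left)
      show "{j. h (j div m) x \<noteq> 0} \<subseteq> {..<N * m}"
        using N m by (auto simp: not_less[symmetric] div_less_iff_less_mult[symmetric])
      show "\<forall>j\<in>{..<N * m} - {j. h (j div m) x \<noteq> 0}. L j x v *s a j = 0" by (simp add: L_def Lam_def)
    qed simp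
    show ?thesis
    proof (rule exI[of _ l], unfold_locales)
      have fin: "\<exists>N. (\<forall>i\<ge>N. h i x = 0) \<and> (\<forall>v. l x v = (\<Sum>j<N * m. L j x v *s a j))"
        if "x \<in> topspace X" for x
        using ch(7)[OF that] l_eq by blast
      show "l x (\<lambda>c. v c + w c) = l x v + l x w" if x: "x \<in> topspace X" "v \<in> tangent_space A x" "w \<in> tangent_space A x" for x v w
      proof -
        obtain N where l: "\<And>v. l x v = (\<Sum>j<N * m. L j x v *s a j)" using fin[OF x(1)] by blast
        show ?thesis unfolding l using x
          by (simp add: L_def Lam_def ccoord_add distrib_left vec.scale_left_distrib sum.distrib)
      qed
      show "l x (\<lambda>c. r *\<^sub>R v c) = r *\<^sub>R l x v" if x: "x \<in> topspace X" "v \<in> tangent_space A x" for x v r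
      proof -
        obtain N where l: "\<And>v. l x v = (\<Sum>j<N * m. L j x v *s a j)" using fin[OF x(1)] by blast
        have "L j x (\<lambda>c. r *\<^sub>R v c) *s a j = r *\<^sub>R (L j x v *s a j)" for j
          using x by (simp add: L_def Lam_def ccoord_scaleR vec_eq_iff)
        then show ?thesis unfolding l by (simp add: scaleR_sum_right)
      qed
      show "l x (J x v) = \<i> *s l x v" if x: "x \<in> topspace X" "v \<in> tangent_space A x" for x v
      proof -
        obtain N where l: "\<And>v. l x v = (\<Sum>j<N * m. L j x v *s a j)" using fin[OF x(1)] by blast
        have "L j x (J x v) = \<i> * L j x v" for j
          using x by (simp add: L_def Lam_def ccoord_J)
        then show ?thesis unfolding l by (simp add: vec.scale_sum_right)
      qed
      show "v = (\<lambda>_. 0)" if x: "x \<in> topspace X" and v: "v \<in> tangent_space A x" and 0: "l x v = 0" for x v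
      proof (rule ccontr)
        assume "v \<noteq> (\<lambda>_. 0)"
        obtain N where N: "\<forall>i\<ge>N. h i x = 0" and l: "\<And>v. l x v = (\<Sum>j<N * m. L j x v *s a j)"
          using fin[OF x] by blast
        obtain i where i: "h i x \<noteq> 0" using ch(6)[OF x] by blast
        then have xc: "x \<in> fst (c i)" using ch(3,4) by blast
        have "v (c i) \<noteq> 0" using tangent_eqI[OF v tangent_zero ch(1) xc] \<open>v \<noteq> _\<close> by blast
        then obtain u where u: "u \<in> Basis" "v (c i) \<bullet> u \<noteq> 0" using euclidean_all_zero_iff by blast
        then obtain j where j: "j < m" "u = \<beta> j" using \<beta> by (auto simp: bij_betw_def)
        have "Re (ccoord (c i) u x v) \<noteq> 0" using u(2) by (simp add: ccoord_def)
        then have "ccoord (c i) u x v \<noteq> 0" by auto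
        then have "L (i * m + j) x v \<noteq> 0" using i j by (simp add: L_def Lam_def)
        moreover have "i * m + j < N * m"
        proof -
          have "i < N" using i N by (meson not_less)
          then have "(i + 1) * m \<le> N * m" by (intro mult_le_mono1) simp
          then show ?thesis using j(1) by simp
        qed
        ultimately show False using a[OF x v, of "N * m"] 0 l by metis
      qed
      show "isCont (\<lambda>y. l (chart_inv d y) (tvec_of A (chart_inv d y) d e)) (snd d x)" if d: "d \<in> A" "x \<in> fst d" for x d e
      proof -
        have x: "x \<in> topspace X" using d chart_subset by blast
        obtain U N where U: "openin X U" "x \<in> U" and N: "\<forall>i\<ge>N. \<forall>x'\<in>U. h i x' = 0" using ch(7)[OF x] by blast
        have "(\<lambda>y. L j (chart_inv d y) (tvec_of A (chart_inv d y) d e)) differentiable (at (snd d x))" for j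
        proof -
          have "(\<lambda>y. (y, e)) differentiable (at (snd d x))"
            unfolding differentiable_def by (rule exI, rule has_derivative_Pair, rule has_derivative_ident, rule has_derivative_const)
          moreover have "(\<lambda>p. L j (chart_inv d (fst p)) (tvec_of A (chart_inv d (fst p)) d (snd p))) differentiable (at (snd d x, e))"
            unfolding L_def by (rule Lam_differentiable[OF ch(5,2,3,4,1) d])
          ultimately show ?thesis
            using differentiable_compose[of "\<lambda>p. L j (chart_inv d (fst p)) (tvec_of A (chart_inv d (fst p)) d (snd p))" "\<lambda>y. (y, e)"] by simp
        qed
        then have "(\<lambda>y. \<Sum>j<N * m. L j (chart_inv d y) (tvec_of A (chart_inv d y) d e) *s a j) differentiable (at (snd d x))"
          by (intro differentiable_sum ballI differentiable_bounded_linear[OF bounded_linear_scale_vec]) simp_all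
        then have "(\<lambda>y. l (chart_inv d y) (tvec_of A (chart_inv d y) d e)) differentiable (at (snd d x))"
        proof (rule differentiable_local[OF _ open_image[OF d(1) U(1)]])
          show "snd d x \<in> snd d ` (fst d \<inter> U)" using d U(2) by blast
          fix y assume "y \<in> snd d ` (fst d \<inter> U)"
          then have "chart_inv d y \<in> U" using chart_inv_chart[OF d(1)] by auto
          then show "(\<Sum>j<N * m. L j (chart_inv d y) (tvec_of A (chart_inv d y) d e) *s a j) =
              l (chart_inv d y) (tvec_of A (chart_inv d y) d e)"
            using l_eq[of N] N by simp
        qed
        then show ?thesis by (rule differentiable_imp_continuous_within)
      qed
    qed
  qed
next
  case True
  have "c \<in> A \<Longrightarrow> fst c = {}" for c using True chart_subset by blast
  with True show ?thesis by (intro exI[of _ "\<lambda>_ _. 0"], unfold_locales) auto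
qed

section \<open>Orthogonal complements and continuity of flags\<close>

lemma dim_complex_span:
  fixes B :: "(complex ^ 'k) set"
  assumes "finite B" "vec.independent B"
  shows "dim (vec.span B) = 2 * card B"
  using assms
proof (induction B rule: finite_induct)
  case (insert v B)
  define S where "S = vec.span B"
  have ind: "vec.independent B" "v \<notin> S"
    using insert by (auto simp: vec.independent_insert S_def)
  have c: "c *s x \<in> S" if "x \<in> S" for c x using that by (simp add: S_def vec.span_scale)
  have sub: "subspace S"
    unfolding S_def by (rule subspace_if_complex[OF vec.subspace_span])
  have span_S: "span S = S" using sub by (simp add: span_eq_iff)
  have 1: "dim (insert v S) = dim S + 1" using ind(2) by (simp add: dim_insert span_S)
  have "\<i> *s v \<notin> span (insert v S)"
  proof
    assume "\<i> *s v \<in> span (insert v S)"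
    then obtain r where "\<i> *s v - r *\<^sub>R v \<in> S" unfolding span_breakdown_eq span_S by blast
    then have "(\<i> - complex_of_real r) *s v \<in> S" by (simp add: scaleR_vec vec.scale_left_diff_distrib)
    moreover have "\<i> - complex_of_real r \<noteq> 0" by (simp add: complex_eq_iff)
    then have "v = (1 / (\<i> - complex_of_real r)) *s ((\<i> - complex_of_real r) *s v)"
      by (simp only: vec.scale_scale nonzero_divide_eq_eq times_divide_eq_left) simp
    ultimately have "v \<in> S" using c by metis
    then show False using ind(2) by simp
  qed
  then have 2: "dim (insert (\<i> *s v) (insert v S)) = dim S + 2" using 1 by (simp add: dim_insert)
  have "vec.span (insert v B) = span (insert (\<i> *s v) (insert v S))"
  proof (intro subset_antisym subsetI)
    fix x assume "x \<in> vec.span (insert v B)"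
    then obtain k where k: "x - k *s v \<in> S" unfolding vec.span_breakdown_eq S_def by blast
    have "x - Im k *\<^sub>R (\<i> *s v) - Re k *\<^sub>R v = x - k *s v"
      by (subst complex_eq[of k]) (simp add: scaleR_vec vec.scale_left_distrib mult.commute)
    with k show "x \<in> span (insert (\<i> *s v) (insert v S))"
      unfolding span_breakdown_eq span_S by metis
  next
    fix x assume "x \<in> span (insert (\<i> *s v) (insert v S))"
    then obtain p q where "x - p *\<^sub>R (\<i> *s v) - q *\<^sub>R v \<in> S"
      unfolding span_breakdown_eq span_S by blast
    then have "x - (complex_of_real p * \<i> + complex_of_real q) *s v \<in> S"
      by (simp add: scaleR_vec vec.scale_left_distrib diff_diff_eq)
    then show "x \<in> vec.span (insert v B)" unfolding vec.span_breakdown_eq S_def by blast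
  qed
  then show ?case using 2 insert.IH[OF ind(1)] insert.hyps by (simp add: S_def dim_span)
qed simp

lemma dim_complex_subspace:
  fixes S :: "(complex ^ 'k) set"
  assumes "vec.subspace S"
  shows "dim S = 2 * vec.dim S"
proof -
  obtain B where B: "B \<subseteq> S" "vec.independent B" "S \<subseteq> vec.span B" "card B = vec.dim S"
    using vec.basis_exists[of S] by metis
  have "vec.span B = S" using B assms by (meson vec.span_minimal subset_antisym)
  then show ?thesis using dim_complex_span[OF vec.finiteI_independent[OF B(2)] B(2)] B(4) by simp
qed

definition perp :: "'v::real_inner set \<Rightarrow> 'v set" where
  "perp V = {w. \<forall>v\<in>V. w \<bullet> v = 0}"

definition herm :: "complex ^ 'k \<Rightarrow> complex ^ 'k \<Rightarrow> complex" where
  "herm w v = (\<Sum>p\<in>UNIV. cnj (v $ p) * w $ p)"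

lemma herm_scale: "herm (c *s w) v = c * herm w v" "herm w (c *s v) = cnj c * herm w v"
  by (simp_all add: herm_def sum_distrib_left algebra_simps)

lemma herm_add_right: "herm w (u + v) = herm w u + herm w v"
  by (simp add: herm_def sum.distrib algebra_simps)

lemma herm_add_left: "herm (u + v) w = herm u w + herm v w"
  by (simp add: herm_def sum.distrib algebra_simps)

lemma inner_herm: "w \<bullet> v = Re (herm w v)"
  by (simp add: herm_def inner_vec_def inner_complex_def algebra_simps)

lemma perp_herm:
  assumes "vec.subspace V"
  shows "w \<in> perp V \<longleftrightarrow> (\<forall>v\<in>V. herm w v = 0)"
proof
  assume w: "w \<in> perp V"
  have "herm w v = 0" if v: "v \<in> V" for v
  proof -
    have "Re (herm w v) = 0" using w v by (simp add: perp_def inner_herm)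
    moreover have "Re (herm w (\<i> *s v)) = 0"
      using w vec.subspace_scale[OF assms v] by (simp add: perp_def inner_herm)
    ultimately show ?thesis by (simp add: herm_scale complex_eq_iff)
  qed
  then show "\<forall>v\<in>V. herm w v = 0" by blast
qed (simp add: perp_def inner_herm)

lemma perp_complex:
  fixes V :: "(complex ^ 'k) set"
  assumes "vec.subspace V"
  shows "vec.subspace (perp V)" "vec.dim (perp V) + vec.dim V = CARD('k)"
proof -
  show sub: "vec.subspace (perp V)"
  proof -
    have "perp V = {w. \<forall>v\<in>V. herm w v = 0}" using perp_herm[OF assms] by blast
    moreover have "herm 0 v = 0" for v :: "complex ^ 'k" by (simp add: herm_def)
    ultimately show ?thesis by (simp add: vec.subspace_def herm_scale herm_add_left)
  qed
  from dim_subspace_orthogonal_to_vectors[OF subspace_if_complex[OF assms] subspace_UNIV subset_UNIV]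
  have "dim (perp V) + dim V = 2 * CARD('k)"
    by (simp add: perp_def orthogonal_def inner_commute)
  then show "vec.dim (perp V) + vec.dim V = CARD('k)"
    by (simp add: dim_complex_subspace[OF assms] dim_complex_subspace[OF sub])
qed

lemma isCont_vec: "(\<And>i. isCont (\<lambda>y. F y $ i) x) \<Longrightarrow> isCont F x"
  unfolding isCont_def by (rule vec_tendstoI)

lemma isCont_matrix_mult: "isCont F x \<Longrightarrow> isCont G x \<Longrightarrow> isCont (\<lambda>y. F y ** G y) x"
  for F :: "'y::t2_space \<Rightarrow> complex ^ 'b ^ 'c" and G :: "'y \<Rightarrow> complex ^ 'd ^ 'b"
  by (intro isCont_vec) (auto simp: matrix_matrix_mult_def intro!: continuous_intros)

lemma isCont_matrix_inv:
  fixes A :: "complex ^ 'k ^ 'k"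
  assumes "det A \<noteq> 0"
  shows "open {B :: complex ^ 'k ^ 'k. det B \<noteq> 0}" "isCont matrix_inv A"
proof -
  define S where "S = {B :: complex ^ 'k ^ 'k. det B \<noteq> 0}"
  have id: "mrat ((**) (mat \<i>)) T (\<lambda>B. B :: complex ^ 'k ^ 'k)" for T
    unfolding mrat_def by (intro allI rat_lin)
      (auto simp: mat_scalar_mult linear_conv_bounded_linear[symmetric] intro!: linearI)
  have "continuous_on UNIV (\<lambda>B :: complex ^ 'k ^ 'k. det B)" by (rule rat_continuous_on[OF rat_det[OF id]])
  then have "open ((\<lambda>B :: complex ^ 'k ^ 'k. det B) -` (- {0}))" by (intro open_vimage) auto
  moreover have "(\<lambda>B :: complex ^ 'k ^ 'k. det B) -` (- {0}) = S" by (auto simp: S_def)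
  ultimately show op: "open {B :: complex ^ 'k ^ 'k. det B \<noteq> 0}" by (simp add: S_def)
  obtain M' where M': "mrat ((**) (mat \<i>)) S M'" "\<And>B. B \<in> S \<Longrightarrow> matrix_inv B = M' B"
    using mrat_inverse[OF id[of S]] by (auto simp: S_def)
  have "continuous_on S (\<lambda>B. M' B $ i $ j)" for i j
    using M'(1) rat_continuous_on unfolding mrat_def by blast
  then have "isCont (\<lambda>B. M' B $ i $ j) A" for i j
    using op assms unfolding S_def[symmetric] by (auto simp: continuous_on_eq_continuous_at S_def)
  then have "isCont M' A" by (intro isCont_vec)
  moreover have "\<forall>\<^sub>F B in nhds A. M' B = matrix_inv B"
    using op assms M'(2) unfolding eventually_nhds S_def by (metis (mono_tags) mem_Collect_eq)
  ultimately show "isCont matrix_inv A" by (simp add: isCont_cong)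
qed

lemma complex_basis_indexed:
  fixes V :: "(complex ^ 'm) set"
  assumes "vec.subspace V" "vec.dim V = CARD('n::finite)"
  obtains b :: "'n::finite \<Rightarrow> complex ^ 'm" where "vec.span (range b) = V"
proof -
  obtain B where B: "B \<subseteq> V" "vec.independent B" "V \<subseteq> vec.span B" "card B = vec.dim V"
    using vec.basis_exists[of V] by metis
  have "vec.span B = V" using B assms by (meson vec.span_minimal subset_antisym)
  moreover obtain b :: "'n \<Rightarrow> complex ^ 'm" where "bij_betw b UNIV B"
    using finite_same_card_bij[of "UNIV :: 'n set" B] vec.finiteI_independent[OF B(2)] B(4) assms(2) by auto
  ultimately show ?thesis using that[of b] by (simp add: bij_betw_def)
qed

lemma matrix_add_rdistrib: "(B + C) ** A = B ** A + C ** A"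
  for A :: "'a::semiring_1 ^ 'p ^ 'n" and B C :: "'a ^ 'n ^ 'm"
  by (simp add: matrix_matrix_mult_def vec_eq_iff sum.distrib distrib_right)

lemma mem_ssum_range: "z \<in> ssum (range ((*v) A)) (range ((*v) B)) \<longleftrightarrow> (\<exists>s q. z = A *v s + B *v q)"
  by (auto simp: ssum_def)

lemma flag_chart_continuous:
  fixes m :: "'y::t2_space \<Rightarrow> 'e \<Rightarrow> complex ^ ('n::finite \<times> 4)" and f :: "'n frame"
    and I1 :: "complex ^ ('n \<times> 4) ^ ('n \<times> 8)" and R1 :: "complex ^ ('n \<times> 8) ^ ('n \<times> 4)"
  assumes f: "is_frame f" and RI: "\<And>w. R1 *v (I1 *v w) = w"
    and V: "\<forall>\<^sub>F y in nhds y0. vec.subspace (range (m y)) \<and> vec.dim (range (m y)) = CARD('n)"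
    and cont: "\<And>e. isCont (\<lambda>y. m y e) y0"
    and u0: "flag_sub f u0 = (*v) I1 ` perp (range (m y0))" "flag_sup f u0 = range ((*v) I1)"
  shows "\<exists>u. isCont u y0 \<and> (\<forall>\<^sub>F y in nhds y0. flag_sub f (u y) = (*v) I1 ` perp (range (m y)) \<and>
    flag_sup f (u y) = range ((*v) I1))"
proof -
  obtain a b c pa pb pc where fe: "f = (a, b, c)" and "dual_frame a b c pa pb pc" using frame_dual[OF f] by blast
  then interpret dual_frame a b c pa pb pc by blast
  obtain K0 M0 E0 where u0e: "u0 = (K0, M0, E0)" by (cases u0)
  define \<alpha> where "\<alpha> = col1 f u0"
  define \<beta> where "\<beta> = col2 f u0"
  have V0: "vec.subspace (range (m y0))" "vec.dim (range (m y0)) = CARD('n)"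
    using eventually_nhds_x_imp_x[OF V] by auto
  obtain w :: "'n \<Rightarrow> complex ^ ('n \<times> 4)" where w: "vec.span (range w) = range (m y0)"
    using complex_basis_indexed[OF V0] .
  have "\<exists>e. m y0 e = w j" for j
    using w vec.span_base[of "w j" "range w"] by (metis rangeI rangeE)
  then obtain e where e: "\<And>j. m y0 (e j) = w j" by metis
  define Q :: "'y \<Rightarrow> complex ^ ('n \<times> 4) ^ 'n" where "Q y = (\<chi> j p. cnj (m y (e j) $ p))" for y
  have Q_herm: "(Q y *v v) $ j = herm v (m y (e j))" for y v j
    by (simp add: Q_def matrix_vector_mult_def herm_def)
  have Q_perp: "Q y *v v = 0" if "vec.subspace (range (m y))" "v \<in> perp (range (m y))" for y v
    using that perp_herm[OF that(1)] by (simp add: vec_eq_iff Q_herm)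
  have Q_perp0: "v \<in> perp (range (m y0))" if "Q y0 *v v = 0" for v
  proof -
    have 0: "herm v (w j) = 0" for j using that Q_herm[of y0 v j] by (simp add: e)
    have "herm v z = 0" if "z \<in> vec.span (range w)" for z
      using that
    proof (induction rule: vec.span_induct_alt)
      case base show ?case by (simp add: herm_def)
    next
      case (step k x y) then show ?case using 0 by (auto simp: herm_add_right herm_scale)
    qed
    then show ?thesis unfolding perp_herm[OF V0(1)] w by blast
  qed
  have sup: "flag_sup f u0 = ssum (range ((*v) \<alpha>)) (range ((*v) \<beta>))"
    by (simp add: flag_sup_col \<alpha>_def \<beta>_def)
  have in_T: "I1 *v (R1 *v z) = z" if "z \<in> flag_sup f u0" for z
    using that unfolding u0(2) by (auto simp: RI)
  have "\<beta> *v q \<in> flag_sup f u0" for q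
  proof -
    have "\<beta> *v q = \<alpha> *v 0 + \<beta> *v q" by simp
    then show ?thesis unfolding sup ssum_def by blast
  qed
  then have \<beta>_T: "I1 *v (R1 *v (\<beta> *v q)) = \<beta> *v q" for q by (rule in_T)
  txt \<open>Near \<open>y0\<close> the orthogonal complement is the kernel of \<open>Q y\<close>. It is sought as the column space of
    \<open>\<alpha> + \<beta> ** N y\<close>, and \<open>N y\<close> is found by solving \<open>Q y ** R1 ** (\<alpha> + \<beta> ** N y) = 0\<close>.\<close>
  define B where "B y = Q y ** (R1 ** \<beta>)" for y
  define N where "N y = - (matrix_inv (B y) ** (Q y ** (R1 ** \<alpha>)))" for y
  have B0: "det (B y0) \<noteq> 0"
    unfolding det_nz_iff_inj
  proof (intro allI impI)
    fix q assume "B y0 *v q = 0"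
    then have "R1 *v (\<beta> *v q) \<in> perp (range (m y0))"
      by (intro Q_perp0) (simp add: B_def matrix_vector_mul_assoc matrix_mul_assoc)
    then have "\<beta> *v q \<in> flag_sub f u0" unfolding u0(1) using \<beta>_T[of q] by (metis image_eqI)
    then obtain s where "\<alpha> *v s = \<beta> *v q" unfolding flag_sub_col \<alpha>_def by auto
    then show "q = 0" using col_inj unfolding \<alpha>_def \<beta>_def fe by blast
  qed
  have contQ: "isCont Q y0"
  proof (intro isCont_vec)
    show "isCont (\<lambda>y. Q y $ j $ p) y0" for j p
      unfolding Q_def vec_lambda_beta using cont[of "e j"] by (intro continuous_intros) simp_all
  qed
  have contB: "isCont B y0" unfolding B_def by (intro isCont_matrix_mult contQ continuous_const)
  have contN: "isCont N y0"
    unfolding N_def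
    by (intro continuous_minus isCont_matrix_mult contQ continuous_const isCont_o2[OF contB isCont_matrix_inv(2)[OF B0]])
  define u where "u y = (K0 + N y, M0 + E0 ** N y, E0)" for y
  have col: "col1 f (u y) = \<alpha> + \<beta> ** N y" "col2 f (u y) = \<beta>" for y
    by (simp_all add: u_def \<alpha>_def \<beta>_def fe u0e col_simps matrix_add_ldistrib matrix_add_rdistrib
        matrix_mul_assoc algebra_simps)
  have "isCont u y0" unfolding u_def by (intro continuous_intros isCont_matrix_mult contN)
  moreover have "\<forall>\<^sub>F y in nhds y0. det (B y) \<noteq> 0"
  proof -
    have "(B \<longlongrightarrow> B y0) (nhds y0)"
      using contB tendsto_at_iff_tendsto_nhds[of B y0] unfolding isCont_def by blast
    from topological_tendstoD[OF this isCont_matrix_inv(1)[OF B0]] show ?thesis using B0 by simp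
  qed
  then have "\<forall>\<^sub>F y in nhds y0. flag_sub f (u y) = (*v) I1 ` perp (range (m y)) \<and> flag_sup f (u y) = range ((*v) I1)"
    using V
  proof eventually_elim
    case (elim y)
    have sup_y: "flag_sup f (u y) = flag_sup f u0"
    proof -
      have "\<exists>s' q'. (\<alpha> + \<beta> ** N y) *v s + \<beta> *v q = \<alpha> *v s' + \<beta> *v q'" for s q
        by (intro exI[of _ s] exI[of _ "N y *v s + q"])
          (simp add: matrix_vector_mult_add_rdistrib matrix_vector_right_distrib matrix_vector_mul_assoc)
      moreover have "\<exists>s' q'. \<alpha> *v s + \<beta> *v q = (\<alpha> + \<beta> ** N y) *v s' + \<beta> *v q'" for s q
        by (intro exI[of _ s] exI[of _ "q - N y *v s"])
          (simp add: matrix_vector_mult_add_rdistrib matrix_vector_mult_diff_distrib matrix_vector_mul_assoc)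
      ultimately have "z \<in> flag_sup f (u y) \<longleftrightarrow> z \<in> flag_sup f u0" for z
        unfolding flag_sup_col[of f "u y"] sup col mem_ssum_range by metis
      then show ?thesis by blast
    qed
    have "(*v) I1 ` perp (range (m y)) \<subseteq> flag_sub f (u y)"
    proof (rule image_subsetI)
      fix v assume v: "v \<in> perp (range (m y))"
      have "I1 *v v \<in> flag_sup f u0" unfolding u0(2) by blast
      then obtain s q where sq: "I1 *v v = \<alpha> *v s + \<beta> *v q" unfolding sup ssum_def by blast
      have "v = R1 *v (I1 *v v)" by (simp add: RI)
      also have "\<dots> = (R1 ** \<alpha>) *v s + (R1 ** \<beta>) *v q"
        unfolding sq by (simp add: matrix_vector_right_distrib matrix_vector_mul_assoc)
      finally have "Q y *v ((R1 ** \<alpha>) *v s + (R1 ** \<beta>) *v q) = 0" using Q_perp v elim by metis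
      then have "B y *v q = - ((Q y ** (R1 ** \<alpha>)) *v s)"
        by (simp add: B_def matrix_vector_right_distrib matrix_vector_mul_assoc eq_neg_iff_add_eq_0 add.commute)
      then have "matrix_inv (B y) *v (B y *v q) = matrix_inv (B y) *v (- ((Q y ** (R1 ** \<alpha>)) *v s))" by simp
      then have "q = - ((matrix_inv (B y) ** (Q y ** (R1 ** \<alpha>))) *v s)"
        using matrix_inv_mult(2)[OF elim(1)] by (simp add: matrix_vector_mul_assoc vec.neg)
      also have "\<dots> = N y *v s" by (simp add: N_def vec_eq_iff matrix_vector_mult_def sum_negf)
      finally have "I1 *v v = (\<alpha> + \<beta> ** N y) *v s"
        using sq by (simp add: matrix_vector_mult_add_rdistrib matrix_vector_mul_assoc)
      then show "I1 *v v \<in> flag_sub f (u y)" unfolding flag_sub_col col by blast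
    qed
    moreover have "vec.dim ((*v) I1 ` perp (range (m y))) = 3 * CARD('n)"
    proof -
      have "inj ((*v) I1)" by (rule inj_on_inverseI[of _ "(*v) R1"]) (rule RI)
      then have "vec.dim ((*v) I1 ` perp (range (m y))) = vec.dim (perp (range (m y)))"
        by (intro vec.dim_image_eq) (auto intro: inj_on_subset)
      then show ?thesis using perp_complex(2)[of "range (m y)"] elim by simp
    qed
    moreover have "vec.subspace ((*v) I1 ` perp (range (m y)))"
      by (intro vec.linear_subspace_image perp_complex) (use elim in auto)
    ultimately have "(*v) I1 ` perp (range (m y)) = flag_sub f (u y)"
      using flag_in_grassmannian(1)[OF f, of "u y"] unfolding grassmannian_def
      by (intro vec.subspace_dim_equal) auto
    then show ?case using sup_y u0(2) by simp
  qed
  ultimately show ?thesis by blast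
qed

section \<open>The formal solution\<close>

lemma ambient_splitting:
  obtains I1 I2 :: "complex ^ ('n::finite \<times> 4) ^ ('n \<times> 8)" and R1 R2 :: "complex ^ ('n \<times> 8) ^ ('n \<times> 4)"
  where "\<And>w. R1 *v (I1 *v w) = w" "\<And>w. R2 *v (I2 *v w) = w" "\<And>w. R1 *v (I2 *v w) = 0"
    "\<And>w. R2 *v (I1 *v w) = 0" "\<And>z. I1 *v (R1 *v z) + I2 *v (R2 *v z) = z"
proof -
  have "card (UNIV :: ('n \<times> 4 + 'n \<times> 4) set) = card (UNIV :: ('n \<times> 8) set)"
    by (simp add: card_UNIV_sum)
  then obtain e :: "'n \<times> 4 + 'n \<times> 4 \<Rightarrow> 'n \<times> 8" where bij: "bij e"
    using finite_same_card_bij[OF finite finite] by blast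
  have e: "e a = e b \<longleftrightarrow> a = b" "\<exists>a. p = e a" for a b p
    using bij_is_inj[OF bij] surjD[OF bij_is_surj[OF bij]] by (simp_all only: inj_eq)
  define I1 :: "complex ^ ('n \<times> 4) ^ ('n \<times> 8)" where "I1 = (\<chi> p q. if p = e (Inl q) then 1 else 0)"
  define I2 :: "complex ^ ('n \<times> 4) ^ ('n \<times> 8)" where "I2 = (\<chi> p q. if p = e (Inr q) then 1 else 0)"
  define R1 :: "complex ^ ('n \<times> 8) ^ ('n \<times> 4)" where "R1 = (\<chi> q p. if p = e (Inl q) then 1 else 0)"
  define R2 :: "complex ^ ('n \<times> 8) ^ ('n \<times> 4)" where "R2 = (\<chi> q p. if p = e (Inr q) then 1 else 0)"
  have I: "(I1 *v w) $ e (Inl q) = w $ q" "(I1 *v w) $ e (Inr q) = 0"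
    "(I2 *v w) $ e (Inl q) = 0" "(I2 *v w) $ e (Inr q) = w $ q" for w q
    by (simp_all add: I1_def I2_def matrix_vector_mult_def e(1) if_distribR if_distrib[where f="\<lambda>x. x * _"] sum.delta' sum.delta cong: if_cong)
  have R: "(R1 *v z) $ q = z $ e (Inl q)" "(R2 *v z) $ q = z $ e (Inr q)" for z q
    by (simp_all add: R1_def R2_def matrix_vector_mult_def if_distribR if_distrib[where f="\<lambda>x. x * _"] sum.delta' sum.delta cong: if_cong)
  show ?thesis
  proof (rule that[of R1 I1 R2 I2])
    show "I1 *v (R1 *v z) + I2 *v (R2 *v z) = z" for z
    proof (rule vec_eq_iff[THEN iffD2], rule allI)
      fix p
      obtain a where "p = e a" using e(2) by blast
      then show "(I1 *v (R1 *v z) + I2 *v (R2 *v z)) $ p = z $ p" by (cases a) (simp_all add: I R)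
    qed
  qed (simp_all add: vec_eq_iff I R del: split_paired_All)
qed

lemma complex_subspace_exists:
  assumes "k \<le> CARD('m::finite)"
  shows "\<exists>W :: (complex ^ 'm) set. vec.subspace W \<and> vec.dim W = k"
proof -
  obtain B :: "(complex ^ 'm) set" where B: "vec.independent B" "card B = vec.dim (UNIV :: (complex ^ 'm) set)"
    using vec.basis_exists[of UNIV] by metis
  obtain B' where B': "B' \<subseteq> B" "card B' = k"
    using obtain_subset_with_card_n[of k B] assms by (auto simp: B(2) card_cart_basis)
  have "vec.independent B'" using B(1) B'(1) vec.independent_mono by blast
  from vec.dim_span_eq_card_independent[OF this] have "vec.dim (vec.span B') = k" by (simp only: B'(2))
  then show ?thesis using vec.subspace_span by blast
qed

definition cnjv :: "complex ^ 'k \<Rightarrow> complex ^ 'k" where "cnjv u = (\<chi> i. cnj (u $ i))"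

lemma cnjv_simps: "cnjv (u + v) = cnjv u + cnjv v" "cnjv (r *\<^sub>R u) = r *\<^sub>R cnjv u"
  "cnjv (\<i> *s u) = - (\<i> *s cnjv u)" "cnjv u = 0 \<longleftrightarrow> u = 0"
  by (simp_all add: cnjv_def vec_eq_iff)

lemma isCont_mult_vec: "isCont F x \<Longrightarrow> isCont (\<lambda>y. M *v F y) x"
  for F :: "'y::t2_space \<Rightarrow> complex ^ 'b" and M :: "complex ^ 'b ^ 'c"
  by (intro isCont_vec) (auto simp: matrix_vector_mult_def intro!: continuous_intros)

lemma isCont_cnjv: "isCont F x \<Longrightarrow> isCont (\<lambda>y. cnjv (F y)) x"
  for F :: "'y::t2_space \<Rightarrow> complex ^ 'b"
  by (intro isCont_vec) (auto simp: cnjv_def intro!: continuous_intros)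

locale solution_data = tangent_mono X A J l
  for X :: "'a topology" and A :: "('a, 'e::euclidean_space) chart set" and J
    and l :: "'a \<Rightarrow> ('a, 'e) tvec \<Rightarrow> complex ^ ('n::finite \<times> 4)" +
  fixes I1 I2 :: "complex ^ ('n \<times> 4) ^ ('n \<times> 8)" and R1 R2 :: "complex ^ ('n \<times> 8) ^ ('n \<times> 4)"
    and W :: "(complex ^ ('n \<times> 4)) set"
  assumes dim: "DIM('e) = 2 * CARD('n)"
    and IR: "\<And>w. R1 *v (I1 *v w) = w" "\<And>w. R2 *v (I2 *v w) = w" "\<And>w. R1 *v (I2 *v w) = 0"
    "\<And>w. R2 *v (I1 *v w) = 0" "\<And>z. I1 *v (R1 *v z) + I2 *v (R2 *v z) = z"
    and W: "vec.subspace W" "vec.dim W = 3 * CARD('n)"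
begin

definition V :: "'a \<Rightarrow> (complex ^ ('n \<times> 4)) set" where "V x = l x ` tangent_space A x"

definition P :: "'a \<Rightarrow> 'n zpoint" where
  "P x = (0, (*v) I1 ` perp (V x), (*v) I2 ` W, range ((*v) I1), range ((*v) I2))"

definition hor :: "'a \<Rightarrow> ('a, 'e) tvec \<Rightarrow> 'n amb" where
  "hor x v = I1 *v l x v + I2 *v cnjv (l x v)"

definition \<sigma> :: "'a \<Rightarrow> ('a, 'e, 'n zpoint, 'n zmodel) jet" where
  "\<sigma> x = (x, P x, restrict (\<lambda>v. hz (P x) (hor x v)) (tangent_space A x))"

lemma V_range:
  assumes c: "c \<in> A" "x \<in> fst c"
  shows "V x = range (\<lambda>e. l x (tvec_of A x c e))"
  unfolding V_def
proof (intro subset_antisym subsetI)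
  fix u assume "u \<in> l x ` tangent_space A x"
  then obtain v where v: "v \<in> tangent_space A x" "u = l x v" by (rule imageE)
  have "u = l x (tvec_of A x c (v c))" unfolding tvec_of_eq[OF v(1) c] by (rule v(2))
  then show "u \<in> range (\<lambda>e. l x (tvec_of A x c e))" by (rule range_eqI)
next
  fix u assume "u \<in> range (\<lambda>e. l x (tvec_of A x c e))"
  then obtain e where e: "u = l x (tvec_of A x c e)" by (rule rangeE)
  show "u \<in> l x ` tangent_space A x" unfolding e by (rule imageI[OF tvec_of_tangent[OF c]])
qed

lemma linear_l: "c \<in> A \<Longrightarrow> x \<in> fst c \<Longrightarrow> linear (\<lambda>e. l x (tvec_of A x c e))"
  using chart_subset[of c]
  by (intro linearI) (auto simp: tvec_of_add tvec_of_scaleR l_add l_scaleR tvec_of_tangent subset_iff)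

lemma V_subspace:
  assumes x: "x \<in> topspace X"
  shows "vec.subspace (V x)" "subspace (V x)" "vec.dim (V x) = CARD('n)"
proof -
  obtain c where c: "c \<in> A" "x \<in> fst c" using x mfd(3) by (auto simp: carrier_of_def)
  show sub: "subspace (V x)"
    unfolding V_range[OF c] by (rule linear_subspace_image[OF linear_l[OF c] subspace_UNIV])
  have "k *s u \<in> V x" if u: "u \<in> V x" for k u
  proof -
    obtain v where v: "v \<in> tangent_space A x" "u = l x v" using u by (auto simp: V_def)
    have "\<i> *s u = l x (J x v)" using l_J[OF x v(1)] v(2) by simp
    then have iu: "\<i> *s u \<in> V x" using J_tangent[OF x v(1)] by (auto simp: V_def)
    have "k *s u = Re k *\<^sub>R u + Im k *\<^sub>R (\<i> *s u)"
      by (simp add: vec_eq_iff complex_eq_iff del: split_paired_All)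
    then show ?thesis using sub u iu by (simp add: subspace_add subspace_scale)
  qed
  then show vs: "vec.subspace (V x)"
    using sub unfolding vec.subspace_def subspace_def by blast
  have "inj (\<lambda>e. l x (tvec_of A x c e))"
    unfolding linear_injective_0[OF linear_l[OF c]]
  proof (intro allI impI)
    fix e assume "l x (tvec_of A x c e) = 0"
    then have "tvec_of A x c e = (\<lambda>_. 0)" by (rule l_inj[OF x tvec_of_tangent[OF c]])
    then show "e = 0" using tvec_of_self[OF c, of e] by simp
  qed
  then have "dim (V x) = DIM('e)"
    unfolding V_range[OF c] using dim_image_eq[OF linear_l[OF c], of UNIV] by simp
  then show "vec.dim (V x) = CARD('n)" using dim_complex_subspace[OF vs] dim by simp
qed

lemma inj_I: "inj ((*v) I1)" "inj ((*v) I2)"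
  by (rule inj_on_inverseI[of _ "(*v) R1"], rule IR) (rule inj_on_inverseI[of _ "(*v) R2"], rule IR)

lemma grassmannian_image:
  fixes M :: "complex ^ 'b ^ 'c"
  assumes "inj ((*v) M)" "vec.subspace S" "vec.dim S = k"
  shows "(*v) M ` S \<in> grassmannian k"
  unfolding grassmannian_def
  using vec.linear_subspace_image[OF _ assms(2), of "(*v) M"] vec.dim_image_eq[of "(*v) M" S] assms
  by (auto intro: inj_on_subset)

lemma P_in_Z:
  assumes x: "x \<in> topspace X"
  shows "P x \<in> Z_space"
proof -
  have "vec.dim (perp (V x)) = 3 * CARD('n)"
    using perp_complex(2)[OF V_subspace(1)[OF x]] V_subspace(3)[OF x] by simp
  moreover have "range ((*v) I1) \<inter> range ((*v) I2) = {0}"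
  proof -
    have "I1 *v w = 0" if "I1 *v w = I2 *v w'" for w w'
      using arg_cong[OF that, of "(*v) R1"] by (simp add: IR)
    moreover have "0 \<in> range ((*v) I1) \<inter> range ((*v) I2)"
      using rangeI[of "(*v) I1" 0] rangeI[of "(*v) I2" 0] by simp
    ultimately show ?thesis by blast
  qed
  moreover have "ssum (range ((*v) I1)) (range ((*v) I2)) = UNIV"
    using IR(5) by (metis UNIV_eq_I mem_ssum_range)
  moreover have "range ((*v) M) \<in> grassmannian (4 * CARD('n))" if "inj ((*v) M)"
    for M :: "complex ^ ('n \<times> 4) ^ ('n \<times> 8)"
    by (rule grassmannian_image[OF that vec.subspace_UNIV]) (simp add: card_cart_basis)
  ultimately show ?thesis
    unfolding P_def Z_space_def mem_Collect_eq prod.case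
    using inj_I W perp_complex(1)[OF V_subspace(1)[OF x]]
    by (intro conjI grassmannian_image image_mono subset_UNIV) (simp_all add: card_cart_basis)
qed

lemma D_fibre_P: "z \<in> D_fibre (P x) \<longleftrightarrow> R1 *v z \<in> perp (V x)"
proof
  assume "z \<in> D_fibre (P x)"
  then obtain s w where "s \<in> perp (V x)" "z = I1 *v s + I2 *v w"
    by (auto simp: D_fibre_def P_def ssum_def)
  then show "R1 *v z \<in> perp (V x)" by (simp add: matrix_vector_right_distrib IR)
next
  assume "R1 *v z \<in> perp (V x)"
  then have "I1 *v (R1 *v z) \<in> (*v) I1 ` perp (V x)" by blast
  then show "z \<in> D_fibre (P x)"
    unfolding D_fibre_def P_def prod.case ssum_def mem_Collect_eq
    by (intro exI[of _ "I1 *v (R1 *v z)"] exI[of _ "I2 *v (R2 *v z)"] conjI IR(5)[symmetric] rangeI)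
qed

lemma jet:
  assumes x: "x \<in> topspace X"
  shows "horizontal_jet A x (J x) (P x) (\<lambda>v. I1 *v l x v) (\<lambda>v. I2 *v cnjv (l x v))"
proof
  show "x \<in> carrier_of A" using x mfd(3) by simp
  show "DIM('e) = 2 * CARD('n)" by (rule dim)
  show "P x \<in> Z_space" by (rule P_in_Z[OF x])
  show "I2 *v cnjv (l x v) \<in> snd (snd (snd (snd (P x))))" for v by (simp add: P_def)
  show "v = (\<lambda>_. 0)" if v: "v \<in> tangent_space A x" and 0: "I2 *v cnjv (l x v) = 0" for v
    using arg_cong[OF 0, of "(*v) R2"] by (intro l_inj[OF x v]) (simp add: IR cnjv_simps)
  show "v = (\<lambda>_. 0)" if v: "v \<in> tangent_space A x" and D: "I1 *v l x v \<in> D_fibre (P x)" for v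
  proof (rule l_inj[OF x v])
    have "l x v \<in> perp (V x)" using D by (simp add: D_fibre_P IR)
    then have "l x v \<bullet> l x v = 0" using v unfolding perp_def V_def by blast
    then show "l x v = 0" by simp
  qed
  show "\<exists>v\<in>tangent_space A x. z - I1 *v l x v \<in> D_fibre (P x)" for z
  proof -
    obtain y w where yw: "y \<in> span (V x)" "\<And>u. u \<in> span (V x) \<Longrightarrow> orthogonal w u" "R1 *v z = y + w"
      using orthogonal_subspace_decomp_exists[of "V x" "R1 *v z"] by metis
    have sp: "span (V x) = V x" using V_subspace(2)[OF x] by (simp add: span_eq_iff)
    obtain v where v: "v \<in> tangent_space A x" "y = l x v" using yw(1)[unfolded sp] unfolding V_def by blast
    have "R1 *v (z - I1 *v l x v) = w"
      using yw(3) by (simp add: matrix_vector_mult_diff_distrib IR v(2))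
    moreover have "w \<in> perp (V x)" using yw(2) unfolding sp perp_def orthogonal_def by blast
    ultimately show ?thesis using v(1) by (metis D_fibre_P)
  qed
qed (use x in \<open>simp_all add: J_tangent J_J l_add l_scaleR l_J cnjv_simps matrix_vector_right_distrib
    matrix_vector_scaleR vec.scale vec.neg\<close>)

lemma \<sigma>_in_R_I:
  assumes "x \<in> topspace X"
  shows "\<sigma> x \<in> R_I A"
proof -
  interpret H: horizontal_jet A x "J x" "P x" "\<lambda>v. I1 *v l x v" "\<lambda>v. I2 *v cnjv (l x v)"
    by (rule jet[OF assms])
  show ?thesis using H.jet_in_R_I by (simp add: \<sigma>_def hor_def H.L_def)
qed

lemma \<sigma>_continuous: "continuous_map X (jet_topology A Z_atlas) \<sigma>"
proof -
  have jet1: "\<sigma> x \<in> jet1 A Z_atlas" if "x \<in> topspace X" for x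
    using \<sigma>_in_R_I[OF that] by (auto simp: R_I_def R_ac_def)
  have carrier: "\<sigma> x \<in> carrier_of {jet_chart A Z_atlas c d |c d. c \<in> A \<and> d \<in> Z_atlas}"
    if x: "x \<in> topspace X" for x
  proof -
    obtain c where c: "c \<in> A" "x \<in> fst c" using x mfd(3) by (auto simp: carrier_of_def)
    obtain d :: "('n zpoint, 'n zmodel) chart" where d: "d \<in> Z_atlas" "P x \<in> fst d"
      using Z_chart_exists[OF P_in_Z[OF x]] by blast
    have "\<sigma> x \<in> fst (jet_chart A Z_atlas c d)"
      using jet1[OF x] c(2) d(2) by (simp add: jet_chart_def \<sigma>_def)
    then show ?thesis unfolding carrier_of_def using c(1) d(1) by blast
  qed
  have "openin X (\<sigma> -` U \<inter> topspace X)" if c: "c \<in> A" and d: "d \<in> Z_atlas" and O': "open O'"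
    and U: "U = fst (jet_chart A Z_atlas c d) \<inter> snd (jet_chart A Z_atlas c d) -` O'"
    for c and d :: "('n zpoint, 'n zmodel) chart" and O' U
    unfolding openin_subopen[of X "\<sigma> -` U \<inter> topspace X"]
  proof
    fix x0 assume "x0 \<in> \<sigma> -` U \<inter> topspace X"
    then have x0: "x0 \<in> topspace X" and \<sigma>0: "\<sigma> x0 \<in> U" by auto
    have xc: "x0 \<in> fst c" and Pd: "P x0 \<in> fst d" and O0: "snd (jet_chart A Z_atlas c d) (\<sigma> x0) \<in> O'"
      using \<sigma>0 unfolding U by (auto simp: jet_chart_def \<sigma>_def)
    define y0 where "y0 = snd c x0"
    have inv0: "chart_inv c y0 = x0" unfolding y0_def by (rule chart_inv_chart[OF c xc])
    obtain f g where f: "is_frame f" and g: "is_frame g" and de: "d = zchart f g" using d by (rule Z_atlasE)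
    obtain z0 u0 w0 where P0: "P x0 = Z_param f g (z0, u0, w0)"
      using Pd unfolding de mem_fst_zchart[OF f g] by (metis prod.collapse)
    then have flags: "flag_sub f u0 = (*v) I1 ` perp (V x0)" "flag_sup f u0 = range ((*v) I1)"
      "flag_sub g w0 = (*v) I2 ` W" "flag_sup g w0 = range ((*v) I2)"
      by (simp_all add: P_def Z_param_def)
    define m where "m y e = l (chart_inv c y) (tvec_of A (chart_inv c y) c e)" for y e
    have in\<Omega>: "\<forall>\<^sub>F y in nhds y0. y \<in> snd c ` fst c"
      by (rule eventually_nhds_in_open[OF chart_open(2)[OF c]]) (simp add: y0_def xc)
    have m\<Omega>: "range (m y) = V (chart_inv c y) \<and> chart_inv c y \<in> fst c \<and> snd c (chart_inv c y) = y \<and> linear (m y)"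
      if "y \<in> snd c ` fst c" for y
      using that chart_inv_chart[OF c] V_range[OF c] linear_l[OF c] by (auto simp: m_def[abs_def])
    have "\<forall>\<^sub>F y in nhds y0. vec.subspace (range (m y)) \<and> vec.dim (range (m y)) = CARD('n)"
      using in\<Omega>
    proof eventually_elim
      case (elim y)
      then show ?case using m\<Omega>[OF elim] V_subspace chart_subset[OF c] by auto
    qed
    moreover have mcont: "isCont (\<lambda>y. m y e) y0" for e
      unfolding m_def y0_def by (rule l_cont[OF c xc])
    moreover have "flag_sub f u0 = (*v) I1 ` perp (range (m y0))"
      using flags(1) m\<Omega>[of y0] xc inv0 by (auto simp: y0_def)
    ultimately obtain u where u: "isCont u y0" and uf: "\<forall>\<^sub>F y in nhds y0.
        flag_sub f (u y) = (*v) I1 ` perp (range (m y)) \<and> flag_sup f (u y) = range ((*v) I1)"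
      using flag_chart_continuous[OF f IR(1) _ _ _ flags(2)] by blast
    define G where "G y e = (I1 *v m y e + I2 *v cnjv (m y e), 0 :: 'n fcoord \<times> 'n fcoord)" for y e
    define F where "F y = (y, (0 :: 'n amb, u y, w0), Blinfun (G y))" for y
    have blG: "bounded_linear (G y)" if "y \<in> snd c ` fst c" for y
      unfolding linear_conv_bounded_linear[symmetric] using m\<Omega>[OF that]
      by (intro linearI) (simp_all add: G_def linear_add linear_cmul cnjv_simps
          matrix_vector_right_distrib matrix_vector_scaleR scaleR_add_right)
    have "isCont (\<lambda>y. Blinfun (G y)) y0"
    proof (rule continuous_blinfun_componentwiseI1)
      fix e :: 'e
      have G: "isCont (\<lambda>y. G y e) y0"
        unfolding G_def by (intro continuous_intros isCont_mult_vec isCont_cnjv mcont)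
      have ev: "\<forall>\<^sub>F y in nhds y0. blinfun_apply (Blinfun (G y)) e = G y e"
        using in\<Omega> by eventually_elim (simp add: bounded_linear_Blinfun_apply blG)
      show "isCont (\<lambda>y. blinfun_apply (Blinfun (G y)) e) y0" unfolding isCont_cong[OF ev] by (rule G)
    qed
    then have Fc: "isCont F y0" unfolding F_def by (intro continuous_intros u)
    have eq: "\<forall>\<^sub>F y in nhds y0. \<sigma> (chart_inv c y) \<in> fst (jet_chart A Z_atlas c d) \<and>
        snd (jet_chart A Z_atlas c d) (\<sigma> (chart_inv c y)) = F y \<and> chart_inv c y \<in> fst c \<and> snd c (chart_inv c y) = y"
      using in\<Omega> uf
    proof eventually_elim
      case (elim y)
      define x where "x = chart_inv c y"
      note my = m\<Omega>[OF elim(1), folded x_def]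
      have x: "x \<in> topspace X" using my chart_subset[OF c] by blast
      have Px: "P x = Z_param f g (0, u y, w0)"
        using elim(2) my flags by (simp add: P_def Z_param_def)
      then have "(0, u y, w0) \<in> Z_dom f g" using P_in_Z[OF x] by (simp add: Z_dom_def)
      then have Pxd: "P x \<in> fst d" unfolding de mem_fst_zchart[OF f g] using Px by blast
      have sPx: "snd d (P x) = (0, u y, w0)" unfolding de Px by (rule snd_zchart[OF f g])
      have "hz (P x) (hor x (tvec_of A x c e)) d = G y e" for e
        using d Pxd by (simp add: hz_def hor_def G_def m_def x_def)
      then have "snd (jet_chart A Z_atlas c d) (\<sigma> x) = F y"
        using my sPx tvec_of_tangent[OF c, of x] by (simp add: jet_chart_def \<sigma>_def F_def)
      then show ?case
        using my Pxd jet1[OF x] unfolding x_def[symmetric] by (simp add: jet_chart_def \<sigma>_def)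
    qed
    have "F y0 \<in> O'" using eventually_nhds_x_imp_x[OF eq] O0 inv0 by simp
    have "(F \<longlongrightarrow> F y0) (nhds y0)"
      using Fc tendsto_at_iff_tendsto_nhds[of F y0] unfolding isCont_def by blast
    from topological_tendstoD[OF this O' \<open>F y0 \<in> O'\<close>] eq
    have "\<forall>\<^sub>F y in nhds y0. \<sigma> (chart_inv c y) \<in> U \<and> chart_inv c y \<in> fst c"
      by eventually_elim (simp add: U)
    then obtain N where N: "open N" "y0 \<in> N" "\<And>y. y \<in> N \<Longrightarrow> \<sigma> (chart_inv c y) \<in> U"
      unfolding eventually_nhds by blast
    have "{x \<in> fst c. snd c x \<in> N} \<subseteq> \<sigma> -` U \<inter> topspace X"
    proof
      fix x assume x: "x \<in> {x \<in> fst c. snd c x \<in> N}"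
      then have "\<sigma> (chart_inv c (snd c x)) \<in> U" using N(3) by blast
      then show "x \<in> \<sigma> -` U \<inter> topspace X"
        using x chart_inv_chart[OF c, of x] chart_subset[OF c] by auto
    qed
    moreover have "x0 \<in> {x \<in> fst c. snd c x \<in> N}" using xc N(2) by (simp add: y0_def)
    ultimately show "\<exists>T. openin X T \<and> x0 \<in> T \<and> T \<subseteq> \<sigma> -` U \<inter> topspace X"
      using openin_preimage[OF c N(1)] by blast
  qed
  moreover have "\<sigma> -` (fst C \<inter> snd C -` O') \<inter> topspace X = {x \<in> topspace X. \<sigma> x \<in> fst C \<and> snd C (\<sigma> x) \<in> O'}"
    for C :: "(('a, 'e, 'n zpoint, 'n zmodel) jet, 'e \<times> 'n zmodel \<times> ('e \<Rightarrow>\<^sub>L 'n zmodel)) chart" and O'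
    by auto
  ultimately show ?thesis
    unfolding jet_topology_def
    by (intro continuous_map_chart_topology carrier) (clarsimp simp del: split_paired_All, metis)
qed

end

theorem theorem1p3:
  fixes X :: "'a topology"
    and A :: "('a, 'e::euclidean_space) chart set"
    and J :: "'a \<Rightarrow> ('a, 'e) tvec \<Rightarrow> ('a, 'e) tvec"
  assumes "almost_complex_manifold X A J"
    and "DIM('e) = 2 * CARD('n::finite)"
  shows "\<exists>\<sigma> :: 'a \<Rightarrow> ('a, 'e, 'n zpoint, 'n zmodel) jet.
           formal_solution X A Z_atlas (R_I A) \<sigma>"
proof -
  interpret almost_complex X A J by (rule almost_complex.intro[OF assms(1)])
  have "DIM('e) < CARD('n \<times> 4)" using assms(2) by simp
  then obtain l :: "'a \<Rightarrow> ('a, 'e) tvec \<Rightarrow> complex ^ ('n \<times> 4)" where l: "tangent_mono X A J l"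
    using tangent_monomorphism by blast
  obtain W :: "(complex ^ ('n \<times> 4)) set" where W: "vec.subspace W" "vec.dim W = 3 * CARD('n)"
    using complex_subspace_exists[where 'm = "'n \<times> 4" and k = "3 * CARD('n)"] by auto
  show ?thesis
  proof (rule ambient_splitting)
    fix I1 I2 :: "complex ^ ('n \<times> 4) ^ ('n \<times> 8)" and R1 R2 :: "complex ^ ('n \<times> 8) ^ ('n \<times> 4)"
    assume IR: "\<And>w. R1 *v (I1 *v w) = w" "\<And>w. R2 *v (I2 *v w) = w" "\<And>w. R1 *v (I2 *v w) = 0"
      "\<And>w. R2 *v (I1 *v w) = 0" "\<And>z. I1 *v (R1 *v z) + I2 *v (R2 *v z) = z"
    interpret S: solution_data X A J l I1 I2 R1 R2 W
      by (intro solution_data.intro l solution_data_axioms.intro assms(2) IR W)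
    show ?thesis
      unfolding formal_solution_def
      using S.\<sigma>_continuous S.\<sigma>_in_R_I by (intro exI[of _ S.\<sigma>]) (simp add: S.\<sigma>_def)
  qed
qed

end
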